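(* Let $\mathcal{M}$ be a connected Riemannian manifold, $R:T\mathcal{M}\to\mathcal{M}$ a retraction, $F:\mathcal{M}\to\mathbb{R}$ a $C^1$ function, $K$ a compact subset of $\mathcal{M}$, and $A>0$ a constant such that $\nabla F$ is $R$-Lipschitz on $K$ up to radius $A$. Let $\{(\Omega_t,\mathcal{F}_t,\mu_t)\}_{t=0}^\infty$ be a sequence of probability spaces and $\{H_t:\mathcal{M}\times\Omega_t\to T\mathcal{M}\}_{t=0}^\infty$ a sequence of functions such that: (a) for all $t\ge 0$ and $\omega\in\Omega_t$, $H_t(\bullet,\omega)$ is a tangent vector field on $\mathcal{M}$; (b) either, for every $t\ge 0$, $\Omega_t$ is a finite set and $\mathcal{F}_t$ consists of all subsets of $\Omega_t$; or, for every $t\ge 0$, $H_t:(\mathcal{M}\times\Omega_t,\mathcal{B}_{\mathcal{M}}\otimes\mathcal{F}_t)\to(T\mathcal{M},\mathcal{B}_{T\mathcal{M}})$ is measurable; (c) $\int_{\Omega_t}H_t(x,\omega)\,d\mu_t=\nabla F(x)$ for all $t\ge 0$ and $x\in\mathcal{M}$; (d) $\|H_t(x,\omega)\|_x\le A$ for all $t\ge 0$, $x\in K$ and $\omega\in\Omega_t$. Let $\{\omega_t\}_{t=0}^\infty$ be a sequence of independent random variables such that $\omega_t$ takes values in $\Omega_t$ with probability distribution $\mu_t$. Let $\{\gamma_t\}_{t=0}^\infty$ be a sequence of positive numbers with $\sum_{t=0}^\infty\gamma_t^2<\infty$, $\sum_{t=0}^\infty\gamma_t=\infty$ and $\gamma_t\le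 1$ for all $t\ge 0$. Let $x_0$ be a fixed point in $K$ and let $\{x_t\}_{t=0}^\infty\subset\mathcal{M}$ be generated by $$x_{t+1}=R_{x_t}\left(-\gamma_tH_t(x_t,\omega_t)\right)\quad\text{for } t\ge 0.$$ Assume that $\{x_t\}_{t=0}^\infty\subset K$. Then $F(x_t)$ converges almost surely, and $\|\nabla F(x_t)\|_{x_t}\to 0$ both almost surely and in mean square (that is, $\mathbb{E}(\|\nabla F(x_t)\|_{x_t}^2)\to 0$).
   Context: Retraction: a $C^2$ map $R:T\mathcal{M}\to\mathcal{M}$ such that for every $x\in\mathcal{M}$ the restriction $R_x=R|_{T_x\mathcal{M}}$ satisfies $R_x(\mathbf{0}_x)=x$ and $dR_x(\mathbf{0}_x)=\mathrm{id}_{T_x\mathcal{M}}$ (under the standard identification $T_{\mathbf{0}_x}T_x\mathcal{M}\cong T_x\mathcal{M}$). $\langle\cdot,\cdot\rangle_x$ and $\|\cdot\|_x$ are the Riemannian inner product and norm on $T_x\mathcal{M}$; $\nabla F$ is the Riemannian gradient. For $x\in\mathcal{M}$, $\mathbf{u}\in T_x\mathcal{M}$, identify $T_{\mathbf{u}}(T_x\mathcal{M})$ with $T_x\mathcal{M}$, so that $dR_x|_{\mathbf{u}}:T_x\mathcal{M}\to T_{R_x(\mathbf{u})}\mathcal{M}$ is linear, and let $\mathrm{adj}(dR_x|_{\mathbf{u}}):T_{R_x(\mathbf{u})}\mathcal{M}\to T_x\mathcal{M}$ be its adjoint: $\langle\mathbf{v},\mathrm{adj}(dR_x|_{\mathbf{u}})(\mathbf{w})\rangle_x=\langle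 dR_x|_{\mathbf{u}}(\mathbf{v}),\mathbf{w}\rangle_{R_x(\mathbf{u})}$ for all $\mathbf{v},\mathbf{w}$. $R$-Lipschitz: for a subset $K\subset\mathcal{M}$ and $r>0$, a vector field $\mathbf{v}$ on $\mathcal{M}$ is $R$-Lipschitz on $K$ up to radius $r$ if there is a constant $C>0$ (depending on $K$ and $r$) such that $\|\mathrm{adj}(dR_x|_{\mathbf{u}})(\mathbf{v}(R_x(\mathbf{u})))-\mathbf{v}(x)\|_x\le C\|\mathbf{u}\|_x$ for all $x\in K$ and $\mathbf{u}\in T_x\mathcal{M}$ with $\|\mathbf{u}\|_x\le r$. $\mathcal{B}_{\mathcal{M}}$ and $\mathcal{B}_{T\mathcal{M}}$ are the Borel $\sigma$-algebras of $\mathcal{M}$ and $T\mathcal{M}$; $\otimes$ denotes the product $\sigma$-algebra. *)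

theory Defs
  imports "HOL-Probability.Probability" "HOL-Library.Function_Algebras"
begin

section \<open>Differentiability classes on open sets of normed spaces\<close>

text \<open>
  Only meant for open \<open>S\<close>.  For a finite-dimensional domain, continuity of all
  iterated directional derivatives is the usual notion of being of class \<open>C\<^sup>k\<close>.
\<close>

primrec Ck_on :: "nat \<Rightarrow> 'b::real_normed_vector set \<Rightarrow> ('b \<Rightarrow> 'c::real_normed_vector) \<Rightarrow> bool" where
  "Ck_on 0 S f \<longleftrightarrow> continuous_on S f"
| "Ck_on (Suc k) S f \<longleftrightarrow>
     (\<forall>y\<in>S. f differentiable (at y)) \<and>
     (\<forall>a. Ck_on k S (\<lambda>y. frechet_derivative f (at y) a))"

definition smooth_on :: "'b::real_normed_vector set \<Rightarrow> ('b \<Rightarrow> 'c::real_normed_vector) \<Rightarrow> bool" where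
  "smooth_on S f \<longleftrightarrow> (\<forall>k. Ck_on k S f)"

section \<open>Smooth manifolds\<close>

text \<open>
  The underlying space of a manifold is the whole topological type \<open>'a\<close>; its smooth
  structure is given by an atlas.  A chart is a domain together with a coordinate map,
  whose values outside the domain are irrelevant.
\<close>

type_synonym ('a, 'e) chart = "'a set \<times> ('a \<Rightarrow> 'e)"

abbreviation chart_dom :: "('a, 'e) chart \<Rightarrow> 'a set" where
  "chart_dom c \<equiv> fst c"

abbreviation chart_map :: "('a, 'e) chart \<Rightarrow> 'a \<Rightarrow> 'e" where
  "chart_map c \<equiv> snd c"

definition chart_img :: "('a, 'e) chart \<Rightarrow> 'e set" where
  "chart_img c = chart_map c ` chart_dom c"

definition chart_inv :: "('a, 'e) chart \<Rightarrow> 'e \<Rightarrow> 'a" where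
  "chart_inv c = inv_into (chart_dom c) (chart_map c)"

definition charts_at :: "('a, 'e) chart set \<Rightarrow> 'a \<Rightarrow> ('a, 'e) chart set" where
  "charts_at \<A> x = {c \<in> \<A>. x \<in> chart_dom c}"

locale smooth_manifold =
  fixes \<A> :: "('a::{t2_space, second_countable_topology}, 'e::euclidean_space) chart set"
  assumes open_dom: "c \<in> \<A> \<Longrightarrow> open (chart_dom c)"
    and open_img: "c \<in> \<A> \<Longrightarrow> open (chart_img c)"
    and homeo: "c \<in> \<A> \<Longrightarrow>
      homeomorphism (chart_dom c) (chart_img c) (chart_map c) (chart_inv c)"
    and cover: "(\<Union>c\<in>\<A>. chart_dom c) = UNIV"
    and compatible: "c \<in> \<A> \<Longrightarrow> d \<in> \<A> \<Longrightarrow>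
      smooth_on (chart_map c ` (chart_dom c \<inter> chart_dom d)) (chart_map d \<circ> chart_inv c)"

section \<open>Tangent vectors\<close>

text \<open>
  Functions into a real vector space form a real vector space; tangent spaces are
  subspaces of such a space.
\<close>

instantiation "fun" :: (type, real_vector) real_vector
begin

definition scaleR_fun :: "real \<Rightarrow> ('a \<Rightarrow> 'b) \<Rightarrow> 'a \<Rightarrow> 'b" where
  "scaleR_fun r f = (\<lambda>x. r *\<^sub>R f x)"

instance
  by standard (auto simp: scaleR_fun_def fun_eq_iff plus_fun_def scaleR_add_left scaleR_add_right)

end

text \<open>
  A tangent vector at \<open>x\<close> assigns to every chart around \<open>x\<close> a coordinate vector, and these
  coordinate vectors are related by the derivatives of the coordinate changes.  The value
  \<open>0\<close> is assigned to all other charts, so that tangent vectors are equal iff their coordinate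
  vectors are.  Points of the tangent bundle are pairs of a base point and a tangent vector.
\<close>

type_synonym ('a, 'e) tvec = "('a, 'e) chart \<Rightarrow> 'e"

definition coord_change_deriv ::
  "('a, 'e::euclidean_space) chart \<Rightarrow> ('a, 'e) chart \<Rightarrow> 'a \<Rightarrow> 'e \<Rightarrow> 'e" where
  "coord_change_deriv c d x =
     frechet_derivative (chart_map d \<circ> chart_inv c) (at (chart_map c x))"

definition tangent_space ::
  "('a, 'e::euclidean_space) chart set \<Rightarrow> 'a \<Rightarrow> ('a, 'e) tvec set" where
  "tangent_space \<A> x =
     {v. (\<forall>c\<in>charts_at \<A> x. \<forall>d\<in>charts_at \<A> x. v d = coord_change_deriv c d x (v c)) \<and>
         (\<forall>c. c \<notin> charts_at \<A> x \<longrightarrow> v c = 0)}"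

text \<open>The tangent vector at \<open>x\<close> with coordinate vector \<open>a\<close> in the chart \<open>c\<close>\<close>

definition coord_tvec ::
  "('a, 'e::euclidean_space) chart set \<Rightarrow> ('a, 'e) chart \<Rightarrow> 'a \<Rightarrow> 'e \<Rightarrow> ('a, 'e) tvec" where
  "coord_tvec \<A> c x a = (\<lambda>d. if d \<in> charts_at \<A> x then coord_change_deriv c d x a else 0)"

definition tangent_bundle ::
  "('a, 'e::euclidean_space) chart set \<Rightarrow> ('a \<times> ('a, 'e) tvec) set" where
  "tangent_bundle \<A> = Sigma UNIV (tangent_space \<A>)"

text \<open>
  A chart \<open>c\<close> of the manifold induces the bundle chart \<open>(x, v) \<mapsto> (chart_map c x, v c)\<close> on the
  part of the tangent bundle over \<open>chart_dom c\<close>, with image \<open>chart_img c \<times> UNIV\<close>.  The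
  topology of the tangent bundle is the one for which these are homeomorphisms onto open sets.
\<close>

definition tangent_chart_inv ::
  "('a, 'e::euclidean_space) chart set \<Rightarrow> ('a, 'e) chart \<Rightarrow> 'e \<times> 'e \<Rightarrow> 'a \<times> ('a, 'e) tvec" where
  "tangent_chart_inv \<A> c = (\<lambda>(y, a). (chart_inv c y, coord_tvec \<A> c (chart_inv c y) a))"

definition tangent_topology ::
  "('a, 'e::euclidean_space) chart set \<Rightarrow> ('a \<times> ('a, 'e) tvec) topology" where
  "tangent_topology \<A> = topology_generated_by
     {{(x, v). (x, v) \<in> tangent_bundle \<A> \<and> x \<in> chart_dom c \<and> (chart_map c x, v c) \<in> W} | c W.
        c \<in> \<A> \<and> open W}"

definition tangent_borel ::
  "('a, 'e::euclidean_space) chart set \<Rightarrow> ('a \<times> ('a, 'e) tvec) measure" where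
  "tangent_borel \<A> = sigma (tangent_bundle \<A>) {W. openin (tangent_topology \<A>) W}"

text \<open>Vector fields are represented by their fibre parts: \<open>X\<close> stands for \<open>x \<mapsto> (x, X x)\<close>.\<close>

definition vector_field ::
  "('a, 'e::euclidean_space) chart set \<Rightarrow> ('a \<Rightarrow> ('a, 'e) tvec) \<Rightarrow> bool" where
  "vector_field \<A> X \<longleftrightarrow> (\<forall>x. X x \<in> tangent_space \<A> x)"

text \<open>The velocity at time \<open>0\<close> of a curve\<close>

definition velocity ::
  "('a, 'e::euclidean_space) chart set \<Rightarrow> (real \<Rightarrow> 'a) \<Rightarrow> ('a, 'e) tvec" where
  "velocity \<A> \<alpha> =
     (\<lambda>d. if d \<in> charts_at \<A> (\<alpha> 0) then vector_derivative (chart_map d \<circ> \<alpha>) (at 0) else 0)"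

text \<open>
  The integral of a function with values in a (finite-dimensional) tangent space is taken
  in coordinates.  The existence of the integral is part of the notion.
\<close>

definition has_tangent_integral ::
  "('a, 'e::euclidean_space) chart set \<Rightarrow> 'a \<Rightarrow> 'w measure \<Rightarrow> ('w \<Rightarrow> ('a, 'e) tvec) \<Rightarrow> ('a, 'e) tvec \<Rightarrow> bool"
  where
  "has_tangent_integral \<A> x M h w \<longleftrightarrow>
     (\<forall>c\<in>charts_at \<A> x. has_bochner_integral M (\<lambda>\<omega>. h \<omega> c) (w c))"

section \<open>Functions on a manifold\<close>

definition Ck_function ::
  "nat \<Rightarrow> ('a, 'e::euclidean_space) chart set \<Rightarrow> ('a \<Rightarrow> real) \<Rightarrow> bool" where
  "Ck_function k \<A> F \<longleftrightarrow> (\<forall>c\<in>\<A>. Ck_on k (chart_img c) (F \<circ> chart_inv c))"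

text \<open>For a differentiable function the value does not depend on the chosen chart.\<close>

definition differential ::
  "('a, 'e::euclidean_space) chart set \<Rightarrow> ('a \<Rightarrow> real) \<Rightarrow> 'a \<Rightarrow> ('a, 'e) tvec \<Rightarrow> real" where
  "differential \<A> F x v =
     (let c = (SOME c. c \<in> charts_at \<A> x)
      in frechet_derivative (F \<circ> chart_inv c) (at (chart_map c x)) (v c))"

section \<open>Riemannian manifolds\<close>

type_synonym ('a, 'e) metric = "'a \<Rightarrow> ('a, 'e) tvec \<Rightarrow> ('a, 'e) tvec \<Rightarrow> real"

locale riemannian_manifold = smooth_manifold \<A>
  for \<A> :: "('a::{t2_space, second_countable_topology}, 'e::euclidean_space) chart set" +
  fixes g :: "('a, 'e) metric"
  assumes metric_sym: "u \<in> tangent_space \<A> x \<Longrightarrow> v \<in> tangent_space \<A> x \<Longrightarrow> g x u v = g x v u"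
    and metric_add: "u \<in> tangent_space \<A> x \<Longrightarrow> v \<in> tangent_space \<A> x \<Longrightarrow> w \<in> tangent_space \<A> x \<Longrightarrow>
      g x (u + v) w = g x u w + g x v w"
    and metric_scaleR: "u \<in> tangent_space \<A> x \<Longrightarrow> v \<in> tangent_space \<A> x \<Longrightarrow>
      g x (r *\<^sub>R u) v = r * g x u v"
    and metric_pos: "u \<in> tangent_space \<A> x \<Longrightarrow> u \<noteq> 0 \<Longrightarrow> g x u u > 0"
    and metric_smooth: "c \<in> \<A> \<Longrightarrow>
      smooth_on (chart_img c)
        (\<lambda>y. g (chart_inv c y) (coord_tvec \<A> c (chart_inv c y) a) (coord_tvec \<A> c (chart_inv c y) b))"

definition tnorm :: "('a, 'e) metric \<Rightarrow> 'a \<Rightarrow> ('a, 'e) tvec \<Rightarrow> real" where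
  "tnorm g x v = sqrt (g x v v)"

definition gradient ::
  "('a, 'e::euclidean_space) chart set \<Rightarrow> ('a, 'e) metric \<Rightarrow> ('a \<Rightarrow> real) \<Rightarrow> 'a \<Rightarrow> ('a, 'e) tvec" where
  "gradient \<A> g F x =
     (THE w. w \<in> tangent_space \<A> x \<and> (\<forall>v\<in>tangent_space \<A> x. g x w v = differential \<A> F x v))"

section \<open>Retractions\<close>

definition Ck_from_tangent_bundle ::
  "nat \<Rightarrow> ('a::topological_space, 'e::euclidean_space) chart set \<Rightarrow> ('a \<times> ('a, 'e) tvec \<Rightarrow> 'a) \<Rightarrow> bool"
  where
  "Ck_from_tangent_bundle k \<A> R \<longleftrightarrow>
     continuous_map (tangent_topology \<A>) euclidean R \<and>
     (\<forall>c\<in>\<A>. \<forall>d\<in>\<A>.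
        Ck_on k {p \<in> chart_img c \<times> UNIV. R (tangent_chart_inv \<A> c p) \<in> chart_dom d}
          (chart_map d \<circ> R \<circ> tangent_chart_inv \<A> c))"

text \<open>
  The differential at \<open>u\<close> of the restriction of \<open>R\<close> to the tangent space at \<open>x\<close>.  The
  direction \<open>v\<close> is identified with the velocity of the line \<open>s \<mapsto> u + s v\<close> in this vector space.
\<close>

definition fibre_differential ::
  "('a, 'e::euclidean_space) chart set \<Rightarrow> ('a \<times> ('a, 'e) tvec \<Rightarrow> 'a) \<Rightarrow> 'a \<Rightarrow>
    ('a, 'e) tvec \<Rightarrow> ('a, 'e) tvec \<Rightarrow> ('a, 'e) tvec" where
  "fibre_differential \<A> R x u v = velocity \<A> (\<lambda>s. R (x, u + s *\<^sub>R v))"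

definition manifold_retraction ::
  "('a::topological_space, 'e::euclidean_space) chart set \<Rightarrow> ('a \<times> ('a, 'e) tvec \<Rightarrow> 'a) \<Rightarrow> bool" where
  "manifold_retraction \<A> R \<longleftrightarrow>
     Ck_from_tangent_bundle 2 \<A> R \<and>
     (\<forall>x. R (x, 0) = x \<and> (\<forall>v\<in>tangent_space \<A> x. fibre_differential \<A> R x 0 v = v))"

definition adj_fibre_differential ::
  "('a, 'e::euclidean_space) chart set \<Rightarrow> ('a, 'e) metric \<Rightarrow> ('a \<times> ('a, 'e) tvec \<Rightarrow> 'a) \<Rightarrow> 'a \<Rightarrow>
    ('a, 'e) tvec \<Rightarrow> ('a, 'e) tvec \<Rightarrow> ('a, 'e) tvec" where
  "adj_fibre_differential \<A> g R x u w =
     (THE z. z \<in> tangent_space \<A> x \<and>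
        (\<forall>v\<in>tangent_space \<A> x. g x v z = g (R (x, u)) (fibre_differential \<A> R x u v) w))"

definition R_lipschitz_on ::
  "('a, 'e::euclidean_space) chart set \<Rightarrow> ('a, 'e) metric \<Rightarrow> ('a \<times> ('a, 'e) tvec \<Rightarrow> 'a) \<Rightarrow>
    'a set \<Rightarrow> real \<Rightarrow> ('a \<Rightarrow> ('a, 'e) tvec) \<Rightarrow> bool" where
  "R_lipschitz_on \<A> g R K r X \<longleftrightarrow>
     (\<exists>C>0. \<forall>x\<in>K. \<forall>u\<in>tangent_space \<A> x. tnorm g x u \<le> r \<longrightarrow>
        tnorm g x (adj_fibre_differential \<A> g R x u (X (R (x, u))) - X x) \<le> C * tnorm g x u)"

end

theory Submission
  imports Defs
begin

text \<open>
  Write \<open>b y\<close> for the norm of the gradient of \<open>F\<close> at \<open>y\<close>, and \<open>u\<close> for the random tangent vector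
  \<open>- \<gamma> t H t\<close> that is followed at time \<open>t\<close>.

  The derivative of \<open>F (R (x, s u))\<close> in \<open>s\<close> is the inner product of \<open>u\<close> with the adjoint of the
  fibre derivative of \<open>R\<close> applied to the gradient at \<open>R (x, s u)\<close>.  The Lipschitz hypothesis
  compares this adjoint with the gradient at \<open>x\<close> itself, so the mean value theorem gives the
  expansion \<open>F (R (x, u)) = F x + dF u + O(|u|^2)\<close>, uniformly for \<open>x\<close> in \<open>K\<close> and \<open>|u| \<le> A\<close> (\<open>retraction_Taylor\<close>).  Along
  a trajectory it reads
  \<open>F (x (t+1)) - F (x t) = - \<gamma> t (b (x t))^2 + \<gamma> t \<psi> t + O((\<gamma> t)^2)\<close>, where \<open>\<psi> t\<close> is the
  difference between the mean of \<open>dF (H t)\<close> and its sampled value.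

  The \<open>\<psi> t\<close> are bounded and centred given the past, so the increments \<open>\<gamma> t \<psi> t\<close> are orthogonal
  with summable variances, and their sum converges almost surely
  (\<open>centred_increments_summable\<close>, by a maximal inequality of Kolmogorov type).  Since \<open>F\<close> is bounded
  on the compact set \<open>K\<close>, the displayed identity then bounds the partial sums of
  \<open>\<gamma> t (b (x t))^2\<close>.  Hence these sums converge, and with them \<open>F (x t)\<close>, on every trajectory
  on which the martingale part converges.

  Convergence of the sum of \<open>\<gamma> t (b (x t))^2\<close>, where the \<open>\<gamma> t\<close> have infinite sum, only shows that
  \<open>b (x t)\<close> comes close to \<open>0\<close> infinitely often.  To exclude oscillations one needs
  \<open>b (x (t+1)) \<le> b (x t) + C \<gamma> t\<close> (\<open>vanishes_of_slow_growth\<close>).  The Lipschitz hypothesis bounds only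
  the adjoint of the gradient, which lives in the tangent space at the old point.  Its norm agrees
  with the norm of the gradient at the new point up to a relative error \<open>O(|u|)\<close>, because the fibre
  derivative of \<open>R\<close> is the identity at \<open>0\<close> and, like the metric, is locally Lipschitz.  A covering
  argument makes the constants uniform on \<open>K\<close> (\<open>gradient_norm_growth\<close>).

  Convergence in mean square follows by dominated convergence, as \<open>b\<close> is bounded on \<open>K\<close>.
\<close>

section \<open>Continuously differentiable maps on Euclidean domains\<close>

lemma Ck_on_Suc_imp: "Ck_on (Suc k) S f \<Longrightarrow> Ck_on k S f"
proof (induction k arbitrary: f)
  case 0
  then show ?case
    by (auto intro!: continuous_at_imp_continuous_on differentiable_imp_continuous_within)
next
  case (Suc k)
  then show ?case by simp
qed

lemma Ck_on_1_continuous: "Ck_on 1 S f \<Longrightarrow> continuous_on S f"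
  using Ck_on_Suc_imp[of 0 S f] unfolding One_nat_def Ck_on.simps(1) .

lemma scaleR_fun_apply: "(r *\<^sub>R f) y = r *\<^sub>R f y"
  by (simp add: scaleR_fun_def)

lemma Ck_on_1_has_derivative:
  "Ck_on 1 S f \<Longrightarrow> y \<in> S \<Longrightarrow> (f has_derivative frechet_derivative f (at y)) (at y)"
  using frechet_derivative_works by auto

lemma Ck_on_1_directional: "Ck_on 1 S f \<Longrightarrow> continuous_on S (\<lambda>y. frechet_derivative f (at y) a)"
  by simp

lemma linear_euclidean_expansion:
  fixes f :: "'b::euclidean_space \<Rightarrow> 'c::real_vector"
  assumes "linear f" shows "f a = (\<Sum>b\<in>Basis. (a \<bullet> b) *\<^sub>R f b)"
  by (subst (1) euclidean_representation[symmetric]) (simp only: linear_sum[OF assms] linear_scale[OF assms])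

text \<open>
  The derivative is linear in the direction, so it is a combination of the finitely many
  partial derivatives, which are continuous by definition of the class \<open>C\<^sup>1\<close>.
\<close>

lemma Ck_on_1_continuous_frechet:
  fixes f :: "'b::euclidean_space \<Rightarrow> 'c::real_normed_vector"
  assumes "Ck_on 1 S f"
  shows "continuous_on (S \<times> UNIV) (\<lambda>(y, a). frechet_derivative f (at y) a)"
proof -
  have lin: "linear (frechet_derivative f (at y))" if "y \<in> S" for y
    using has_derivative_linear[OF Ck_on_1_has_derivative[OF assms that]] .
  have "continuous_on (S \<times> UNIV) (\<lambda>z. \<Sum>b\<in>Basis. (snd z \<bullet> b) *\<^sub>R frechet_derivative f (at (fst z)) b)"
    by (intro continuous_intros continuous_on_compose2[OF Ck_on_1_directional[OF assms]]) auto
  then show ?thesis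
    by (rule continuous_on_eq) (auto simp: linear_euclidean_expansion[OF lin])
qed

text \<open>
  On a closed ball the continuous derivative is bounded by compactness, and convexity of the ball
  turns this bound into a Lipschitz constant.
\<close>

lemma Ck_on_1_locally_Lipschitz:
  fixes f :: "'b::euclidean_space \<Rightarrow> 'c::real_normed_vector"
  assumes f: "Ck_on 1 S f" and S: "open S" "z \<in> S"
  shows "\<exists>r>0. \<exists>L\<ge>0. cball z r \<subseteq> S \<and> (\<forall>x\<in>cball z r. \<forall>y\<in>cball z r. norm (f x - f y) \<le> L * norm (x - y))"
proof -
  obtain r where r: "0 < r" "cball z r \<subseteq> S" using S open_contains_cball by blast
  have der: "(f has_derivative frechet_derivative f (at y)) (at y)" if "y \<in> cball z r" for y
    using Ck_on_1_has_derivative[OF f] that r(2) by blast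
  have "\<exists>B. \<forall>y\<in>cball z r. norm (frechet_derivative f (at y) b) \<le> B" for b
  proof -
    have "compact ((\<lambda>y. frechet_derivative f (at y) b) ` cball z r)"
      by (intro compact_continuous_image continuous_on_subset[OF Ck_on_1_directional[OF f] r(2)] compact_cball)
    then show ?thesis by (auto dest!: compact_imp_bounded simp: bounded_iff)
  qed
  then obtain B where B: "\<And>b y. y \<in> cball z r \<Longrightarrow> norm (frechet_derivative f (at y) b) \<le> B b" by metis
  have Bn: "0 \<le> B b" for b
    using order_trans[OF norm_ge_zero B[of z b]] r(1) by simp
  define L where "L = (\<Sum>b\<in>Basis. B b)"
  have on: "onorm (frechet_derivative f (at y)) \<le> L" if y: "y \<in> cball z r" for y
  proof (rule onorm_bound)
    show "0 \<le> L" unfolding L_def using Bn by (intro sum_nonneg)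
    fix a :: 'b
    have "norm (frechet_derivative f (at y) a) = norm (\<Sum>b\<in>Basis. (a \<bullet> b) *\<^sub>R frechet_derivative f (at y) b)"
      by (subst linear_euclidean_expansion[OF has_derivative_linear[OF der[OF y]]]) (rule refl)
    also have "\<dots> \<le> (\<Sum>b\<in>Basis. norm ((a \<bullet> b) *\<^sub>R frechet_derivative f (at y) b))" by (rule norm_sum)
    also have "\<dots> \<le> (\<Sum>b\<in>Basis. norm a * B b)"
      using B[OF y] Basis_le_norm[of _ a] by (intro sum_mono) (auto intro!: mult_mono)
    finally show "norm (frechet_derivative f (at y) a) \<le> L * norm a"
      unfolding L_def by (simp add: sum_distrib_left mult.commute)
  qed
  have "norm (f x - f y) \<le> L * norm (x - y)" if "x \<in> cball z r" "y \<in> cball z r" for x y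
    using has_derivative_at_withinI[OF der] on that by (intro differentiable_bound[OF convex_cball])
  moreover have "0 \<le> L" unfolding L_def using Bn by (intro sum_nonneg)
  ultimately show ?thesis using r by blast
qed

text \<open>
  One ball and one constant serve finitely many functions; used for all partial derivatives of
  a map and for all coefficients of the metric at once.
\<close>

lemma Ck_on_1_locally_Lipschitz_family:
  fixes f :: "'i \<Rightarrow> 'b::euclidean_space \<Rightarrow> 'c::real_normed_vector"
  assumes "finite I" "\<And>i. i \<in> I \<Longrightarrow> Ck_on 1 S (f i)" "open S" "z \<in> S"
  shows "\<exists>r>0. \<exists>L\<ge>0. cball z r \<subseteq> S \<and>
    (\<forall>i\<in>I. \<forall>x\<in>cball z r. \<forall>y\<in>cball z r. norm (f i x - f i y) \<le> L * norm (x - y))"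
  using assms(1,2)
proof (induction I)
  case empty
  then show ?case using assms(3,4) open_contains_cball by (metis empty_iff order_refl)
next
  case (insert j I)
  obtain r L where 1: "0 < r" "0 \<le> L" "cball z r \<subseteq> S"
    "\<forall>i\<in>I. \<forall>x\<in>cball z r. \<forall>y\<in>cball z r. norm (f i x - f i y) \<le> L * norm (x - y)"
    using insert by auto
  obtain s N where 2: "0 < s" "0 \<le> N"
    "\<forall>x\<in>cball z s. \<forall>y\<in>cball z s. norm (f j x - f j y) \<le> N * norm (x - y)"
    using Ck_on_1_locally_Lipschitz[OF insert(4)[of j] assms(3,4)] by auto
  have "norm (f i x - f i y) \<le> max L N * norm (x - y)"
    if i: "i \<in> insert j I" and xy: "x \<in> cball z (min r s)" "y \<in> cball z (min r s)" for i x y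
  proof (cases "i = j")
    case True
    then have "norm (f i x - f i y) \<le> N * norm (x - y)" using 2 xy by auto
    also have "\<dots> \<le> max L N * norm (x - y)" by (intro mult_right_mono) auto
    finally show ?thesis .
  next
    case False
    then have "norm (f i x - f i y) \<le> L * norm (x - y)" using 1 i xy by auto
    also have "\<dots> \<le> max L N * norm (x - y)" by (intro mult_right_mono) auto
    finally show ?thesis .
  qed
  moreover have "cball z (min r s) \<subseteq> S" using 1(3) by auto
  ultimately show ?case using 1 2 by (intro exI[of _ "min r s"] conjI exI[of _ "max L N"]) auto
qed

section \<open>Charts and tangent spaces\<close>

context smooth_manifold
begin

lemma chart_inv_map [simp]: "c \<in> \<A> \<Longrightarrow> x \<in> chart_dom c \<Longrightarrow> chart_inv c (chart_map c x) = x"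
  using homeo[of c] by (auto simp: homeomorphism_def)

lemma chart_map_inv [simp]: "c \<in> \<A> \<Longrightarrow> p \<in> chart_img c \<Longrightarrow> chart_map c (chart_inv c p) = p"
  using homeo[of c] by (auto simp: homeomorphism_def)

lemma chart_inv_in [simp]: "c \<in> \<A> \<Longrightarrow> p \<in> chart_img c \<Longrightarrow> chart_inv c p \<in> chart_dom c"
  using homeo[of c] by (auto simp: homeomorphism_def)

lemma chart_map_in [simp]: "x \<in> chart_dom c \<Longrightarrow> chart_map c x \<in> chart_img c"
  by (simp add: chart_img_def)

lemma chart_continuous: "c \<in> \<A> \<Longrightarrow> continuous_on (chart_dom c) (chart_map c)"
  using homeo[of c] by (auto simp: homeomorphism_def)

lemma chart_inv_continuous: "c \<in> \<A> \<Longrightarrow> continuous_on (chart_img c) (chart_inv c)"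
  using homeo[of c] by (auto simp: homeomorphism_def)

lemma charts_at_in [simp]: "c \<in> charts_at \<A> x \<longleftrightarrow> c \<in> \<A> \<and> x \<in> chart_dom c"
  by (simp add: charts_at_def)

lemma ex_chart: obtains c where "c \<in> \<A>" "x \<in> chart_dom c"
  using cover by blast

text \<open>
  The preimage form makes openness of the domain of a coordinate change immediate.
\<close>

lemma overlap_eq:
  "c \<in> \<A> \<Longrightarrow> chart_map c ` (chart_dom c \<inter> chart_dom d) = {p \<in> chart_img c. chart_inv c p \<in> chart_dom d}"
  by (force simp: image_iff chart_img_def)

lemma open_overlap: "c \<in> \<A> \<Longrightarrow> d \<in> \<A> \<Longrightarrow> open {p \<in> chart_img c. chart_inv c p \<in> chart_dom d}"
  using continuous_open_preimage[OF chart_inv_continuous[of c] open_img[of c] open_dom[of d]]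
  unfolding vimage_def Int_def by simp

lemma coord_change_C1:
  "c \<in> \<A> \<Longrightarrow> d \<in> \<A> \<Longrightarrow> Ck_on 1 {p \<in> chart_img c. chart_inv c p \<in> chart_dom d} (chart_map d \<circ> chart_inv c)"
  using compatible[of c d] overlap_eq[of c d] unfolding smooth_on_def by metis

lemma coord_change_has_derivative:
  assumes "c \<in> \<A>" "d \<in> \<A>" "x \<in> chart_dom c" "x \<in> chart_dom d"
  shows "((chart_map d \<circ> chart_inv c) has_derivative coord_change_deriv c d x) (at (chart_map c x))"
  unfolding coord_change_deriv_def
  by (rule Ck_on_1_has_derivative[OF coord_change_C1]) (use assms in auto)

lemma coord_change_linear:
  "c \<in> \<A> \<Longrightarrow> d \<in> \<A> \<Longrightarrow> x \<in> chart_dom c \<Longrightarrow> x \<in> chart_dom d \<Longrightarrow> linear (coord_change_deriv c d x)"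
  using coord_change_has_derivative has_derivative_linear by blast

lemma coord_change_compose:
  assumes c: "c \<in> \<A>" "x \<in> chart_dom c" and d: "d \<in> \<A>" "x \<in> chart_dom d" and e: "e \<in> \<A>" "x \<in> chart_dom e"
  shows "coord_change_deriv d e x (coord_change_deriv c d x a) = coord_change_deriv c e x a"
proof -
  let ?p = "chart_map c x"
  have "((chart_map e \<circ> chart_inv d) has_derivative coord_change_deriv d e x)
      (at ((chart_map d \<circ> chart_inv c) ?p))"
    using coord_change_has_derivative[of d e x] c d e by simp
  from diff_chain_at[OF coord_change_has_derivative[OF c(1) d(1) c(2) d(2)] this]
  have "(chart_map e \<circ> chart_inv d \<circ> (chart_map d \<circ> chart_inv c) has_derivative
      coord_change_deriv d e x \<circ> coord_change_deriv c d x) (at ?p)" .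
  moreover have "((chart_map e \<circ> chart_inv d \<circ> (chart_map d \<circ> chart_inv c)) has_derivative
      coord_change_deriv c e x) (at ?p)"
  proof (rule has_derivative_transform_within_open[OF coord_change_has_derivative open_overlap[of c d]])
    fix p assume "p \<in> {p \<in> chart_img c. chart_inv c p \<in> chart_dom d}"
    then show "(chart_map e \<circ> chart_inv c) p = (chart_map e \<circ> chart_inv d \<circ> (chart_map d \<circ> chart_inv c)) p"
      using d by simp
  qed (use c d e in auto)
  ultimately show ?thesis using has_derivative_unique comp_apply by metis
qed

lemma coord_change_same:
  assumes c: "c \<in> \<A>" "x \<in> chart_dom c"
  shows "coord_change_deriv c c x a = a"
proof -
  have "((chart_map c \<circ> chart_inv c) has_derivative (\<lambda>a. a)) (at (chart_map c x))"
    by (rule has_derivative_transform_within_open[OF has_derivative_ident open_img[OF c(1)]])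
      (use c in auto)
  then have "coord_change_deriv c c x = (\<lambda>a. a)"
    using has_derivative_unique coord_change_has_derivative[OF c(1) c(1) c(2) c(2)] by blast
  then show ?thesis by simp
qed

lemma tangent_coord_change:
  "v \<in> tangent_space \<A> x \<Longrightarrow> c \<in> \<A> \<Longrightarrow> x \<in> chart_dom c \<Longrightarrow> d \<in> \<A> \<Longrightarrow> x \<in> chart_dom d \<Longrightarrow>
    v d = coord_change_deriv c d x (v c)"
  unfolding tangent_space_def using charts_at_in by blast

lemma tangent_outside: "v \<in> tangent_space \<A> x \<Longrightarrow> d \<notin> charts_at \<A> x \<Longrightarrow> v d = 0"
  unfolding tangent_space_def by blast

text \<open>
  By the cocycle property of coordinate changes, compatibility with one chart suffices.
\<close>

lemma tvecI:
  assumes c: "c \<in> \<A>" "x \<in> chart_dom c"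
    and v: "\<And>d. d \<in> \<A> \<Longrightarrow> x \<in> chart_dom d \<Longrightarrow> v d = coord_change_deriv c d x (v c)"
    and 0: "\<And>d. d \<notin> charts_at \<A> x \<Longrightarrow> v d = 0"
  shows "v \<in> tangent_space \<A> x"
proof -
  have "v e = coord_change_deriv d e x (v d)" if "d \<in> charts_at \<A> x" "e \<in> charts_at \<A> x" for d e
    using that v[of d] v[of e] coord_change_compose[OF c, of d e] by simp
  then show ?thesis using 0 unfolding tangent_space_def by blast
qed

lemma coord_tvec_in [simp]: "c \<in> \<A> \<Longrightarrow> x \<in> chart_dom c \<Longrightarrow> coord_tvec \<A> c x a \<in> tangent_space \<A> x"
  by (rule tvecI) (auto simp: coord_tvec_def coord_change_same)

lemma coord_tvec_coord [simp]: "c \<in> \<A> \<Longrightarrow> x \<in> chart_dom c \<Longrightarrow> coord_tvec \<A> c x a c = a"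
  by (simp add: coord_tvec_def coord_change_same)

lemma tvec_eqI:
  assumes "u \<in> tangent_space \<A> x" "v \<in> tangent_space \<A> x" "c \<in> \<A>" "x \<in> chart_dom c" "u c = v c"
  shows "u = v"
proof
  fix d show "u d = v d"
    using assms tangent_coord_change[OF assms(1,3,4), of d] tangent_coord_change[OF assms(2,3,4), of d]
      tangent_outside[OF assms(1), of d] tangent_outside[OF assms(2), of d]
    by (cases "d \<in> charts_at \<A> x") auto
qed

lemma coord_tvec_of_coord [simp]:
  "v \<in> tangent_space \<A> x \<Longrightarrow> c \<in> \<A> \<Longrightarrow> x \<in> chart_dom c \<Longrightarrow> coord_tvec \<A> c x (v c) = v"
  by (rule tvec_eqI[of _ x _ c]) (auto intro: coord_tvec_in)

lemma tangent_0 [simp]: "0 \<in> tangent_space \<A> x"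
proof -
  obtain c where c: "c \<in> \<A>" "x \<in> chart_dom c" by (rule ex_chart)
  show ?thesis using linear_0[OF coord_change_linear] c by (intro tvecI[OF c]) auto
qed

lemma tangent_add [simp]:
  assumes u: "u \<in> tangent_space \<A> x" and v: "v \<in> tangent_space \<A> x"
  shows "u + v \<in> tangent_space \<A> x"
proof -
  obtain c where c: "c \<in> \<A>" "x \<in> chart_dom c" by (rule ex_chart)
  show ?thesis
  proof (rule tvecI[OF c])
    fix d assume d: "d \<in> \<A>" "x \<in> chart_dom d"
    show "(u + v) d = coord_change_deriv c d x ((u + v) c)"
      using tangent_coord_change[OF u c d] tangent_coord_change[OF v c d]
      by (simp add: linear_add[OF coord_change_linear[OF c(1) d(1) c(2) d(2)]])
  qed (simp add: tangent_outside[OF u] tangent_outside[OF v])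
qed

lemma tangent_scaleR [simp]:
  assumes u: "u \<in> tangent_space \<A> x" shows "r *\<^sub>R u \<in> tangent_space \<A> x"
proof -
  obtain c where c: "c \<in> \<A>" "x \<in> chart_dom c" by (rule ex_chart)
  show ?thesis
  proof (rule tvecI[OF c])
    fix d assume d: "d \<in> \<A>" "x \<in> chart_dom d"
    show "(r *\<^sub>R u) d = coord_change_deriv c d x ((r *\<^sub>R u) c)"
      using tangent_coord_change[OF u c d]
      by (simp add: scaleR_fun_apply linear_scale[OF coord_change_linear[OF c(1) d(1) c(2) d(2)]])
  qed (simp add: tangent_outside[OF u] scaleR_fun_apply)
qed

lemma tangent_uminus [simp]: "u \<in> tangent_space \<A> x \<Longrightarrow> - u \<in> tangent_space \<A> x"
  using tangent_scaleR[of u x "-1"] by simp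

lemma tangent_diff [simp]:
  "u \<in> tangent_space \<A> x \<Longrightarrow> v \<in> tangent_space \<A> x \<Longrightarrow> u - v \<in> tangent_space \<A> x"
  using tangent_add[of u x "-v"] by simp

lemma coord_tvec_add:
  assumes "c \<in> \<A>" "x \<in> chart_dom c"
  shows "coord_tvec \<A> c x (a + b) = coord_tvec \<A> c x a + coord_tvec \<A> c x b"
  by (rule tvec_eqI[of _ x _ c]) (use assms in \<open>auto intro: coord_tvec_in\<close>)

lemma coord_tvec_scaleR:
  assumes "c \<in> \<A>" "x \<in> chart_dom c"
  shows "coord_tvec \<A> c x (r *\<^sub>R a) = r *\<^sub>R coord_tvec \<A> c x a"
  by (rule tvec_eqI[of _ x _ c]) (use assms in \<open>auto intro: coord_tvec_in simp: scaleR_fun_apply\<close>)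

lemma C1_function_chart_has_derivative:
  assumes "Ck_function 1 \<A> F" "c \<in> \<A>" "p \<in> chart_img c"
  shows "((F \<circ> chart_inv c) has_derivative frechet_derivative (F \<circ> chart_inv c) (at p)) (at p)"
  by (rule Ck_on_1_has_derivative[of "chart_img c"]) (use assms in \<open>auto simp: Ck_function_def\<close>)

text \<open>
  The differential is defined through an arbitrarily selected chart; the chain rule for the change of
  coordinates frees it from that choice.
\<close>

lemma differential_chart:
  assumes F: "Ck_function 1 \<A> F" and c: "c \<in> \<A>" "x \<in> chart_dom c" and v: "v \<in> tangent_space \<A> x"
  shows "differential \<A> F x v = frechet_derivative (F \<circ> chart_inv c) (at (chart_map c x)) (v c)"
proof -
  define d where "d = (SOME c. c \<in> charts_at \<A> x)"
  have "d \<in> charts_at \<A> x" unfolding d_def by (rule someI[of _ c]) (use c in simp)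
  then have d: "d \<in> \<A>" "x \<in> chart_dom d" by auto
  let ?p = "chart_map d x"
  have "((F \<circ> chart_inv c) has_derivative frechet_derivative (F \<circ> chart_inv c) (at (chart_map c x)))
      (at ((chart_map c \<circ> chart_inv d) ?p))"
    using C1_function_chart_has_derivative[OF F c(1), of "chart_map c x"] c d by simp
  from diff_chain_at[OF coord_change_has_derivative[OF d(1) c(1) d(2) c(2)] this]
  have "(F \<circ> chart_inv c \<circ> (chart_map c \<circ> chart_inv d) has_derivative
     frechet_derivative (F \<circ> chart_inv c) (at (chart_map c x)) \<circ> coord_change_deriv d c x) (at ?p)" .
  moreover have "(F \<circ> chart_inv c \<circ> (chart_map c \<circ> chart_inv d) has_derivative
     frechet_derivative (F \<circ> chart_inv d) (at ?p)) (at ?p)"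
  proof (rule has_derivative_transform_within_open[OF C1_function_chart_has_derivative[OF F d(1)] open_overlap[of d c]])
    fix p assume "p \<in> {p \<in> chart_img d. chart_inv d p \<in> chart_dom c}"
    then show "(F \<circ> chart_inv d) p = (F \<circ> chart_inv c \<circ> (chart_map c \<circ> chart_inv d)) p"
      using c by simp
  qed (use c d in auto)
  ultimately have "frechet_derivative (F \<circ> chart_inv d) (at ?p) =
      frechet_derivative (F \<circ> chart_inv c) (at (chart_map c x)) \<circ> coord_change_deriv d c x"
    by (rule has_derivative_unique[rotated])
  then show ?thesis
    using tangent_coord_change[OF v d c] unfolding differential_def d_def[symmetric] Let_def by simp
qed

lemma C1_function_continuous:
  assumes F: "Ck_function 1 \<A> F" shows "continuous_on UNIV F"
proof -
  have "isCont F x" for x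
  proof -
    obtain c where c: "c \<in> \<A>" "x \<in> chart_dom c" by (rule ex_chart)
    have "continuous_on (chart_img c) (F \<circ> chart_inv c)"
      using F c by (intro Ck_on_1_continuous) (auto simp: Ck_function_def)
    then have "continuous_on (chart_dom c) (\<lambda>y. (F \<circ> chart_inv c) (chart_map c y))"
      by (rule continuous_on_compose2[OF _ chart_continuous[OF c(1)]]) auto
    then have "continuous_on (chart_dom c) F"
      by (rule continuous_on_eq) (use c in auto)
    then show ?thesis using continuous_on_eq_continuous_at[OF open_dom] c by blast
  qed
  then show ?thesis by (simp add: continuous_at_imp_continuous_on)
qed

end

section \<open>The metric, Riesz representation and the gradient\<close>

context riemannian_manifold
begin

lemma metric_add_right:
  "u \<in> tangent_space \<A> x \<Longrightarrow> v \<in> tangent_space \<A> x \<Longrightarrow> w \<in> tangent_space \<A> x \<Longrightarrow>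
    g x u (v + w) = g x u v + g x u w"
  using metric_sym[of u x] metric_add[of v x w u] by simp

lemma metric_scaleR_right:
  "u \<in> tangent_space \<A> x \<Longrightarrow> v \<in> tangent_space \<A> x \<Longrightarrow> g x u (r *\<^sub>R v) = r * g x u v"
  using metric_sym[of u x] metric_scaleR[of v x u r] by simp

lemma metric_0 [simp]: "v \<in> tangent_space \<A> x \<Longrightarrow> g x 0 v = 0"
  using metric_scaleR[of 0 x v 0] by simp

lemma metric_uminus: "u \<in> tangent_space \<A> x \<Longrightarrow> v \<in> tangent_space \<A> x \<Longrightarrow> g x (- u) v = - g x u v"
  using metric_scaleR[of u x v "-1"] by simp

lemma metric_uminus_right: "u \<in> tangent_space \<A> x \<Longrightarrow> v \<in> tangent_space \<A> x \<Longrightarrow> g x u (- v) = - g x u v"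
  using metric_scaleR_right[of u x v "-1"] by simp

lemma metric_diff:
  "u \<in> tangent_space \<A> x \<Longrightarrow> v \<in> tangent_space \<A> x \<Longrightarrow> w \<in> tangent_space \<A> x \<Longrightarrow>
    g x (u - v) w = g x u w - g x v w"
  using metric_add[of u x "-v" w] metric_uminus[of v x w] by simp

lemma metric_diff_right:
  "u \<in> tangent_space \<A> x \<Longrightarrow> v \<in> tangent_space \<A> x \<Longrightarrow> w \<in> tangent_space \<A> x \<Longrightarrow>
    g x u (v - w) = g x u v - g x u w"
  using metric_add_right[of u x v "-w"] metric_uminus_right[of u x w] by simp

lemma metric_nonneg: "v \<in> tangent_space \<A> x \<Longrightarrow> 0 \<le> g x v v"
  using metric_pos[of v x] by (cases "v = 0") auto

lemma tnorm_nonneg [simp]: "v \<in> tangent_space \<A> x \<Longrightarrow> 0 \<le> tnorm g x v"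
  by (simp add: tnorm_def metric_nonneg)

lemma tnorm_sq: "v \<in> tangent_space \<A> x \<Longrightarrow> (tnorm g x v)\<^sup>2 = g x v v"
  by (simp add: tnorm_def metric_nonneg)

lemma tnorm_scaleR: "v \<in> tangent_space \<A> x \<Longrightarrow> tnorm g x (r *\<^sub>R v) = \<bar>r\<bar> * tnorm g x v"
proof -
  assume v: "v \<in> tangent_space \<A> x"
  then have "g x (r *\<^sub>R v) (r *\<^sub>R v) = r\<^sup>2 * g x v v"
    by (simp add: metric_scaleR metric_scaleR_right power2_eq_square)
  then show ?thesis by (simp add: tnorm_def real_sqrt_mult)
qed

text \<open>
  The usual discriminant argument, carried out for the form \<open>g x\<close>, which is an inner product
  on the tangent space only.
\<close>

lemma metric_Cauchy_Schwarz:
  assumes u: "u \<in> tangent_space \<A> x" and v: "v \<in> tangent_space \<A> x"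
  shows "\<bar>g x u v\<bar> \<le> tnorm g x u * tnorm g x v"
proof (cases "v = 0")
  case True
  then show ?thesis using metric_sym[OF u v] u by (simp add: tnorm_def)
next
  case False
  then have pos: "0 < g x v v" using metric_pos v by blast
  define t where "t = g x u v / g x v v"
  have "0 \<le> g x (u - t *\<^sub>R v) (u - t *\<^sub>R v)" using u v by (intro metric_nonneg) auto
  also have "\<dots> = g x u u - 2 * (t * g x u v) + t * (t * g x v v)"
    using u v metric_sym[OF u v]
    by (simp add: metric_diff metric_diff_right metric_scaleR metric_scaleR_right algebra_simps)
  also have "t * g x v v = g x u v" using pos by (simp add: t_def)
  finally have "t * g x u v \<le> g x u u" by simp
  then have "g x u v * g x u v \<le> g x u u * g x v v" using pos by (simp add: t_def field_simps)
  then have "(g x u v)\<^sup>2 \<le> (tnorm g x u * tnorm g x v)\<^sup>2"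
    unfolding power_mult_distrib tnorm_sq[OF u] tnorm_sq[OF v] by (simp add: power2_eq_square)
  then show ?thesis using u v abs_le_square_iff[of "g x u v" "tnorm g x u * tnorm g x v"] by simp
qed

lemma tnorm_triangle:
  assumes u: "u \<in> tangent_space \<A> x" and v: "v \<in> tangent_space \<A> x"
  shows "tnorm g x (u + v) \<le> tnorm g x u + tnorm g x v"
proof -
  have "(tnorm g x (u + v))\<^sup>2 = g x u u + 2 * g x u v + g x v v"
    using u v metric_sym[OF u v] by (simp add: tnorm_sq metric_add metric_add_right)
  also have "\<dots> \<le> (tnorm g x u + tnorm g x v)\<^sup>2"
    using metric_Cauchy_Schwarz[OF u v] u v by (simp add: power2_sum tnorm_sq)
  finally show ?thesis by (rule power2_le_imp_le) (simp add: u v)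
qed

text \<open>
  The metric as a family of bilinear forms on the model space, parametrized by the image of \<open>c\<close>.
\<close>

definition chart_metric :: "('a, 'e) chart \<Rightarrow> 'e \<Rightarrow> 'e \<Rightarrow> 'e \<Rightarrow> real" where
  "chart_metric c p a b = g (chart_inv c p) (coord_tvec \<A> c (chart_inv c p) a) (coord_tvec \<A> c (chart_inv c p) b)"

lemma metric_chart:
  "u \<in> tangent_space \<A> x \<Longrightarrow> v \<in> tangent_space \<A> x \<Longrightarrow> c \<in> \<A> \<Longrightarrow> x \<in> chart_dom c \<Longrightarrow>
    g x u v = chart_metric c (chart_map c x) (u c) (v c)"
  by (simp add: chart_metric_def)

lemma chart_metric_linear:
  assumes "c \<in> \<A>" "p \<in> chart_img c"
  shows "linear (\<lambda>a. chart_metric c p a b)" and "linear (chart_metric c p a)"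
  using assms unfolding chart_metric_def
  by (auto intro!: linearI simp: coord_tvec_add coord_tvec_scaleR metric_add metric_add_right metric_scaleR metric_scaleR_right)

lemma chart_metric_pos:
  assumes c: "c \<in> \<A>" and p: "p \<in> chart_img c" and a: "a \<noteq> 0" shows "0 < chart_metric c p a a"
proof -
  have "coord_tvec \<A> c (chart_inv c p) a c = a" using c p by simp
  then have "coord_tvec \<A> c (chart_inv c p) a \<noteq> 0" using a by (auto simp del: coord_tvec_coord)
  then show ?thesis unfolding chart_metric_def using c p by (intro metric_pos) auto
qed

lemma chart_metric_C1: "c \<in> \<A> \<Longrightarrow> Ck_on 1 (chart_img c) (\<lambda>p. chart_metric c p a b)"
  using metric_smooth[of c a b] unfolding smooth_on_def chart_metric_def by blast

lemma chart_metric_expansion: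
  assumes "c \<in> \<A>" "p \<in> chart_img c"
  shows "chart_metric c p a b = (\<Sum>i\<in>Basis. \<Sum>j\<in>Basis. (a \<bullet> i) * (b \<bullet> j) * chart_metric c p i j)"
proof -
  have "chart_metric c p a b = (\<Sum>i\<in>Basis. (a \<bullet> i) *\<^sub>R chart_metric c p i b)"
    by (rule linear_euclidean_expansion[OF chart_metric_linear(1)[OF assms]])
  also have "\<dots> = (\<Sum>i\<in>Basis. (a \<bullet> i) *\<^sub>R (\<Sum>j\<in>Basis. (b \<bullet> j) *\<^sub>R chart_metric c p i j))"
    by (intro sum.cong refl arg_cong2[where f=scaleR] linear_euclidean_expansion[OF chart_metric_linear(2)[OF assms]])
  finally show ?thesis by (simp add: sum_distrib_left mult.assoc)
qed

lemma chart_metric_continuous: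
  assumes c: "c \<in> \<A>"
  shows "continuous_on (chart_img c \<times> UNIV) (\<lambda>(p, a, b). chart_metric c p a b)"
proof -
  have cont: "continuous_on (chart_img c) (\<lambda>p. chart_metric c p i j)" for i j
    using Ck_on_1_continuous[OF chart_metric_C1[OF c]] .
  then have "continuous_on (chart_img c \<times> UNIV) (\<lambda>z. \<Sum>i\<in>Basis. \<Sum>j\<in>Basis.
      (fst (snd z) \<bullet> i) * (snd (snd z) \<bullet> j) * chart_metric c (fst z) i j)"
    by (intro continuous_intros continuous_on_compose2[OF cont]) auto
  then show ?thesis
    by (rule continuous_on_eq) (use chart_metric_expansion[OF c] in auto)
qed

text \<open>
  Homogeneity reduces both bounds to unit vectors, hence to a continuous function on a compact
  set; positivity makes its minimum on the diagonal positive.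
\<close>

lemma chart_metric_bounds:
  assumes c: "c \<in> \<A>" and C: "compact C" "C \<subseteq> chart_img c"
  shows "\<exists>m>0. \<forall>p\<in>C. \<forall>a. m * (norm a)\<^sup>2 \<le> chart_metric c p a a"
    and "\<exists>M\<ge>0. \<forall>p\<in>C. \<forall>a b. \<bar>chart_metric c p a b\<bar> \<le> M * norm a * norm b"
proof -
  let ?S = "sphere 0 1 :: 'e set"
  have comp: "compact (C \<times> ?S \<times> ?S)" by (intro compact_Times C compact_sphere)
  have cont: "continuous_on (C \<times> ?S \<times> ?S) (\<lambda>(p, a, b). chart_metric c p a b)"
    by (rule continuous_on_subset[OF chart_metric_continuous[OF c]]) (use C in auto)
  have comp': "compact (C \<times> ?S)" by (intro compact_Times C compact_sphere)
  have cont': "continuous_on (C \<times> ?S) (\<lambda>(p, a). chart_metric c p a a)"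
  proof -
    have "continuous_on (C \<times> ?S) (\<lambda>z. (\<lambda>(p, a, b). chart_metric c p a b) (fst z, snd z, snd z))"
      by (rule continuous_on_compose2[OF cont]) (auto intro!: continuous_intros)
    then show ?thesis by (simp add: case_prod_beta)
  qed
  have unit: "a = norm a *\<^sub>R (a /\<^sub>R norm a)" "a /\<^sub>R norm a \<in> ?S" if "a \<noteq> 0" for a :: 'e
    using that by auto
  show "\<exists>m>0. \<forall>p\<in>C. \<forall>a. m * (norm a)\<^sup>2 \<le> chart_metric c p a a"
  proof (cases "C = {}")
    case True
    then show ?thesis by (intro exI[of _ 1]) auto
  next
    case False
    obtain b :: 'e where "b \<in> Basis" using nonempty_Basis by blast
    then have "C \<times> ?S \<noteq> {}" using False by auto
    from continuous_attains_inf[OF comp' this cont']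
    obtain p0 a0 where p0: "p0 \<in> C" "a0 \<in> ?S"
      and min: "\<And>p a. p \<in> C \<Longrightarrow> a \<in> ?S \<Longrightarrow> chart_metric c p0 a0 a0 \<le> chart_metric c p a a"
      by auto
    define m where "m = chart_metric c p0 a0 a0"
    have "m * (norm a)\<^sup>2 \<le> chart_metric c p a a" if p: "p \<in> C" for p a
    proof (cases "a = 0")
      case True
      then show ?thesis using linear_0[OF chart_metric_linear(1)[OF c, of p 0]] p C by auto
    next
      case False
      have pc: "p \<in> chart_img c" using p C by auto
      have "chart_metric c p a a = (norm a)\<^sup>2 * chart_metric c p (a /\<^sub>R norm a) (a /\<^sub>R norm a)"
        using False by (simp add: linear_scale[OF chart_metric_linear(1)[OF c pc]]
            linear_scale[OF chart_metric_linear(2)[OF c pc]] power2_eq_square field_simps)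
      then show ?thesis
        using min[OF p unit(2)[OF False]] by (simp add: m_def mult.commute mult_left_mono)
    qed
    moreover have "0 < m" unfolding m_def using p0 C by (intro chart_metric_pos c) auto
    ultimately show ?thesis by blast
  qed
  have "compact ((\<lambda>(p, a, b). chart_metric c p a b) ` (C \<times> ?S \<times> ?S))"
    by (rule compact_continuous_image[OF cont comp])
  then obtain M0 where M0: "\<And>p a b. p \<in> C \<Longrightarrow> a \<in> ?S \<Longrightarrow> b \<in> ?S \<Longrightarrow> \<bar>chart_metric c p a b\<bar> \<le> M0"
    by (force dest!: compact_imp_bounded simp: bounded_iff)
  define M where "M = max M0 0"
  have M: "\<bar>chart_metric c p a b\<bar> \<le> M" if "p \<in> C" "a \<in> ?S" "b \<in> ?S" for p a b
    using M0[OF that] unfolding M_def by linarith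
  have "\<bar>chart_metric c p a b\<bar> \<le> M * norm a * norm b" if p: "p \<in> C" for p a b
  proof (cases "a = 0 \<or> b = 0")
    case True
    then show ?thesis
      using linear_0[OF chart_metric_linear(1)[OF c, of p b]] linear_0[OF chart_metric_linear(2)[OF c, of p a]] p C by auto
  next
    case False
    have pc: "p \<in> chart_img c" using p C by auto
    have "chart_metric c p a b = norm a * norm b * chart_metric c p (a /\<^sub>R norm a) (b /\<^sub>R norm b)"
      using False by (simp add: linear_scale[OF chart_metric_linear(1)[OF c pc]]
          linear_scale[OF chart_metric_linear(2)[OF c pc]] field_simps)
    then have "\<bar>chart_metric c p a b\<bar> = norm a * norm b * \<bar>chart_metric c p (a /\<^sub>R norm a) (b /\<^sub>R norm b)\<bar>"
      by (simp add: abs_mult)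
    also have "\<dots> \<le> norm a * norm b * M"
      using False by (intro mult_left_mono M p unit) auto
    finally show ?thesis by (simp add: mult_ac)
  qed
  then show "\<exists>M\<ge>0. \<forall>p\<in>C. \<forall>a b. \<bar>chart_metric c p a b\<bar> \<le> M * norm a * norm b"
    unfolding M_def by (intro exI[of _ "max M0 0"]) auto
qed

text \<open>
  In coordinates the map that sends \<open>a\<close> to the functional of pairing with \<open>a\<close> is an injective endomorphism
  of a finite-dimensional space, hence surjective.  Both the gradient and the adjoint
  of the fibre derivative are defined by such a unique representing vector.
\<close>

lemma Riesz_representation:
  assumes add: "\<And>u v. u \<in> tangent_space \<A> x \<Longrightarrow> v \<in> tangent_space \<A> x \<Longrightarrow> L (u + v) = L u + L v"
    and scale: "\<And>r v. v \<in> tangent_space \<A> x \<Longrightarrow> L (r *\<^sub>R v) = r * L v"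
  shows "\<exists>!w. w \<in> tangent_space \<A> x \<and> (\<forall>v\<in>tangent_space \<A> x. g x w v = L v)"
proof -
  obtain c where c: "c \<in> \<A>" "x \<in> chart_dom c" by (rule ex_chart)
  let ?p = "chart_map c x"
  have p: "?p \<in> chart_img c" using c by simp
  note lin = chart_metric_linear[OF c(1) p]
  define T where "T a = (\<Sum>b\<in>Basis. chart_metric c ?p a b *\<^sub>R b)" for a
  have Tb: "T a \<bullet> b = chart_metric c ?p a b" if "b \<in> Basis" for a b
    unfolding T_def using that by (simp add: inner_sum_left inner_Basis if_distrib cong: if_cong)
  have "linear T" unfolding T_def
    by (intro linear_compose_sum ballI linear_compose[OF lin(1), unfolded o_def] bounded_linear.linear[OF bounded_linear_scaleR_left])
  moreover have "inj T"
  proof (subst linear_injective_0[OF \<open>linear T\<close>], intro allI impI)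
    fix a assume "T a = 0"
    then have "chart_metric c ?p a b = 0" if "b \<in> Basis" for b using Tb[OF that, of a] by simp
    then have "chart_metric c ?p a a = 0"
      by (subst linear_euclidean_expansion[OF lin(2)]) simp
    then show "a = 0" using chart_metric_pos[OF c(1) p] by force
  qed
  ultimately have "surj T" by (rule linear_inj_imp_surj)
  then obtain a where a: "T a = (\<Sum>b\<in>Basis. L (coord_tvec \<A> c x b) *\<^sub>R b)" by (metis surjD)
  have ab: "chart_metric c ?p a b = L (coord_tvec \<A> c x b)" if "b \<in> Basis" for b
    unfolding Tb[OF that, symmetric] a using that by (simp add: inner_sum_left inner_Basis if_distrib cong: if_cong)
  define w where "w = coord_tvec \<A> c x a"
  have w: "w \<in> tangent_space \<A> x" unfolding w_def using c by simp
  have "linear (\<lambda>b. L (coord_tvec \<A> c x b))"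
    using c by (intro linearI) (auto simp: coord_tvec_add coord_tvec_scaleR add scale)
  note linL = this
  have Lc: "L (coord_tvec \<A> c x b) = chart_metric c ?p a b" for b
  proof -
    have "L (coord_tvec \<A> c x b) = (\<Sum>i\<in>Basis. (b \<bullet> i) *\<^sub>R L (coord_tvec \<A> c x i))"
      by (rule linear_euclidean_expansion[OF linL])
    also have "\<dots> = (\<Sum>i\<in>Basis. (b \<bullet> i) *\<^sub>R chart_metric c ?p a i)" using ab by simp
    also have "\<dots> = chart_metric c ?p a b" by (rule linear_euclidean_expansion[OF lin(2), symmetric])
    finally show ?thesis .
  qed
  have wv: "g x w v = L v" if v: "v \<in> tangent_space \<A> x" for v
    using metric_chart[OF w v c] Lc[of "v c"] v c by (simp add: w_def)
  show ?thesis
  proof (rule ex1I[of _ w])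
    show "w \<in> tangent_space \<A> x \<and> (\<forall>v\<in>tangent_space \<A> x. g x w v = L v)" using w wv by blast
    fix z assume z: "z \<in> tangent_space \<A> x \<and> (\<forall>v\<in>tangent_space \<A> x. g x z v = L v)"
    then have "g x (z - w) (z - w) = 0" using w wv by (simp add: metric_diff)
    then show "z = w" using metric_pos[of "z - w" x] w z by force
  qed
qed

lemma differential_add:
  assumes F: "Ck_function 1 \<A> F" and u: "u \<in> tangent_space \<A> x" and v: "v \<in> tangent_space \<A> x"
  shows "differential \<A> F x (u + v) = differential \<A> F x u + differential \<A> F x v"
proof -
  obtain c where c: "c \<in> \<A>" "x \<in> chart_dom c" by (rule ex_chart)
  have lin: "linear (frechet_derivative (F \<circ> chart_inv c) (at (chart_map c x)))"
    using has_derivative_linear[OF C1_function_chart_has_derivative[OF F c(1)]] c by simp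
  show ?thesis using u v by (simp add: differential_chart[OF F c] linear_add[OF lin])
qed

lemma differential_scaleR:
  assumes F: "Ck_function 1 \<A> F" and v: "v \<in> tangent_space \<A> x"
  shows "differential \<A> F x (r *\<^sub>R v) = r * differential \<A> F x v"
proof -
  obtain c where c: "c \<in> \<A>" "x \<in> chart_dom c" by (rule ex_chart)
  have lin: "linear (frechet_derivative (F \<circ> chart_inv c) (at (chart_map c x)))"
    using has_derivative_linear[OF C1_function_chart_has_derivative[OF F c(1)]] c by simp
  show ?thesis using v by (simp add: differential_chart[OF F c] scaleR_fun_apply linear_scale[OF lin])
qed

lemma gradient_in [simp]: "Ck_function 1 \<A> F \<Longrightarrow> gradient \<A> g F x \<in> tangent_space \<A> x"
  and metric_gradient:
    "Ck_function 1 \<A> F \<Longrightarrow> v \<in> tangent_space \<A> x \<Longrightarrow> g x (gradient \<A> g F x) v = differential \<A> F x v"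
proof -
  assume F: "Ck_function 1 \<A> F"
  have "\<exists>!w. w \<in> tangent_space \<A> x \<and> (\<forall>v\<in>tangent_space \<A> x. g x w v = differential \<A> F x v)"
    by (intro Riesz_representation differential_add differential_scaleR F)
  from theI'[OF this] show "gradient \<A> g F x \<in> tangent_space \<A> x"
    and "v \<in> tangent_space \<A> x \<Longrightarrow> g x (gradient \<A> g F x) v = differential \<A> F x v"
    unfolding gradient_def by blast+
qed

lemma tnorm_gradient_sq:
  "Ck_function 1 \<A> F \<Longrightarrow> (tnorm g x (gradient \<A> g F x))\<^sup>2 = differential \<A> F x (gradient \<A> g F x)"
  by (simp add: tnorm_sq metric_gradient)

text \<open>
  The gradient solves a linear system whose coefficients and right-hand side are continuous in
  the base point.  Coercivity of the metric, uniform near the point \<open>p0\<close>, bounds the change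
  of the solution by the residual of the solution at \<open>p0\<close>, which tends to \<open>0\<close>.
\<close>

lemma gradient_continuous_in_chart:
  assumes F: "Ck_function 1 \<A> F" and c: "c \<in> \<A>"
  shows "continuous_on (chart_img c) (\<lambda>p. gradient \<A> g F (chart_inv c p) c)"
proof -
  define w where "w p = gradient \<A> g F (chart_inv c p) c" for p
  define l where "l p = frechet_derivative (F \<circ> chart_inv c) (at p)" for p
  have FC: "Ck_on 1 (chart_img c) (F \<circ> chart_inv c)" using F c unfolding Ck_function_def by blast
  have wl: "chart_metric c p (w p) a = l p a" if p: "p \<in> chart_img c" for p a
  proof -
    let ?x = "chart_inv c p" and ?v = "coord_tvec \<A> c (chart_inv c p) a"
    have v: "?v \<in> tangent_space \<A> ?x" using c p by simp
    have "g ?x (gradient \<A> g F ?x) ?v = differential \<A> F ?x ?v"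
      by (rule metric_gradient[OF F v])
    then show ?thesis
      using metric_chart[OF gradient_in[OF F] v c] differential_chart[OF F c _ v] c p
      by (simp add: w_def l_def)
  qed
  have "isCont w p0" if p0: "p0 \<in> chart_img c" for p0
  proof -
    obtain r where r: "0 < r" "cball p0 r \<subseteq> chart_img c" using p0 open_img[OF c] open_contains_cball by blast
    obtain m where m: "0 < m" "\<And>p a. p \<in> cball p0 r \<Longrightarrow> m * (norm a)\<^sup>2 \<le> chart_metric c p a a"
      using chart_metric_bounds(1)[OF c compact_cball r(2)] by auto
    define e where "e p = (\<Sum>b\<in>Basis. \<bar>l p b - chart_metric c p (w p0) b\<bar>)" for p
    have near: "norm (w p - w p0) \<le> e p / m" if p: "p \<in> cball p0 r" for p
    proof -
      have pc: "p \<in> chart_img c" using p r by auto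
      note lin = chart_metric_linear[OF c pc]
      let ?a = "w p - w p0"
      have "m * (norm ?a)\<^sup>2 \<le> chart_metric c p ?a ?a" by (rule m(2)[OF p])
      also have "\<dots> = (\<Sum>b\<in>Basis. (?a \<bullet> b) *\<^sub>R chart_metric c p ?a b)"
        by (rule linear_euclidean_expansion[OF lin(2)])
      also have "\<dots> = (\<Sum>b\<in>Basis. (?a \<bullet> b) * (l p b - chart_metric c p (w p0) b))"
        using linear_diff[OF lin(1)] wl[OF pc] by simp
      also have "\<dots> \<le> (\<Sum>b\<in>Basis. norm ?a * \<bar>l p b - chart_metric c p (w p0) b\<bar>)"
      proof (rule sum_mono)
        fix b :: 'e assume "b \<in> Basis"
        then have "\<bar>?a \<bullet> b\<bar> * \<bar>l p b - chart_metric c p (w p0) b\<bar> \<le> norm ?a * \<bar>l p b - chart_metric c p (w p0) b\<bar>"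
          by (intro mult_right_mono Basis_le_norm) auto
        then show "(?a \<bullet> b) * (l p b - chart_metric c p (w p0) b) \<le> norm ?a * \<bar>l p b - chart_metric c p (w p0) b\<bar>"
          using abs_ge_self[of "(?a \<bullet> b) * (l p b - chart_metric c p (w p0) b)"] unfolding abs_mult by linarith
      qed
      also have "\<dots> = norm ?a * e p" unfolding e_def by (simp add: sum_distrib_left)
      finally have "norm ?a * (m * norm ?a) \<le> norm ?a * e p" by (simp add: power2_eq_square mult_ac)
      moreover have "0 \<le> e p" unfolding e_def by (intro sum_nonneg) auto
      ultimately have "m * norm ?a \<le> e p" by (cases "norm ?a = 0") (auto simp: mult_le_cancel_left)
      then show ?thesis using m(1) by (simp add: field_simps)
    qed
    have "(e \<longlongrightarrow> e p0) (at p0)"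
    proof -
      have "continuous_on (chart_img c) (\<lambda>p. chart_metric c p (w p0) b)" for b
        using Ck_on_1_continuous[OF chart_metric_C1[OF c]] .
      moreover have "continuous_on (chart_img c) (\<lambda>p. l p b)" for b
        unfolding l_def by (rule Ck_on_1_directional[OF FC])
      ultimately have "continuous_on (chart_img c) e"
        unfolding e_def by (intro continuous_intros)
      then show ?thesis using continuous_on_eq_continuous_at[OF open_img[OF c]] p0 unfolding isCont_def by blast
    qed
    moreover have "e p0 = 0" unfolding e_def using wl[OF p0] by simp
    ultimately have "((\<lambda>p. e p / m) \<longlongrightarrow> 0) (at p0)" by (simp add: tendsto_divide_zero)
    moreover have "\<forall>\<^sub>F p in at p0. p \<in> ball p0 r"
      by (rule eventually_at_in_open') (use r in auto)
    then have "\<forall>\<^sub>F p in at p0. norm (w p - w p0) \<le> e p / m"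
      by (rule eventually_mono) (use near in auto)
    ultimately have "((\<lambda>p. w p - w p0) \<longlongrightarrow> 0) (at p0)" by (rule Lim_null_comparison[rotated])
    then show ?thesis unfolding isCont_def using Lim_null by blast
  qed
  then show ?thesis unfolding w_def by (rule continuous_at_imp_continuous_on[OF ballI])
qed

lemma tnorm_gradient_continuous:
  assumes F: "Ck_function 1 \<A> F"
  shows "continuous_on UNIV (\<lambda>x. tnorm g x (gradient \<A> g F x))"
proof -
  have "isCont (\<lambda>x. tnorm g x (gradient \<A> g F x)) x" for x
  proof -
    obtain c where c: "c \<in> \<A>" "x \<in> chart_dom c" by (rule ex_chart)
    let ?w = "\<lambda>y. gradient \<A> g F (chart_inv c (chart_map c y)) c"
    have w: "continuous_on (chart_dom c) ?w"
      by (rule continuous_on_compose2[OF gradient_continuous_in_chart[OF F c(1)] chart_continuous[OF c(1)]]) auto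
    have "continuous_on (chart_dom c) (\<lambda>y. (\<lambda>(p, a, b). chart_metric c p a b) (chart_map c y, ?w y, ?w y))"
      by (rule continuous_on_compose2[OF chart_metric_continuous[OF c(1)]])
        (auto intro!: continuous_intros w chart_continuous c)
    then have "continuous_on (chart_dom c) (\<lambda>y. sqrt (chart_metric c (chart_map c y) (?w y) (?w y)))"
      by (intro continuous_intros) simp
    then have "continuous_on (chart_dom c) (\<lambda>y. tnorm g y (gradient \<A> g F y))"
      by (rule continuous_on_eq) (use c in \<open>auto simp: tnorm_def metric_chart[OF gradient_in[OF F] gradient_in[OF F] c(1)]\<close>)
    then show ?thesis using continuous_on_eq_continuous_at[OF open_dom] c by blast
  qed
  then show ?thesis by (simp add: continuous_at_imp_continuous_on)
qed

end

section \<open>The retraction and its fibre derivative\<close>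

locale riemannian_retraction = riemannian_manifold \<A> g
  for \<A> :: "('a::{t2_space, second_countable_topology}, 'e::euclidean_space) chart set"
    and g :: "('a, 'e) metric" +
  fixes R :: "'a \<times> ('a, 'e) tvec \<Rightarrow> 'a"
  assumes retraction: "manifold_retraction \<A> R"
begin

lemma retraction_0 [simp]: "R (x, 0) = x"
  using retraction unfolding manifold_retraction_def by blast

lemma fibre_differential_0: "v \<in> tangent_space \<A> x \<Longrightarrow> fibre_differential \<A> R x 0 v = v"
  using retraction unfolding manifold_retraction_def by blast

lemma retraction_continuous: "continuous_map (tangent_topology \<A>) euclidean R"
  using retraction unfolding manifold_retraction_def Ck_from_tangent_bundle_def by blast

lemma tangent_chart_inv_coord [simp]:
  "c \<in> \<A> \<Longrightarrow> x \<in> chart_dom c \<Longrightarrow> v \<in> tangent_space \<A> x \<Longrightarrow> tangent_chart_inv \<A> c (chart_map c x, v c) = (x, v)"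
  by (simp add: tangent_chart_inv_def)

text \<open>
  Makes the domains on which \<open>R\<close> is seen through two charts open, so that derivatives there are
  meaningful.
\<close>

lemma tangent_chart_inv_continuous:
  assumes c: "c \<in> \<A>"
  shows "continuous_map (top_of_set (chart_img c \<times> UNIV)) (tangent_topology \<A>) (tangent_chart_inv \<A> c)"
  unfolding tangent_topology_def
proof (rule continuous_on_generated_topo)
  fix U assume "U \<in> {{(x, v). (x, v) \<in> tangent_bundle \<A> \<and> x \<in> chart_dom c \<and> (chart_map c x, v c) \<in> W} | c W.
        c \<in> \<A> \<and> open W}"
  then obtain d W where d: "d \<in> \<A>" and W: "open W"
    and U: "U = {(x, v). (x, v) \<in> tangent_bundle \<A> \<and> x \<in> chart_dom d \<and> (chart_map d x, v d) \<in> W}" by blast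
  let ?f = "chart_map d \<circ> chart_inv c"
  define O' where "O' = {p \<in> chart_img c. chart_inv c p \<in> chart_dom d}"
  have O': "open O'" unfolding O'_def by (rule open_overlap[OF c d])
  have C1: "Ck_on 1 O' ?f" unfolding O'_def by (rule coord_change_C1[OF c d])
  define h where "h z = (?f (fst z), (\<lambda>(y, a). frechet_derivative ?f (at y) a) z)" for z
  have "continuous_on (O' \<times> UNIV) h"
    unfolding h_def
    by (intro continuous_on_Pair Ck_on_1_continuous_frechet[OF C1]
        continuous_on_compose2[OF Ck_on_1_continuous[OF C1] continuous_on_fst[OF continuous_on_id]]) auto
  then have "open (O' \<times> UNIV \<inter> h -` W)"
    by (rule continuous_open_preimage[OF _ open_Times[OF O' open_UNIV] W])
  moreover have "tangent_chart_inv \<A> c -` U \<inter> topspace (top_of_set (chart_img c \<times> UNIV)) = O' \<times> UNIV \<inter> h -` W"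
  proof -
    have mem: "tangent_chart_inv \<A> c (p, a) \<in> U \<longleftrightarrow> (p, a) \<in> O' \<times> UNIV \<inter> h -` W"
      if p: "p \<in> chart_img c" for p a
    proof -
      let ?x = "chart_inv c p"
      have "coord_tvec \<A> c ?x a \<in> tangent_space \<A> ?x" using c p by simp
      then have "tangent_chart_inv \<A> c (p, a) \<in> U \<longleftrightarrow>
          ?x \<in> chart_dom d \<and> (chart_map d ?x, coord_tvec \<A> c ?x a d) \<in> W"
        unfolding U by (simp add: tangent_chart_inv_def tangent_bundle_def)
      moreover have "coord_tvec \<A> c ?x a d = frechet_derivative ?f (at p) a" if "?x \<in> chart_dom d"
        using that c d p by (simp add: coord_tvec_def coord_change_deriv_def)
      ultimately show ?thesis using p by (auto simp: O'_def h_def)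
    qed
    show ?thesis
    proof (rule set_eqI)
      fix z
      show "z \<in> tangent_chart_inv \<A> c -` U \<inter> topspace (top_of_set (chart_img c \<times> UNIV)) \<longleftrightarrow>
          z \<in> O' \<times> UNIV \<inter> h -` W"
        using mem[of "fst z" "snd z"] by (cases "fst z \<in> chart_img c") (simp_all add: mem_Times_iff O'_def)
    qed
  qed
  ultimately show "openin (top_of_set (chart_img c \<times> UNIV))
      (tangent_chart_inv \<A> c -` U \<inter> topspace (top_of_set (chart_img c \<times> UNIV)))"
    by (intro open_subset) (auto simp: O'_def)
next
  let ?G = "{(x, v). (x, v) \<in> tangent_bundle \<A> \<and> x \<in> chart_dom c \<and> (chart_map c x, v c) \<in> UNIV}"
  have "tangent_chart_inv \<A> c ` topspace (top_of_set (chart_img c \<times> UNIV)) \<subseteq> ?G"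
    using c by (auto simp: tangent_chart_inv_def tangent_bundle_def)
  moreover have "?G \<in> {{(x, v). (x, v) \<in> tangent_bundle \<A> \<and> x \<in> chart_dom c \<and> (chart_map c x, v c) \<in> W} | c W.
        c \<in> \<A> \<and> open W}"
    by (rule CollectI, rule exI[of _ c], rule exI[of _ UNIV]) (simp only: c open_UNIV simp_thms)
  ultimately show "tangent_chart_inv \<A> c ` topspace (top_of_set (chart_img c \<times> UNIV)) \<subseteq>
     \<Union> {{(x, v). (x, v) \<in> tangent_bundle \<A> \<and> x \<in> chart_dom c \<and> (chart_map c x, v c) \<in> W} | c W.
        c \<in> \<A> \<and> open W}"
    by (meson Union_upper subset_trans)
qed

text \<open>
  The retraction read in the bundle chart of \<open>c\<close> at the source and in the chart \<open>d\<close> at the target.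
\<close>

definition chart_retraction :: "('a, 'e) chart \<Rightarrow> ('a, 'e) chart \<Rightarrow> 'e \<times> 'e \<Rightarrow> 'e" where
  "chart_retraction c d = chart_map d \<circ> R \<circ> tangent_chart_inv \<A> c"

definition chart_retraction_dom :: "('a, 'e) chart \<Rightarrow> ('a, 'e) chart \<Rightarrow> ('e \<times> 'e) set" where
  "chart_retraction_dom c d = {p \<in> chart_img c \<times> UNIV. R (tangent_chart_inv \<A> c p) \<in> chart_dom d}"

lemma open_chart_retraction_dom:
  assumes c: "c \<in> \<A>" and d: "d \<in> \<A>" shows "open (chart_retraction_dom c d)"
proof -
  have "continuous_on (chart_img c \<times> UNIV) (R \<circ> tangent_chart_inv \<A> c)"
    using continuous_map_compose[OF tangent_chart_inv_continuous[OF c] retraction_continuous]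
    by (simp only: continuous_map_iff_continuous)
  from continuous_open_preimage[OF this open_Times[OF open_img[OF c] open_UNIV] open_dom[OF d]]
  show ?thesis unfolding chart_retraction_dom_def vimage_def Int_def by simp
qed

lemma chart_retraction_C2:
  "c \<in> \<A> \<Longrightarrow> d \<in> \<A> \<Longrightarrow> Ck_on (Suc 1) (chart_retraction_dom c d) (chart_retraction c d)"
  using retraction unfolding manifold_retraction_def Ck_from_tangent_bundle_def chart_retraction_def chart_retraction_dom_def
  by (simp only: numeral_2_eq_2 One_nat_def)

lemma chart_retraction_C1:
  "c \<in> \<A> \<Longrightarrow> d \<in> \<A> \<Longrightarrow> Ck_on 1 (chart_retraction_dom c d) (chart_retraction c d)"
  by (rule Ck_on_Suc_imp[OF chart_retraction_C2])

text \<open>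
  This is where two continuous derivatives of the retraction enter: the fibre derivative is itself
  of class \<open>C\<^sup>1\<close>, hence locally Lipschitz.
\<close>

lemma chart_retraction_directional_C1:
  "c \<in> \<A> \<Longrightarrow> d \<in> \<A> \<Longrightarrow> Ck_on 1 (chart_retraction_dom c d) (\<lambda>z. frechet_derivative (chart_retraction c d) (at z) a)"
  using chart_retraction_C2[of c d] unfolding Ck_on.simps(2)[of 1] by blast

lemma chart_retraction_has_derivative:
  "c \<in> \<A> \<Longrightarrow> d \<in> \<A> \<Longrightarrow> z \<in> chart_retraction_dom c d \<Longrightarrow>
    (chart_retraction c d has_derivative frechet_derivative (chart_retraction c d) (at z)) (at z)"
  by (rule Ck_on_1_has_derivative[OF chart_retraction_C1])

lemma in_chart_retraction_dom:
  "c \<in> \<A> \<Longrightarrow> x \<in> chart_dom c \<Longrightarrow> u \<in> tangent_space \<A> x \<Longrightarrow> R (x, u) \<in> chart_dom d \<Longrightarrow>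
    (chart_map c x, u c) \<in> chart_retraction_dom c d"
  by (simp add: chart_retraction_dom_def)

lemma fibre_line_derivative:
  "((\<lambda>s. (p, a + s *\<^sub>R b)) has_derivative (\<lambda>s. (0, s *\<^sub>R b))) (at s)"
  by (auto intro!: derivative_eq_intros)

text \<open>
  The velocity of the line \<open>u + s v\<close> in the fibre is the partial derivative in the direction \<open>(0, v)\<close>.
\<close>

lemma fibre_differential_coord:
  assumes c: "c \<in> \<A>" "x \<in> chart_dom c" and u: "u \<in> tangent_space \<A> x" and v: "v \<in> tangent_space \<A> x"
    and d: "d \<in> \<A>" "R (x, u) \<in> chart_dom d"
  shows "fibre_differential \<A> R x u v d =
    frechet_derivative (chart_retraction c d) (at (chart_map c x, u c)) (0, v c)"
proof -
  let ?z = "(chart_map c x, u c)"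
  let ?D = "frechet_derivative (chart_retraction c d) (at ?z)"
  have z: "?z \<in> chart_retraction_dom c d" using c u d by (intro in_chart_retraction_dom)
  have der: "(chart_retraction c d has_derivative ?D) (at (chart_map c x, u c + 0 *\<^sub>R v c))"
    using chart_retraction_has_derivative[OF c(1) d(1) z] by simp
  have "((chart_retraction c d \<circ> (\<lambda>s. (chart_map c x, u c + s *\<^sub>R v c))) has_derivative ?D \<circ> (\<lambda>s. (0, s *\<^sub>R v c))) (at 0)"
    by (rule diff_chain_at[OF fibre_line_derivative der])
  moreover have "chart_retraction c d \<circ> (\<lambda>s. (chart_map c x, u c + s *\<^sub>R v c)) = chart_map d \<circ> (\<lambda>s. R (x, u + s *\<^sub>R v))"
  proof
    fix s
    have "tangent_chart_inv \<A> c (chart_map c x, (u + s *\<^sub>R v) c) = (x, u + s *\<^sub>R v)"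
      by (rule tangent_chart_inv_coord[OF c, where v="u + s *\<^sub>R v"]) (simp add: u v)
    then show "(chart_retraction c d \<circ> (\<lambda>s. (chart_map c x, u c + s *\<^sub>R v c))) s = (chart_map d \<circ> (\<lambda>s. R (x, u + s *\<^sub>R v))) s"
      by (simp add: chart_retraction_def scaleR_fun_apply)
  qed
  moreover have "?D \<circ> (\<lambda>s. (0, s *\<^sub>R v c)) = (\<lambda>s. s *\<^sub>R ?D (0, v c))"
  proof
    fix s :: real
    have "?D (s *\<^sub>R (0, v c)) = s *\<^sub>R ?D (0, v c)"
      by (rule linear_scale[OF has_derivative_linear[OF der]])
    then show "(?D \<circ> (\<lambda>s. (0, s *\<^sub>R v c))) s = s *\<^sub>R ?D (0, v c)" by simp
  qed
  ultimately have "((chart_map d \<circ> (\<lambda>s. R (x, u + s *\<^sub>R v))) has_vector_derivative ?D (0, v c)) (at 0)"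
    unfolding has_vector_derivative_def by simp
  from vector_derivative_at[OF this] show ?thesis
    using d unfolding fibre_differential_def velocity_def by simp
qed

text \<open>
  Reading the retraction in two target charts differs by the coordinate change, and the
  chain rule turns this into the transformation rule for tangent vectors.
\<close>

lemma fibre_differential_in [simp]:
  assumes u: "u \<in> tangent_space \<A> x" and v: "v \<in> tangent_space \<A> x"
  shows "fibre_differential \<A> R x u v \<in> tangent_space \<A> (R (x, u))"
proof -
  obtain c where c: "c \<in> \<A>" "x \<in> chart_dom c" by (rule ex_chart)
  obtain d where d: "d \<in> \<A>" "R (x, u) \<in> chart_dom d" by (rule ex_chart)
  let ?z = "(chart_map c x, u c)"
  show ?thesis
  proof (rule tvecI[OF d])
    fix e assume e: "e \<in> \<A>" "R (x, u) \<in> chart_dom e"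
    let ?D = "\<lambda>d. frechet_derivative (chart_retraction c d) (at ?z)"
    have zd: "?z \<in> chart_retraction_dom c d" and ze: "?z \<in> chart_retraction_dom c e"
      using c u d e in_chart_retraction_dom by auto
    have zm: "chart_retraction c d ?z = chart_map d (R (x, u))" using c u by (simp add: chart_retraction_def)
    have "((chart_map e \<circ> chart_inv d) has_derivative coord_change_deriv d e (R (x, u))) (at (chart_retraction c d ?z))"
      unfolding zm using d e by (intro coord_change_has_derivative)
    from diff_chain_at[OF chart_retraction_has_derivative[OF c(1) d(1) zd] this]
    have "(chart_map e \<circ> chart_inv d \<circ> chart_retraction c d has_derivative
        coord_change_deriv d e (R (x, u)) \<circ> ?D d) (at ?z)" .
    moreover have "(chart_map e \<circ> chart_inv d \<circ> chart_retraction c d has_derivative ?D e) (at ?z)"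
    proof (rule has_derivative_transform_within_open[OF chart_retraction_has_derivative[OF c(1) e(1) ze]])
      show "open (chart_retraction_dom c d)" using c d by (intro open_chart_retraction_dom)
      fix z assume "z \<in> chart_retraction_dom c d"
      then show "chart_retraction c e z = (chart_map e \<circ> chart_inv d \<circ> chart_retraction c d) z"
        using d(1) by (simp add: chart_retraction_dom_def chart_retraction_def)
    qed (rule zd)
    ultimately have "coord_change_deriv d e (R (x, u)) \<circ> ?D d = ?D e" by (rule has_derivative_unique)
    from fun_cong[OF this, of "(0, v c)"] show "fibre_differential \<A> R x u v e =
        coord_change_deriv d e (R (x, u)) (fibre_differential \<A> R x u v d)"
      by (simp add: fibre_differential_coord[OF c u v d] fibre_differential_coord[OF c u v e])
  next
    fix e assume "e \<notin> charts_at \<A> (R (x, u))"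
    then show "fibre_differential \<A> R x u v e = 0"
      unfolding fibre_differential_def velocity_def by auto
  qed
qed

lemma fibre_differential_add:
  assumes u: "u \<in> tangent_space \<A> x" and v: "v \<in> tangent_space \<A> x" and w: "w \<in> tangent_space \<A> x"
  shows "fibre_differential \<A> R x u (v + w) = fibre_differential \<A> R x u v + fibre_differential \<A> R x u w"
proof -
  obtain c where c: "c \<in> \<A>" "x \<in> chart_dom c" by (rule ex_chart)
  obtain d where d: "d \<in> \<A>" "R (x, u) \<in> chart_dom d" by (rule ex_chart)
  have "linear (frechet_derivative (chart_retraction c d) (at (chart_map c x, u c)))"
    using has_derivative_linear[OF chart_retraction_has_derivative[OF c(1) d(1)]] in_chart_retraction_dom[OF c u d(2)] by blast
  from linear_add[OF this, of "(0, v c)" "(0, w c)"] show ?thesis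
    by (intro tvec_eqI[OF _ _ d]) (simp_all add: u v w fibre_differential_coord[OF c u _ d])
qed

lemma fibre_differential_scaleR:
  assumes u: "u \<in> tangent_space \<A> x" and v: "v \<in> tangent_space \<A> x"
  shows "fibre_differential \<A> R x u (r *\<^sub>R v) = r *\<^sub>R fibre_differential \<A> R x u v"
proof -
  obtain c where c: "c \<in> \<A>" "x \<in> chart_dom c" by (rule ex_chart)
  obtain d where d: "d \<in> \<A>" "R (x, u) \<in> chart_dom d" by (rule ex_chart)
  have "linear (frechet_derivative (chart_retraction c d) (at (chart_map c x, u c)))"
    using has_derivative_linear[OF chart_retraction_has_derivative[OF c(1) d(1)]] in_chart_retraction_dom[OF c u d(2)] by blast
  from linear_scale[OF this, of r "(0, v c)"] show ?thesis
    by (intro tvec_eqI[OF _ _ d]) (simp_all add: u v scaleR_fun_apply fibre_differential_coord[OF c u _ d])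
qed

lemma adj_in [simp]:
    "u \<in> tangent_space \<A> x \<Longrightarrow> w \<in> tangent_space \<A> (R (x, u)) \<Longrightarrow>
      adj_fibre_differential \<A> g R x u w \<in> tangent_space \<A> x"
  and metric_adj:
    "u \<in> tangent_space \<A> x \<Longrightarrow> w \<in> tangent_space \<A> (R (x, u)) \<Longrightarrow> v \<in> tangent_space \<A> x \<Longrightarrow>
      g x v (adj_fibre_differential \<A> g R x u w) = g (R (x, u)) (fibre_differential \<A> R x u v) w"
proof -
  assume u: "u \<in> tangent_space \<A> x" and w: "w \<in> tangent_space \<A> (R (x, u))"
  let ?L = "\<lambda>v. g (R (x, u)) (fibre_differential \<A> R x u v) w"
  have "\<exists>!z. z \<in> tangent_space \<A> x \<and> (\<forall>v\<in>tangent_space \<A> x. g x z v = ?L v)"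
    using u w by (intro Riesz_representation)
      (simp_all add: fibre_differential_add fibre_differential_scaleR metric_add metric_scaleR)
  moreover have "(z \<in> tangent_space \<A> x \<and> (\<forall>v\<in>tangent_space \<A> x. g x z v = ?L v)) =
      (z \<in> tangent_space \<A> x \<and> (\<forall>v\<in>tangent_space \<A> x. g x v z = ?L v))" for z
    by (rule conj_cong[OF refl], rule ball_cong[OF refl], subst metric_sym) simp_all
  ultimately have "\<exists>!z. z \<in> tangent_space \<A> x \<and> (\<forall>v\<in>tangent_space \<A> x. g x v z = ?L v)" by simp
  from theI'[OF this] show "adj_fibre_differential \<A> g R x u w \<in> tangent_space \<A> x"
    and "v \<in> tangent_space \<A> x \<Longrightarrow> g x v (adj_fibre_differential \<A> g R x u w) = ?L v"
    unfolding adj_fibre_differential_def by blast+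
qed

lemma function_along_retraction_derivative:
  assumes F: "Ck_function 1 \<A> F" and u: "u \<in> tangent_space \<A> x"
  shows "((\<lambda>s. F (R (x, s *\<^sub>R u))) has_real_derivative
    differential \<A> F (R (x, s *\<^sub>R u)) (fibre_differential \<A> R x (s *\<^sub>R u) u)) (at s)"
proof -
  obtain c where c: "c \<in> \<A>" "x \<in> chart_dom c" by (rule ex_chart)
  let ?y = "R (x, s *\<^sub>R u)"
  obtain d where d: "d \<in> \<A>" "?y \<in> chart_dom d" by (rule ex_chart)
  let ?z = "(chart_map c x, (s *\<^sub>R u) c)"
  have su: "s *\<^sub>R u \<in> tangent_space \<A> x" for s using u by simp
  have z: "?z \<in> chart_retraction_dom c d" by (rule in_chart_retraction_dom[OF c su d(2)])
  have zm: "chart_retraction c d ?z = chart_map d ?y" using tangent_chart_inv_coord[OF c su] by (simp add: chart_retraction_def)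
  let ?DR = "frechet_derivative (chart_retraction c d) (at ?z)"
  let ?DF = "frechet_derivative (F \<circ> chart_inv d) (at (chart_map d ?y))"
  have "((F \<circ> chart_inv d) has_derivative ?DF) (at (chart_retraction c d ?z))"
    unfolding zm by (rule C1_function_chart_has_derivative[OF F d(1)]) (use d in simp)
  from diff_chain_at[OF chart_retraction_has_derivative[OF c(1) d(1) z] this]
  have "((F \<circ> chart_inv d \<circ> chart_retraction c d) has_derivative ?DF \<circ> ?DR) (at ?z)" .
  then have "((F \<circ> R \<circ> tangent_chart_inv \<A> c) has_derivative ?DF \<circ> ?DR) (at ?z)"
  proof (rule has_derivative_transform_within_open)
    show "open (chart_retraction_dom c d)" using c d by (intro open_chart_retraction_dom)
    fix z assume "z \<in> chart_retraction_dom c d"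
    then show "(F \<circ> chart_inv d \<circ> chart_retraction c d) z = (F \<circ> R \<circ> tangent_chart_inv \<A> c) z"
      using d(1) by (simp add: chart_retraction_dom_def chart_retraction_def)
  qed (rule z)
  then have der: "((F \<circ> R \<circ> tangent_chart_inv \<A> c) has_derivative ?DF \<circ> ?DR) (at (chart_map c x, 0 + s *\<^sub>R u c))"
    by (simp add: scaleR_fun_apply)
  from diff_chain_at[OF fibre_line_derivative this]
  have "((F \<circ> R \<circ> tangent_chart_inv \<A> c \<circ> (\<lambda>s. (chart_map c x, 0 + s *\<^sub>R u c))) has_derivative
      ?DF \<circ> ?DR \<circ> (\<lambda>s. (0, s *\<^sub>R u c))) (at s)" .
  moreover have "F \<circ> R \<circ> tangent_chart_inv \<A> c \<circ> (\<lambda>s. (chart_map c x, 0 + s *\<^sub>R u c)) = (\<lambda>s. F (R (x, s *\<^sub>R u)))"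
  proof
    fix s
    show "(F \<circ> R \<circ> tangent_chart_inv \<A> c \<circ> (\<lambda>s. (chart_map c x, 0 + s *\<^sub>R u c))) s = F (R (x, s *\<^sub>R u))"
      using tangent_chart_inv_coord[OF c su, of s] by (simp add: scaleR_fun_apply)
  qed
  moreover have "?DF \<circ> ?DR \<circ> (\<lambda>s. (0, s *\<^sub>R u c)) = (*) (?DF (?DR (0, u c)))"
  proof
    fix r :: real
    have "(?DF \<circ> ?DR) (r *\<^sub>R (0, u c)) = r *\<^sub>R (?DF \<circ> ?DR) (0, u c)"
      by (rule linear_scale[OF has_derivative_linear[OF der]])
    then show "(?DF \<circ> ?DR \<circ> (\<lambda>s. (0, s *\<^sub>R u c))) r = ?DF (?DR (0, u c)) * r" by simp
  qed
  moreover have "?DF (?DR (0, u c)) = differential \<A> F ?y (fibre_differential \<A> R x (s *\<^sub>R u) u)"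
    using differential_chart[OF F d fibre_differential_in[OF su u]] fibre_differential_coord[OF c su u d] by simp
  ultimately show ?thesis unfolding has_field_derivative_def by simp
qed

text \<open>
  By the mean value theorem the increment of \<open>F\<close> equals its derivative at some intermediate \<open>s u\<close>, which is
  the inner product of \<open>u\<close> with the pulled back gradient.  The Lipschitz bound replaces that gradient by
  the one at \<open>x\<close> at the cost of \<open>C |s u| |u|\<close>.
\<close>

lemma retraction_Taylor:
  assumes F: "Ck_function 1 \<A> F" and C: "0 \<le> C"
    and lip: "\<And>u. u \<in> tangent_space \<A> x \<Longrightarrow> tnorm g x u \<le> A \<Longrightarrow>
      tnorm g x (adj_fibre_differential \<A> g R x u (gradient \<A> g F (R (x, u))) - gradient \<A> g F x) \<le> C * tnorm g x u"
    and u: "u \<in> tangent_space \<A> x" "tnorm g x u \<le> A"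
  shows "\<bar>F (R (x, u)) - F x - differential \<A> F x u\<bar> \<le> C * (tnorm g x u)\<^sup>2"
proof -
  define f' where "f' s = differential \<A> F (R (x, s *\<^sub>R u)) (fibre_differential \<A> R x (s *\<^sub>R u) u)" for s
  have "\<exists>s>0. s < 1 \<and> F (R (x, 1 *\<^sub>R u)) - F (R (x, 0 *\<^sub>R u)) = (1 - 0) * f' s"
    unfolding f'_def by (rule MVT2) (auto intro!: function_along_retraction_derivative F u)
  then obtain s where s: "0 < s" "s < 1" and mvt: "F (R (x, u)) - F x = f' s" by auto
  have su: "s *\<^sub>R u \<in> tangent_space \<A> x" using u by simp
  let ?y = "R (x, s *\<^sub>R u)"
  let ?a = "adj_fibre_differential \<A> g R x (s *\<^sub>R u) (gradient \<A> g F ?y)"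
  have a: "?a \<in> tangent_space \<A> x" using F su by simp
  have "f' s = g ?y (gradient \<A> g F ?y) (fibre_differential \<A> R x (s *\<^sub>R u) u)"
    unfolding f'_def using F u su by (simp add: metric_gradient)
  also have "\<dots> = g ?y (fibre_differential \<A> R x (s *\<^sub>R u) u) (gradient \<A> g F ?y)"
    using F u su by (intro metric_sym) auto
  also have "\<dots> = g x u ?a" using F u su by (simp add: metric_adj)
  finally have f's: "f' s = g x u ?a" .
  have "differential \<A> F x u = g x u (gradient \<A> g F x)"
    using F u metric_sym[OF u(1), of "gradient \<A> g F x"] by (simp add: metric_gradient)
  then have "F (R (x, u)) - F x - differential \<A> F x u = g x u (?a - gradient \<A> g F x)"
    using mvt f's a F u by (simp add: metric_diff_right)
  then have "\<bar>F (R (x, u)) - F x - differential \<A> F x u\<bar> \<le> tnorm g x u * tnorm g x (?a - gradient \<A> g F x)"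
    using metric_Cauchy_Schwarz[OF u(1), of "?a - gradient \<A> g F x"] a F by simp
  also have "\<dots> \<le> tnorm g x u * (C * tnorm g x u)"
  proof (rule mult_left_mono)
    have n: "tnorm g x (s *\<^sub>R u) = s * tnorm g x u" using u s by (simp add: tnorm_scaleR)
    have le: "s * tnorm g x u \<le> 1 * tnorm g x u" using s u by (intro mult_right_mono) auto
    have "tnorm g x (?a - gradient \<A> g F x) \<le> C * (s * tnorm g x u)"
      using lip[OF su] n le u(2) by simp
    also have "\<dots> \<le> C * tnorm g x u" using le C by (intro mult_left_mono) auto
    finally show "tnorm g x (?a - gradient \<A> g F x) \<le> C * tnorm g x u" .
  qed (use u in simp)
  finally show ?thesis by (simp add: power2_eq_square mult_ac)
qed

end

section \<open>Growth of the gradient norm along a retraction\<close>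

text \<open>
  The interiors of the sets where \<open>Q n\<close> holds form an increasing open cover of \<open>K\<close>, so one of them contains \<open>K\<close>.
\<close>

lemma compact_uniform_index:
  fixes Q :: "nat \<Rightarrow> 'a::topological_space \<Rightarrow> bool"
  assumes K: "compact K" and mono: "\<And>m n x. m \<le> n \<Longrightarrow> Q m x \<Longrightarrow> Q n x"
    and loc: "\<And>x. x \<in> K \<Longrightarrow> \<exists>U n. open U \<and> x \<in> U \<and> (\<forall>y\<in>U. Q n y)"
  shows "\<exists>n. \<forall>x\<in>K. Q n x"
proof -
  have "K \<subseteq> (\<Union>n\<in>UNIV. interior {x. Q n x})"
  proof
    fix x assume "x \<in> K"
    then obtain U n where "open U" "x \<in> U" "\<forall>y\<in>U. Q n y" using loc by blast
    then have "x \<in> interior {x. Q n x}" by (intro interiorI[of U]) auto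
    then show "x \<in> (\<Union>n\<in>UNIV. interior {x. Q n x})" by blast
  qed
  then obtain N where N: "finite N" "K \<subseteq> (\<Union>n\<in>N. interior {x. Q n x})"
    using compactE_image[OF K, of UNIV "\<lambda>n. interior {x. Q n x}"] by auto
  have "Q (Max N) x" if "x \<in> K" for x
  proof -
    obtain n where n: "n \<in> N" "Q n x" using N(2) interior_subset \<open>x \<in> K\<close> by blast
    then show ?thesis using mono Max_ge[OF N(1)] by blast
  qed
  then show ?thesis by blast
qed

context riemannian_retraction
begin

text \<open>
  Transplanting \<open>w\<close> to \<open>x\<close> by its coordinates in a fixed chart gives a vector \<open>v\<close>.  The square of the norm
  of \<open>w\<close> is the pairing of \<open>w\<close> with the fibre derivative of \<open>v\<close>, that is, of \<open>v\<close> with the adjoint of \<open>w\<close>, up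
  to the difference between the fibre derivative and the identity.  That difference and the change
  of the norm under transplantation are both \<open>O(|u|)\<close>.

  The single natural number \<open>n\<close> plays the roles of constant and of inverse radius, which makes the
  estimate monotone in \<open>n\<close> and hence fit for \<open>compact_uniform_index\<close>.
\<close>

lemma tnorm_le_adj_local:
  "\<exists>U n. open U \<and> x0 \<in> U \<and> (\<forall>x\<in>U. \<forall>u\<in>tangent_space \<A> x. real n * tnorm g x u \<le> 1 \<longrightarrow>
    (\<forall>w\<in>tangent_space \<A> (R (x, u)). tnorm g (R (x, u)) w \<le>
      (1 + real n * tnorm g x u) * tnorm g x (adj_fibre_differential \<A> g R x u w) +
      real n * tnorm g x u * tnorm g (R (x, u)) w))"
proof -
  obtain c where c: "c \<in> \<A>" "x0 \<in> chart_dom c" by (rule ex_chart)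
  define p0 where "p0 = chart_map c x0"
  let ?S = "chart_retraction_dom c c" and ?r = "chart_retraction c c"
  let ?J = "\<lambda>b z. frechet_derivative ?r (at z) (0, b)"
  have S: "open ?S" by (rule open_chart_retraction_dom[OF c(1) c(1)])
  have "(chart_map c x0, (0 :: ('a, 'e) tvec) c) \<in> ?S"
    by (rule in_chart_retraction_dom[OF c tangent_0]) (use c in simp)
  then have z0: "(p0, 0) \<in> ?S" by (simp add: p0_def)
  obtain r1 L1 where 1: "0 < r1" "0 \<le> L1" "cball (p0, 0) r1 \<subseteq> ?S"
    "\<And>y z. y \<in> cball (p0, 0) r1 \<Longrightarrow> z \<in> cball (p0, 0) r1 \<Longrightarrow> norm (?r y - ?r z) \<le> L1 * norm (y - z)"
    using Ck_on_1_locally_Lipschitz[OF chart_retraction_C1[OF c(1) c(1)] S z0] by blast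
  have "\<exists>r>0. \<exists>L\<ge>0. cball (p0, 0) r \<subseteq> ?S \<and> (\<forall>b\<in>Basis. \<forall>y\<in>cball (p0, 0) r. \<forall>z\<in>cball (p0, 0) r.
      norm (?J b y - ?J b z) \<le> L * norm (y - z))"
    by (rule Ck_on_1_locally_Lipschitz_family[OF finite_Basis chart_retraction_directional_C1[OF c(1) c(1)] S z0])
  then obtain r2 L2 where 2: "0 < r2" "0 \<le> L2"
    "\<And>b y z. b \<in> Basis \<Longrightarrow> y \<in> cball (p0, 0) r2 \<Longrightarrow> z \<in> cball (p0, 0) r2 \<Longrightarrow> norm (?J b y - ?J b z) \<le> L2 * norm (y - z)"
    by blast
  have p0: "p0 \<in> chart_img c" using c by (simp add: p0_def)
  have "\<exists>r>0. \<exists>L\<ge>0. cball p0 r \<subseteq> chart_img c \<and> (\<forall>ij\<in>Basis \<times> Basis. \<forall>p\<in>cball p0 r. \<forall>q\<in>cball p0 r.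
      norm (chart_metric c p (fst ij) (snd ij) - chart_metric c q (fst ij) (snd ij)) \<le> L * norm (p - q))"
    by (rule Ck_on_1_locally_Lipschitz_family[OF _ chart_metric_C1[OF c(1)] open_img[OF c(1)] p0]) simp
  then obtain r3 L3 where 3: "0 < r3" "0 \<le> L3" "cball p0 r3 \<subseteq> chart_img c"
    and L3: "\<And>ij p q. ij \<in> Basis \<times> Basis \<Longrightarrow> p \<in> cball p0 r3 \<Longrightarrow> q \<in> cball p0 r3 \<Longrightarrow>
      norm (chart_metric c p (fst ij) (snd ij) - chart_metric c q (fst ij) (snd ij)) \<le> L3 * norm (p - q)"
    by blast
  obtain m where m: "0 < m" "\<And>p a. p \<in> cball p0 r3 \<Longrightarrow> m * (norm a)\<^sup>2 \<le> chart_metric c p a a"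
    using chart_metric_bounds(1)[OF c(1) compact_cball 3(3)] by auto
  obtain M where M: "0 \<le> M" "\<And>p a b. p \<in> cball p0 r3 \<Longrightarrow> \<bar>chart_metric c p a b\<bar> \<le> M * norm a * norm b"
    using chart_metric_bounds(2)[OF c(1) compact_cball 3(3)] by auto
  \<comment> \<open>Number of coordinates, for estimates that sum over a basis.\<close>
  define N where "N = real (card (Basis :: 'e set))"
  have N0: "0 \<le> N" by (simp add: N_def)
  have metric_Lip: "\<bar>chart_metric c p a a - chart_metric c q a a\<bar> \<le> N * N * L3 * norm (p - q) * (norm a)\<^sup>2"
    if pq: "p \<in> cball p0 r3" "q \<in> cball p0 r3" for p q a
  proof -
    have pqc: "p \<in> chart_img c" "q \<in> chart_img c" using pq 3(3) by auto
    have "\<bar>chart_metric c p a a - chart_metric c q a a\<bar> =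
        \<bar>\<Sum>i\<in>Basis. \<Sum>j\<in>Basis. (a \<bullet> i) * (a \<bullet> j) * (chart_metric c p i j - chart_metric c q i j)\<bar>"
      unfolding chart_metric_expansion[OF c(1) pqc(1), of a a] chart_metric_expansion[OF c(1) pqc(2), of a a]
      by (simp add: sum_subtractf right_diff_distrib)
    also have "\<dots> \<le> (\<Sum>i\<in>Basis. \<Sum>j\<in>Basis. \<bar>(a \<bullet> i) * (a \<bullet> j) * (chart_metric c p i j - chart_metric c q i j)\<bar>)"
      by (intro order_trans[OF sum_abs] sum_mono sum_abs)
    also have "\<dots> \<le> (\<Sum>i\<in>(Basis::'e set). \<Sum>j\<in>(Basis::'e set). (norm a * norm a) * (L3 * norm (p - q)))"
      unfolding abs_mult using L3[OF _ pq, of "(_, _)"]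
      by (intro sum_mono mult_mono) (auto simp: Basis_le_norm)
    also have "\<dots> = N * N * L3 * norm (p - q) * (norm a)\<^sup>2"
      by (simp add: N_def power2_eq_square)
    finally show ?thesis .
  qed
  define r where "r = min r1 (min r2 r3)"
  have r: "0 < r" "r \<le> r1" "r \<le> r2" "r \<le> r3" using 1 2 3 by (auto simp: r_def)
  \<comment> \<open>By coercivity the coordinates of a tangent vector are at most
    \<open>\<kappa>\<close> times its norm.\<close>
  define \<kappa> where "\<kappa> = 1 / sqrt m"
  have \<kappa>: "0 < \<kappa>" using m by (simp add: \<kappa>_def)
  define \<alpha> where "\<alpha> = N * N * L3 * L1 * \<kappa> / m"
  define \<beta> where "\<beta> = M * (N * L2 * \<kappa>) / m"
  have \<alpha>\<beta>: "0 \<le> \<alpha>" "0 \<le> \<beta>" using N0 1 2 3 m M \<kappa> by (auto simp: \<alpha>_def \<beta>_def intro!: divide_nonneg_nonneg mult_nonneg_nonneg)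
  \<comment> \<open>The last bound makes \<open>n |u| \<le> 1\<close> keep both \<open>(x,
    u)\<close> and its image within the coordinate balls.\<close>
  obtain n where n: "max (max \<alpha> \<beta>) (2 * \<kappa> * (1 + L1) / r) \<le> real n" using real_arch_simple by blast
  define U where "U = chart_dom c \<inter> chart_map c -` ball p0 (r / 2)"
  have U: "open U" unfolding U_def
    by (rule continuous_open_preimage[OF chart_continuous[OF c(1)] open_dom[OF c(1)] open_ball])
  have x0U: "x0 \<in> U" using c r unfolding U_def by (simp add: p0_def)
  show ?thesis
  proof (intro exI[of _ U] exI[of _ n] conjI U x0U ballI impI)
    fix x u w
    assume x: "x \<in> U" and u: "u \<in> tangent_space \<A> x" and small: "real n * tnorm g x u \<le> 1"
      and w: "w \<in> tangent_space \<A> (R (x, u))"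
    define y where "y = R (x, u)"
    define p where "p = chart_map c x"
    define \<delta> where "\<delta> = tnorm g x u"
    have \<delta>: "0 \<le> \<delta>" using u by (simp add: \<delta>_def)
    have xc: "x \<in> chart_dom c" using x by (simp add: U_def)
    have pp0: "dist p0 p < r / 2" using x by (simp add: U_def p_def)
    have pr3: "p \<in> cball p0 r3" using pp0 r by simp
    have pc: "p \<in> chart_img c" using pr3 3(3) by auto
    have uc: "norm (u c) \<le> \<kappa> * \<delta>"
    proof -
      have "m * (norm (u c))\<^sup>2 \<le> \<delta>\<^sup>2"
        using m(2)[OF pr3, of "u c"] metric_chart[OF u u c(1) xc] tnorm_sq[OF u] by (simp add: p_def \<delta>_def)
      then have "sqrt (m * (norm (u c))\<^sup>2) \<le> \<delta>" using \<delta> real_le_lsqrt by blast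
      then show ?thesis using m(1) by (simp add: \<kappa>_def real_sqrt_mult field_simps)
    qed
    have small': "\<kappa> * (1 + L1) * \<delta> \<le> r / 2"
    proof -
      have "2 * \<kappa> * (1 + L1) / r * \<delta> \<le> real n * \<delta>" using n \<delta> by (intro mult_right_mono) auto
      then have "2 * \<kappa> * (1 + L1) / r * \<delta> \<le> 1" using small by (simp add: \<delta>_def)
      then show ?thesis using r(1) by (simp add: field_simps)
    qed
    have uc': "norm (u c) \<le> r / 2" and L1uc: "L1 * norm (u c) \<le> r / 2"
    proof -
      have "0 \<le> \<kappa> * L1 * \<delta>" "0 \<le> \<kappa> * \<delta>" using \<kappa> 1(2) \<delta> by auto
      then show "norm (u c) \<le> r / 2" using uc small' by (simp add: algebra_simps)
      have "L1 * norm (u c) \<le> L1 * (\<kappa> * \<delta>)" using uc 1(2) by (intro mult_left_mono)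
      then show "L1 * norm (u c) \<le> r / 2" using \<open>0 \<le> \<kappa> * \<delta>\<close> small' by (simp add: algebra_simps)
    qed
    define z where "z = (p, u c)"
    have z0r: "(p, 0) \<in> cball (p0, 0) r" using pp0 r(1) by (simp add: dist_Pair_Pair)
    have zr: "z \<in> cball (p0, 0) r"
    proof -
      have "dist (p0, 0) z \<le> dist p0 p + dist 0 (u c)"
        unfolding z_def dist_Pair_Pair by (rule sqrt_sum_squares_le_sum) auto
      then show ?thesis using pp0 uc' by simp
    qed
    have zz: "norm (z - (p, 0)) = norm (u c)" unfolding z_def by (simp add: norm_Pair)
    have zS: "z \<in> ?S" using zr r 1(3) by auto
    have tci: "tangent_chart_inv \<A> c z = (x, u)" unfolding z_def p_def by (rule tangent_chart_inv_coord[OF c(1) xc u])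
    have yc: "y \<in> chart_dom c" using zS tci by (simp add: chart_retraction_dom_def y_def)
    define q where "q = chart_map c y"
    have "?r z = q" using tci by (simp add: chart_retraction_def q_def y_def)
    moreover have "?r (p, 0) = p"
      using tangent_chart_inv_coord[OF c(1) xc tangent_0] xc c by (simp add: chart_retraction_def p_def)
    ultimately have "norm (q - p) \<le> L1 * norm (u c)"
      using 1(4)[OF subsetD[OF subset_cball[OF r(2)] zr] subsetD[OF subset_cball[OF r(2)] z0r]] zz by simp
    then have qp: "norm (q - p) \<le> L1 * (\<kappa> * \<delta>)" "norm (q - p) \<le> r / 2"
      using order_trans[OF _ mult_left_mono[OF uc 1(2)]] order_trans[OF _ L1uc] by auto
    have qr3: "q \<in> cball p0 r3"
      using qp(2) pp0 r(4) dist_triangle[of p0 q p] by (simp add: dist_norm norm_minus_commute)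
    have qc: "q \<in> chart_img c" using qr3 3(3) by auto
    have wy: "w \<in> tangent_space \<A> y" using w by (simp add: y_def)
    define a where "a = w c"
    define v where "v = coord_tvec \<A> c x a"
    have v: "v \<in> tangent_space \<A> x" and vc: "v c = a" using c xc by (auto simp: v_def)
    define b where "b = frechet_derivative ?r (at z) (0, a)"
    have b: "fibre_differential \<A> R x u v c = b"
      using fibre_differential_coord[OF c(1) xc u v c(1)] yc vc by (simp add: b_def z_def p_def y_def)
    have J0: "?J i (p, 0) = i" for i
      using fibre_differential_coord[OF c(1) xc tangent_0, of "coord_tvec \<A> c x i" c] c xc
      by (simp add: fibre_differential_0 p_def)
    have ba: "norm (b - a) \<le> N * (L2 * (\<kappa> * \<delta>)) * norm a"
    proof -
      have lin: "linear (\<lambda>a. frechet_derivative ?r (at z) (0, a))"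
      proof -
        have "linear (frechet_derivative ?r (at z))"
          by (rule has_derivative_linear[OF chart_retraction_has_derivative[OF c(1) c(1) zS]])
        from linear_add[OF this, of "(0, _)" "(0, _)"] linear_scale[OF this, of _ "(0, _)"]
        show ?thesis by (intro linearI) auto
      qed
      have "b = (\<Sum>i\<in>Basis. (a \<bullet> i) *\<^sub>R ?J i z)" unfolding b_def by (rule linear_euclidean_expansion[OF lin])
      moreover have "a = (\<Sum>i\<in>Basis. (a \<bullet> i) *\<^sub>R ?J i (p, 0))"
        unfolding J0 by (rule euclidean_representation[symmetric])
      ultimately have "b - a = (\<Sum>i\<in>Basis. (a \<bullet> i) *\<^sub>R (?J i z - ?J i (p, 0)))"
        by (simp add: sum_subtractf scaleR_diff_right)
      then have "norm (b - a) \<le> (\<Sum>i\<in>Basis. norm ((a \<bullet> i) *\<^sub>R (?J i z - ?J i (p, 0))))"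
        by (simp only: norm_sum)
      also have "\<dots> \<le> (\<Sum>i\<in>(Basis::'e set). norm a * (L2 * (\<kappa> * \<delta>)))"
      proof (rule sum_mono)
        fix i :: 'e assume i: "i \<in> Basis"
        have "norm (?J i z - ?J i (p, 0)) \<le> L2 * norm (z - (p, 0))"
          by (rule 2(3)[OF i subsetD[OF subset_cball[OF r(3)] zr] subsetD[OF subset_cball[OF r(3)] z0r]])
        also have "\<dots> \<le> L2 * (\<kappa> * \<delta>)" unfolding zz using uc 2(2) by (intro mult_left_mono)
        finally have "\<bar>a \<bullet> i\<bar> * norm (?J i z - ?J i (p, 0)) \<le> norm a * (L2 * (\<kappa> * \<delta>))"
          using Basis_le_norm[OF i, of a] by (intro mult_mono) auto
        then show "norm ((a \<bullet> i) *\<^sub>R (?J i z - ?J i (p, 0))) \<le> norm a * (L2 * (\<kappa> * \<delta>))" by simp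
      qed
      finally show ?thesis by (simp add: N_def mult_ac)
    qed
    define W where "W = tnorm g y w"
    define X where "X = tnorm g x (adj_fibre_differential \<A> g R x u w)"
    have W0: "0 \<le> W" using wy by (simp add: W_def)
    have X0: "0 \<le> X" using u w by (simp add: X_def)
    have W2: "W\<^sup>2 = chart_metric c q a a"
      using tnorm_sq[OF wy] metric_chart[OF wy wy c(1) yc] by (simp add: W_def a_def q_def)
    have aW: "(norm a)\<^sup>2 \<le> W\<^sup>2 / m" using m(2)[OF qr3, of a] m(1) W2 by (simp add: field_simps)
    have v_le: "tnorm g x v \<le> W * (1 + \<alpha> * \<delta>)"
    proof (rule power2_le_imp_le)
      have "(tnorm g x v)\<^sup>2 = chart_metric c p a a"
        using tnorm_sq[OF v] metric_chart[OF v v c(1) xc] vc by (simp add: p_def)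
      also have "\<dots> \<le> chart_metric c q a a + N * N * L3 * norm (p - q) * (norm a)\<^sup>2"
        using metric_Lip[OF pr3 qr3, of a] by linarith
      also have "\<dots> \<le> W\<^sup>2 + N * N * L3 * (L1 * (\<kappa> * \<delta>)) * (W\<^sup>2 / m)"
        unfolding W2[symmetric]
        using qp(1) aW N0 3(2) 1(2) \<kappa> \<delta> by (intro add_left_mono mult_mono) (auto simp: norm_minus_commute)
      also have "\<dots> = W\<^sup>2 * (1 + \<alpha> * \<delta>)" unfolding \<alpha>_def by (simp add: algebra_simps)
      also have "\<dots> \<le> W\<^sup>2 * (1 + \<alpha> * \<delta>)\<^sup>2"
      proof (rule mult_left_mono)
        have "0 \<le> \<alpha> * \<delta>" using \<alpha>\<beta> \<delta> by simp
        then show "1 + \<alpha> * \<delta> \<le> (1 + \<alpha> * \<delta>)\<^sup>2"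
          using power_increasing[of 1 2 "1 + \<alpha> * \<delta>"] by simp
      qed simp
      finally show "(tnorm g x v)\<^sup>2 \<le> (W * (1 + \<alpha> * \<delta>))\<^sup>2" by (simp add: power_mult_distrib)
    qed (use W0 \<alpha>\<beta> \<delta> in simp)
    have "chart_metric c q b a = g y (fibre_differential \<A> R x u v) w"
      using metric_chart[OF fibre_differential_in[OF u v] w c(1)] yc b by (simp add: q_def a_def y_def)
    also have "\<dots> = g x v (adj_fibre_differential \<A> g R x u w)"
      using metric_adj[OF u w v] by (simp add: y_def)
    also have "\<dots> \<le> tnorm g x v * X"
      using metric_Cauchy_Schwarz[OF v adj_in[OF u w]] unfolding X_def by linarith
    also have "\<dots> \<le> W * (1 + \<alpha> * \<delta>) * X" using v_le X0 by (rule mult_right_mono)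
    finally have main: "chart_metric c q b a \<le> W * (1 + \<alpha> * \<delta>) * X" .
    have "chart_metric c q a a = chart_metric c q b a - chart_metric c q (b - a) a"
      by (simp add: linear_diff[OF chart_metric_linear(1)[OF c(1) qc]])
    moreover have "\<bar>chart_metric c q (b - a) a\<bar> \<le> \<beta> * \<delta> * W\<^sup>2"
    proof -
      have "\<bar>chart_metric c q (b - a) a\<bar> \<le> M * norm (b - a) * norm a" by (rule M(2)[OF qr3])
      also have "\<dots> \<le> M * (N * (L2 * (\<kappa> * \<delta>)) * norm a) * norm a"
        using ba M(1) by (intro mult_right_mono mult_left_mono) auto
      also have "\<dots> = M * (N * (L2 * (\<kappa> * \<delta>))) * (norm a)\<^sup>2" by (simp add: power2_eq_square)
      also have "\<dots> \<le> M * (N * (L2 * (\<kappa> * \<delta>))) * (W\<^sup>2 / m)"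
        using aW M(1) N0 2(2) \<kappa> \<delta> by (intro mult_left_mono) auto
      finally show ?thesis unfolding \<beta>_def by (simp add: mult_ac)
    qed
    ultimately have "W\<^sup>2 \<le> W * (1 + \<alpha> * \<delta>) * X + \<beta> * \<delta> * W\<^sup>2" using main W2 by linarith
    then have "W * W \<le> W * ((1 + \<alpha> * \<delta>) * X + \<beta> * \<delta> * W)" by (simp add: power2_eq_square algebra_simps)
    moreover have "0 \<le> (1 + \<alpha> * \<delta>) * X + \<beta> * \<delta> * W" using \<alpha>\<beta> \<delta> X0 W0 by simp
    ultimately have "W \<le> (1 + \<alpha> * \<delta>) * X + \<beta> * \<delta> * W"
      using W0 by (cases "W = 0") (auto simp: mult_le_cancel_left)
    also have "\<dots> \<le> (1 + real n * \<delta>) * X + real n * \<delta> * W"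
      using n \<delta> X0 W0 by (intro add_mono mult_right_mono add_left_mono) auto
    finally show "tnorm g (R (x, u)) w \<le>
      (1 + real n * tnorm g x u) * tnorm g x (adj_fibre_differential \<A> g R x u w) +
      real n * tnorm g x u * tnorm g (R (x, u)) w"
      unfolding W_def X_def \<delta>_def y_def .
  qed
qed

text \<open>
  For short \<open>u\<close> the local comparison of norms is combined with the Lipschitz bound on the pulled
  back gradient; for long \<open>u\<close> the bound on the gradient over \<open>K\<close> is already at most a multiple of \<open>|u|\<close>.
\<close>

lemma gradient_norm_growth:
  assumes F: "Ck_function 1 \<A> F" and K: "compact K" and lip: "R_lipschitz_on \<A> g R K A (gradient \<A> g F)"
  shows "\<exists>C\<ge>0. \<forall>x\<in>K. \<forall>u\<in>tangent_space \<A> x. tnorm g x u \<le> A \<longrightarrow> R (x, u) \<in> K \<longrightarrow>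
    tnorm g (R (x, u)) (gradient \<A> g F (R (x, u))) \<le> tnorm g x (gradient \<A> g F x) + C * tnorm g x u"
proof -
  let ?G = "\<lambda>x. tnorm g x (gradient \<A> g F x)"
  let ?adj = "adj_fibre_differential \<A> g R"
  define Q where "Q n x \<longleftrightarrow> (\<forall>u\<in>tangent_space \<A> x. real n * tnorm g x u \<le> 1 \<longrightarrow>
    (\<forall>w\<in>tangent_space \<A> (R (x, u)). tnorm g (R (x, u)) w \<le>
      (1 + real n * tnorm g x u) * tnorm g x (?adj x u w) +
      real n * tnorm g x u * tnorm g (R (x, u)) w))" for n x
  have mono: "Q n x" if mn: "m \<le> n" and Qm: "Q m x" for m n x
    unfolding Q_def
  proof (intro ballI impI)
    fix u w assume u: "u \<in> tangent_space \<A> x" and small: "real n * tnorm g x u \<le> 1"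
      and w: "w \<in> tangent_space \<A> (R (x, u))"
    have mn': "real m * tnorm g x u \<le> real n * tnorm g x u" using mn u by (intro mult_right_mono) auto
    then have "tnorm g (R (x, u)) w \<le> (1 + real m * tnorm g x u) * tnorm g x (?adj x u w) +
      real m * tnorm g x u * tnorm g (R (x, u)) w" using Qm small u w unfolding Q_def by auto
    also have "\<dots> \<le> (1 + real n * tnorm g x u) * tnorm g x (?adj x u w) +
      real n * tnorm g x u * tnorm g (R (x, u)) w"
      by (rule add_mono[OF mult_right_mono mult_right_mono[OF mn']]) (use mn' u w in simp_all)
    finally show "tnorm g (R (x, u)) w \<le> \<dots>" .
  qed
  have "\<exists>n. \<forall>x\<in>K. Q n x"
  proof (rule compact_uniform_index[OF K])
    show "Q n x" if "m \<le> n" "Q m x" for m n x using that by (rule mono)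
    show "\<exists>U n. open U \<and> x \<in> U \<and> (\<forall>y\<in>U. Q n y)" for x
      using tnorm_le_adj_local[of x] unfolding Q_def .
  qed
  then obtain n where n: "\<And>x. x \<in> K \<Longrightarrow> Q n x" by blast
  have "compact (?G ` K)"
    by (rule compact_continuous_image[OF continuous_on_subset[OF tnorm_gradient_continuous[OF F]] K]) simp
  then obtain B0 where B0: "\<forall>x\<in>K. \<bar>?G x\<bar> \<le> B0" by (auto dest!: compact_imp_bounded simp: bounded_iff)
  define B where "B = max B0 0"
  have "?G x \<le> B" if "x \<in> K" for x using B0 that unfolding B_def by force
  then have B: "0 \<le> B" "\<And>x. x \<in> K \<Longrightarrow> ?G x \<le> B" by (simp_all add: B_def)
  obtain C1 where C1: "0 < C1" "\<And>x u. x \<in> K \<Longrightarrow> u \<in> tangent_space \<A> x \<Longrightarrow> tnorm g x u \<le> A \<Longrightarrow>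
      tnorm g x (?adj x u (gradient \<A> g F (R (x, u))) - gradient \<A> g F x) \<le> C1 * tnorm g x u"
    using lip unfolding R_lipschitz_on_def by auto
  define C where "C = 2 * C1 + 2 * real n * B"
  show ?thesis
  proof (intro exI[of _ C] conjI ballI impI)
    show "0 \<le> C" using B C1 by (simp add: C_def)
    fix x u assume x: "x \<in> K" and u: "u \<in> tangent_space \<A> x" and uA: "tnorm g x u \<le> A" and y: "R (x, u) \<in> K"
    define \<delta> where "\<delta> = tnorm g x u"
    have \<delta>: "0 \<le> \<delta>" using u by (simp add: \<delta>_def)
    show "?G (R (x, u)) \<le> ?G x + C * tnorm g x u"
    proof (cases "real n * \<delta> \<le> 1")
      case False
      have "?G (R (x, u)) \<le> B * 1" using B(2)[OF y] by simp
      also have "\<dots> \<le> B * (real n * \<delta>)" using False B by (intro mult_left_mono) auto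
      also have "\<dots> \<le> C * \<delta>"
      proof -
        have "B * real n \<le> C" using C1 B by (simp add: C_def mult_ac)
        then show ?thesis using \<delta> mult_right_mono[of "B * real n" C \<delta>] by (simp add: mult_ac)
      qed
      finally show ?thesis using tnorm_nonneg[OF gradient_in[OF F, of x]] unfolding \<delta>_def by linarith
    next
      case True
      let ?w = "gradient \<A> g F (R (x, u))"
      have w: "?w \<in> tangent_space \<A> (R (x, u))" using F by simp
      define X where "X = tnorm g x (?adj x u ?w)"
      have X: "X \<le> ?G x + C1 * \<delta>"
      proof -
        have "X = tnorm g x ((?adj x u ?w - gradient \<A> g F x) + gradient \<A> g F x)" by (simp add: X_def)
        also have "\<dots> \<le> tnorm g x (?adj x u ?w - gradient \<A> g F x) + ?G x"
          using u w F by (intro tnorm_triangle) auto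
        finally show ?thesis using C1(2)[OF x u uA] by (simp add: \<delta>_def)
      qed
      have "?G (R (x, u)) \<le> (1 + real n * \<delta>) * X + real n * \<delta> * ?G (R (x, u))"
        using n[OF x] u w True unfolding Q_def X_def \<delta>_def by blast
      also have "\<dots> \<le> (1 + real n * \<delta>) * (?G x + C1 * \<delta>) + real n * \<delta> * B"
        using X B(2)[OF y] \<delta> by (intro add_mono mult_left_mono) auto
      also have "\<dots> = ?G x + C1 * \<delta> + (real n * \<delta>) * ?G x + (real n * \<delta>) * (C1 * \<delta>) + real n * \<delta> * B"
        by (simp add: algebra_simps)
      also have "\<dots> \<le> ?G x + C1 * \<delta> + (real n * \<delta>) * B + 1 * (C1 * \<delta>) + real n * \<delta> * B"
        using True B(2)[OF x] \<delta> C1(1) by (intro add_mono mult_left_mono mult_right_mono order_refl) auto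
      also have "\<dots> = ?G x + C * \<delta>" by (simp add: C_def algebra_simps)
      finally show ?thesis by (simp add: \<delta>_def)
    qed
  qed
qed

end

section \<open>Borel structure of the tangent bundle\<close>

context smooth_manifold
begin

lemma topspace_tangent_topology: "topspace (tangent_topology \<A>) = tangent_bundle \<A>"
proof
  show "topspace (tangent_topology \<A>) \<subseteq> tangent_bundle \<A>"
    unfolding tangent_topology_def topology_generated_by_topspace by blast
  show "tangent_bundle \<A> \<subseteq> topspace (tangent_topology \<A>)"
  proof
    fix z assume z: "z \<in> tangent_bundle \<A>"
    obtain c where c: "c \<in> \<A>" "fst z \<in> chart_dom c" by (rule ex_chart)
    have "openin (tangent_topology \<A>) {(x, v). (x, v) \<in> tangent_bundle \<A> \<and> x \<in> chart_dom c \<and> (chart_map c x, v c) \<in> UNIV}"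
      unfolding tangent_topology_def using c(1) open_UNIV by (intro topology_generated_by_Basis) blast
    from openin_subset[OF this] show "z \<in> topspace (tangent_topology \<A>)" using z c by (auto simp: case_prod_beta)
  qed
qed

lemma openin_tangent_chart:
  "c \<in> \<A> \<Longrightarrow> open W \<Longrightarrow>
    openin (tangent_topology \<A>) {(x, v). (x, v) \<in> tangent_bundle \<A> \<and> x \<in> chart_dom c \<and> (chart_map c x, v c) \<in> W}"
  unfolding tangent_topology_def by (intro topology_generated_by_Basis) blast

lemma tangent_borel_space: "space (tangent_borel \<A>) = tangent_bundle \<A>"
  unfolding tangent_borel_def by (simp add: space_measure_of_conv)

lemma tangent_borel_measurable:
  fixes f :: "'a \<times> ('a, 'e) tvec \<Rightarrow> 'c::topological_space"
  assumes f: "continuous_map (tangent_topology \<A>) euclidean f"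
  shows "f \<in> borel_measurable (tangent_borel \<A>)"
proof (rule borel_measurableI)
  fix S :: "'c set" assume "open S"
  then have "openin (tangent_topology \<A>) {z \<in> tangent_bundle \<A>. f z \<in> S}"
    using f unfolding continuous_map_def topspace_tangent_topology by simp
  moreover have "sets (tangent_borel \<A>) = sigma_sets (tangent_bundle \<A>) {W. openin (tangent_topology \<A>) W}"
    unfolding tangent_borel_def using openin_subset topspace_tangent_topology by (intro sets_measure_of) blast
  moreover have "f -` S \<inter> space (tangent_borel \<A>) = {z \<in> tangent_bundle \<A>. f z \<in> S}"
    unfolding tangent_borel_space by auto
  ultimately show "f -` S \<inter> space (tangent_borel \<A>) \<in> sets (tangent_borel \<A>)"
    by (simp add: sigma_sets.Basic)
qed

lemma tangent_scaling_continuous: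
  "continuous_map (tangent_topology \<A>) (tangent_topology \<A>) (\<lambda>(x, v). (x, r *\<^sub>R v))"
proof -
  let ?f = "\<lambda>(x, v). (x, r *\<^sub>R v) :: 'a \<times> ('a, 'e) tvec"
  have "continuous_map (tangent_topology \<A>) (topology_generated_by
      {{(x, v). (x, v) \<in> tangent_bundle \<A> \<and> x \<in> chart_dom c \<and> (chart_map c x, v c) \<in> W} | c W. c \<in> \<A> \<and> open W}) ?f"
  proof (rule continuous_on_generated_topo)
    fix U assume "U \<in> {{(x, v). (x, v) \<in> tangent_bundle \<A> \<and> x \<in> chart_dom c \<and> (chart_map c x, v c) \<in> W} | c W.
          c \<in> \<A> \<and> open W}"
    then obtain c W where c: "c \<in> \<A>" and W: "open W"
      and U: "U = {(x, v). (x, v) \<in> tangent_bundle \<A> \<and> x \<in> chart_dom c \<and> (chart_map c x, v c) \<in> W}" by blast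
    let ?W = "(\<lambda>z. (fst z, r *\<^sub>R snd z)) -` W"
    have "open ?W" by (intro open_vimage W continuous_intros)
    from openin_tangent_chart[OF c this]
    show "openin (tangent_topology \<A>) (?f -` U \<inter> topspace (tangent_topology \<A>))"
    proof (rule back_subst[of "openin (tangent_topology \<A>)"])
      show "{(x, v). (x, v) \<in> tangent_bundle \<A> \<and> x \<in> chart_dom c \<and> (chart_map c x, v c) \<in> ?W} =
          ?f -` U \<inter> topspace (tangent_topology \<A>)"
        unfolding U topspace_tangent_topology by (auto simp: tangent_bundle_def scaleR_fun_apply)
    qed
  next
    have "?f ` topspace (tangent_topology \<A>) \<subseteq> topspace (tangent_topology \<A>)"
      unfolding topspace_tangent_topology by (auto simp: tangent_bundle_def)
    also have "topspace (tangent_topology \<A>) = \<Union>{{(x, v). (x, v) \<in> tangent_bundle \<A> \<and> x \<in> chart_dom c \<and> (chart_map c x, v c) \<in> W} | c W.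
          c \<in> \<A> \<and> open W}" unfolding tangent_topology_def by (rule topology_generated_by_topspace)
    finally show "?f ` topspace (tangent_topology \<A>) \<subseteq> \<dots>" .
  qed
  then show ?thesis unfolding tangent_topology_def[symmetric] .
qed

text \<open>
  Since the pieces of the bundle over the chart domains are open, continuity can be checked in bundle charts.
\<close>

lemma differential_continuous:
  assumes F: "Ck_function 1 \<A> F"
  shows "continuous_map (tangent_topology \<A>) euclidean (\<lambda>(x, v). differential \<A> F x v)"
  unfolding continuous_map_def
proof (intro conjI allI impI)
  fix U :: "real set" assume "openin euclidean U"
  then have U: "open U" by simp
  define h where "h c = (\<lambda>(p, a). frechet_derivative (F \<circ> chart_inv c) (at p) a)" for c :: "('a, 'e) chart"
  define W where "W c = chart_img c \<times> UNIV \<inter> h c -` U" for c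
  let ?O = "\<lambda>c. {(x, v). (x, v) \<in> tangent_bundle \<A> \<and> x \<in> chart_dom c \<and> (chart_map c x, v c) \<in> W c}"
  have "open (W c)" if c: "c \<in> \<A>" for c
  proof -
    have "Ck_on 1 (chart_img c) (F \<circ> chart_inv c)" using F c unfolding Ck_function_def by blast
    then have "continuous_on (chart_img c \<times> UNIV) (h c)"
      unfolding h_def by (rule Ck_on_1_continuous_frechet)
    then show ?thesis unfolding W_def
      by (rule continuous_open_preimage[OF _ open_Times[OF open_img[OF c] open_UNIV] U])
  qed
  then have "openin (tangent_topology \<A>) (\<Union>c\<in>\<A>. ?O c)"
    by (intro openin_clauses(3)[rule_format]) (auto intro: openin_tangent_chart)
  moreover have "{z \<in> topspace (tangent_topology \<A>). (case z of (x, v) \<Rightarrow> differential \<A> F x v) \<in> U} = (\<Union>c\<in>\<A>. ?O c)"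
  proof -
    have "differential \<A> F x v \<in> U \<longleftrightarrow> (chart_map c x, v c) \<in> W c"
      if "c \<in> \<A>" "x \<in> chart_dom c" "v \<in> tangent_space \<A> x" for c x v
      using that by (simp add: differential_chart[OF F] W_def h_def)
    moreover have "\<exists>c\<in>\<A>. x \<in> chart_dom c" for x using cover by blast
    ultimately show ?thesis
      unfolding topspace_tangent_topology tangent_bundle_def by (simp add: set_eq_iff) blast
  qed
  ultimately show "openin (tangent_topology \<A>) {z \<in> topspace (tangent_topology \<A>). (case z of (x, v) \<Rightarrow> differential \<A> F x v) \<in> U}"
    by simp
qed simp

end

section \<open>Almost sure convergence of centred random increments\<close>

context prob_space
begin

text \<open>
  The increments are stopped as soon as a partial sum reaches \<open>e\<close>.  Stopping depends on the past only,
  so the stopped increments are still orthogonal and the second moment of their sum is at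
  most the sum of the \<open>(c t)\<^sup>2\<close>.  Once \<open>e\<close> has been reached the stopped sum stays there, so
  Markov's inequality for the square of its final value controls the maximum.
\<close>

lemma orthogonal_maximal_inequality:
  fixes D :: "nat \<Rightarrow> 'a \<Rightarrow> real"
  assumes sub: "\<And>t. subalgebra M (G t)"
    and mono: "\<And>s t. s \<le> t \<Longrightarrow> sets (G s) \<subseteq> sets (G t)"
    and D: "\<And>t. D t \<in> borel_measurable (G (Suc t))"
    and bnd: "\<And>t p. p \<in> space M \<Longrightarrow> \<bar>D t p\<bar> \<le> c t"
    and orth: "\<And>t Z B. Z \<in> borel_measurable (G t) \<Longrightarrow> (\<And>p. p \<in> space M \<Longrightarrow> \<bar>Z p\<bar> \<le> B) \<Longrightarrow>
        expectation (\<lambda>p. Z p * D t p) = 0"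
    and e: "0 < e"
  shows "prob {p \<in> space M. \<exists>n\<in>{m..N}. e \<le> \<bar>\<Sum>t=m..<n. D t p\<bar>} \<le> (\<Sum>t=m..<N. (c t)\<^sup>2) / e\<^sup>2"
proof -
  have spG: "space (G t) = space M" for t using sub by (simp add: subalgebra_def)
  have GM: "f \<in> borel_measurable M" if "f \<in> borel_measurable (G t)" for t and f :: "'a \<Rightarrow> real"
    using that measurable_from_subalg[OF sub] by blast
  have Gmono: "f \<in> borel_measurable (G t)" if "f \<in> borel_measurable (G s)" "s \<le> t"
    for s t and f :: "'a \<Rightarrow> real"
    using that measurable_from_subalg[of "G t" "G s"] mono[of s t] spG by (simp add: subalgebra_def)
  have DG: "D t \<in> borel_measurable (G u)" if "t < u" for t u
    using Gmono[OF D] that by simp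
  define S where "S n p = (\<Sum>t=m..<n. D t p)" for n p
  \<comment> \<open>\<open>J t\<close> indicates that no partial sum up to time \<open>t\<close>
    has reached \<open>e\<close>; \<open>E\<close> are the stopped increments and \<open>V\<close>
    their partial sums.\<close>
  define J where "J t p = (if \<forall>j\<in>{m..t}. \<bar>S j p\<bar> < e then 1 else 0 :: real)" for t p
  define E where "E t p = J t p * D t p" for t p
  define V where "V n p = (\<Sum>t=m..<n. E t p)" for n p
  have SG: "S n \<in> borel_measurable (G t)" if "n \<le> t" for n t
    unfolding S_def using that by (intro borel_measurable_sum DG) auto
  have JG: "J t \<in> borel_measurable (G t)" for t
  proof -
    have "{p \<in> space (G t). \<forall>j\<in>{m..t}. \<bar>S j p\<bar> < e} \<in> sets (G t)"
    proof (cases "m \<le> t")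
      case True
      show ?thesis
      proof (rule sets.sets_Collect_finite_All')
        fix j assume "j \<in> {m..t}"
        then have [measurable]: "S j \<in> borel_measurable (G t)" using SG by simp
        show "{p \<in> space (G t). \<bar>S j p\<bar> < e} \<in> sets (G t)" by measurable
      qed (use True in auto)
    qed simp
    then show ?thesis unfolding J_def by (intro measurable_If) auto
  qed
  have J01: "0 \<le> J t p" "J t p \<le> 1" for t p by (auto simp: J_def)
  have EG: "E t \<in> borel_measurable (G u)" if "t < u" for t u
    unfolding E_def using that DG Gmono[OF JG] by (intro borel_measurable_times) auto
  have Ebnd: "\<bar>E t p\<bar> \<le> c t" if "p \<in> space M" for t p
    using bnd[OF that, of t] J01[of t p] mult_mono[of "\<bar>J t p\<bar>" 1 "\<bar>D t p\<bar>" "c t"]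
    by (simp add: E_def abs_mult)
  have VG: "V n \<in> borel_measurable (G n)" for n
    unfolding V_def by (intro borel_measurable_sum EG) auto
  have Vbnd: "\<bar>V n p\<bar> \<le> (\<Sum>t=m..<n. c t)" if "p \<in> space M" for n p
    unfolding V_def using Ebnd[OF that] by (intro order_trans[OF sum_abs] sum_mono)
  have c0: "0 \<le> c t" for t
  proof -
    obtain p where "p \<in> space M" using not_empty by blast
    then show ?thesis using bnd[of p t] by linarith
  qed
  have int_bdd: "integrable M f" if "f \<in> borel_measurable M" "\<And>p. p \<in> space M \<Longrightarrow> \<bar>f p\<bar> \<le> B"
    for f :: "'a \<Rightarrow> real" and B
    using that by (intro integrable_const_bound[of _ B]) auto
  have VM[measurable]: "V n \<in> borel_measurable M" for n using GM[OF VG] .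
  have EM[measurable]: "E n \<in> borel_measurable M" for n using GM[OF EG[of n "Suc n"]] by simp
  have sq_le: "a\<^sup>2 \<le> b\<^sup>2" if "\<bar>a\<bar> \<le> b" for a b :: real
    using that power_mono[of "\<bar>a\<bar>" b 2] by simp
  have intV: "integrable M (\<lambda>p. (V n p)\<^sup>2)" for n
    using Vbnd by (intro int_bdd[of _ "(\<Sum>t=m..<n. c t)\<^sup>2"]) (auto simp: sq_le)
  have sqV: "expectation (\<lambda>p. (V n p)\<^sup>2) \<le> (\<Sum>t=m..<n. (c t)\<^sup>2)" for n
  proof (induction n)
    case 0
    then show ?case by (simp add: V_def)
  next
    case (Suc n)
    show ?case
    proof (cases "m \<le> n")
      case False
      then show ?thesis by (simp add: V_def)
    next
      case True
      have Vs: "V (Suc n) p = V n p + E n p" for p using True by (simp add: V_def)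
      have i2: "integrable M (\<lambda>p. (V n p * J n p) * D n p)"
      proof (rule int_bdd)
        show "(\<lambda>p. V n p * J n p * D n p) \<in> borel_measurable M"
          using VM GM[OF JG] GM[OF D] by (intro borel_measurable_times)
        fix p assume p: "p \<in> space M"
        have "\<bar>V n p * E n p\<bar> \<le> (\<Sum>t=m..<n. c t) * c n"
          unfolding abs_mult using Vbnd[OF p] Ebnd[OF p] c0 by (intro mult_mono) (auto intro: sum_nonneg)
        then show "\<bar>V n p * J n p * D n p\<bar> \<le> (\<Sum>t=m..<n. c t) * c n" by (simp add: E_def mult.assoc)
      qed
      have cross: "expectation (\<lambda>p. (V n p * J n p) * D n p) = 0"
      proof (rule orth)
        show "(\<lambda>p. V n p * J n p) \<in> borel_measurable (G n)" using VG JG by (intro borel_measurable_times)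
        fix p assume p: "p \<in> space M"
        show "\<bar>V n p * J n p\<bar> \<le> (\<Sum>t=m..<n. c t)"
          using Vbnd[OF p, of n] J01[of n p] mult_mono[of "\<bar>V n p\<bar>" "\<Sum>t=m..<n. c t" "\<bar>J n p\<bar>" 1]
          by (simp add: abs_mult)
      qed
      have i3: "integrable M (\<lambda>p. (E n p)\<^sup>2)"
        using Ebnd c0 by (intro int_bdd[of _ "(c n)\<^sup>2"]) (auto simp: sq_le)
      have "expectation (\<lambda>p. (E n p)\<^sup>2) \<le> expectation (\<lambda>p. (c n)\<^sup>2)"
        using Ebnd i3 c0 by (intro integral_mono) (auto simp: sq_le)
      then have E2: "expectation (\<lambda>p. (E n p)\<^sup>2) \<le> (c n)\<^sup>2" by (simp add: prob_space)
      have "(\<lambda>p. (V (Suc n) p)\<^sup>2) = (\<lambda>p. (V n p)\<^sup>2 + 2 * ((V n p * J n p) * D n p) + (E n p)\<^sup>2)"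
        by (simp add: Vs power2_sum E_def algebra_simps)
      then have "expectation (\<lambda>p. (V (Suc n) p)\<^sup>2) = expectation (\<lambda>p. (V n p)\<^sup>2) + expectation (\<lambda>p. (E n p)\<^sup>2)"
        using intV i2 i3 cross by simp
      then show ?thesis using Suc E2 True by simp
    qed
  qed
  have stop: "e \<le> \<bar>V N p\<bar>" if "n \<in> {m..N}" "e \<le> \<bar>S n p\<bar>" for n p
  proof -
    define k where "k = (LEAST k. m \<le> k \<and> e \<le> \<bar>S k p\<bar>)"
    have k: "m \<le> k" "e \<le> \<bar>S k p\<bar>" using LeastI[of "\<lambda>k. m \<le> k \<and> e \<le> \<bar>S k p\<bar>" n] that
      unfolding k_def by auto
    have kN: "k \<le> N" using Least_le[of "\<lambda>k. m \<le> k \<and> e \<le> \<bar>S k p\<bar>" n] that unfolding k_def by auto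
    have less: "\<bar>S j p\<bar> < e" if "m \<le> j" "j < k" for j
      using not_less_Least[of j "\<lambda>k. m \<le> k \<and> e \<le> \<bar>S k p\<bar>"] that unfolding k_def by auto
    have "V N p = (\<Sum>t=m..<k. E t p) + (\<Sum>t=k..<N. E t p)"
      unfolding V_def using k(1) kN by (simp add: sum.atLeastLessThan_concat)
    also have "(\<Sum>t=k..<N. E t p) = 0"
    proof (rule sum.neutral, rule ballI)
      fix t assume t: "t \<in> {k..<N}"
      have "\<not> (\<forall>j\<in>{m..t}. \<bar>S j p\<bar> < e)" using k t by (auto intro!: bexI[of _ k])
      then have "J t p = 0" unfolding J_def by (rule if_not_P)
      then show "E t p = 0" unfolding E_def by simp
    qed
    also have "(\<Sum>t=m..<k. E t p) = S k p"
      unfolding S_def using less by (intro sum.cong) (auto simp: E_def J_def)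
    finally show ?thesis using k(2) by simp
  qed
  have "prob {p \<in> space M. \<exists>n\<in>{m..N}. e \<le> \<bar>\<Sum>t=m..<n. D t p\<bar>} \<le> prob {p \<in> space M. e\<^sup>2 \<le> (V N p)\<^sup>2}"
  proof (rule finite_measure_mono)
    show "{p \<in> space M. e\<^sup>2 \<le> (V N p)\<^sup>2} \<in> sets M" by measurable
    show "{p \<in> space M. \<exists>n\<in>{m..N}. e \<le> \<bar>\<Sum>t=m..<n. D t p\<bar>} \<subseteq> {p \<in> space M. e\<^sup>2 \<le> (V N p)\<^sup>2}"
    proof (intro subsetI CollectI, elim CollectE conjE bexE, intro conjI)
      fix p n assume n: "n \<in> {m..N}" "e \<le> \<bar>\<Sum>t=m..<n. D t p\<bar>"
      have "e \<le> \<bar>V N p\<bar>" using stop[OF n(1)] n(2) unfolding S_def by simp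
      then have "e\<^sup>2 \<le> \<bar>V N p\<bar>\<^sup>2" using e by (intro power_mono) auto
      then show "e\<^sup>2 \<le> (V N p)\<^sup>2" by simp
    qed
  qed
  also have "\<dots> \<le> expectation (\<lambda>p. (V N p)\<^sup>2) / e\<^sup>2"
    by (rule integral_Markov_inequality_measure[where A="{}"]) (use intV e in auto)
  also have "\<dots> \<le> (\<Sum>t=m..<N. (c t)\<^sup>2) / e\<^sup>2" using sqV by (simp add: divide_right_mono)
  finally show ?thesis .
qed

text \<open>
  The maximal inequality, applied to tails of the series, shows that the partial sums are almost surely Cauchy.
\<close>

lemma orthogonal_increments_summable:
  fixes D :: "nat \<Rightarrow> 'a \<Rightarrow> real"
  assumes sub: "\<And>t. subalgebra M (G t)"
    and mono: "\<And>s t. s \<le> t \<Longrightarrow> sets (G s) \<subseteq> sets (G t)"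
    and D: "\<And>t. D t \<in> borel_measurable (G (Suc t))"
    and bnd: "\<And>t p. p \<in> space M \<Longrightarrow> \<bar>D t p\<bar> \<le> c t"
    and orth: "\<And>t Z B. Z \<in> borel_measurable (G t) \<Longrightarrow> (\<And>p. p \<in> space M \<Longrightarrow> \<bar>Z p\<bar> \<le> B) \<Longrightarrow>
        expectation (\<lambda>p. Z p * D t p) = 0"
    and c: "summable (\<lambda>t. (c t)\<^sup>2)"
  shows "AE p in M. summable (\<lambda>t. D t p)"
proof -
  have DM[measurable]: "D t \<in> borel_measurable M" for t
    using D measurable_from_subalg[OF sub] by blast
  define X where "X e m N = {p \<in> space M. \<exists>n\<in>{m..N}. e \<le> \<bar>\<Sum>t=m..<n. D t p\<bar>}" for e m N
  define Y where "Y e m = {p \<in> space M. \<exists>n\<ge>m. e \<le> \<bar>\<Sum>t=m..<n. D t p\<bar>}" for e m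
  have Xm: "X e m N \<in> sets M" for e m N unfolding X_def by measurable
  have Ym[measurable]: "Y e m \<in> sets M" for e m unfolding Y_def by measurable
  have Yle: "prob (Y e m) \<le> (\<Sum>t. (c (t + m))\<^sup>2) / e\<^sup>2" if "0 < e" for e m
  proof (rule LIMSEQ_le_const2)
    have "(\<Union>N. X e m N) = Y e m" unfolding X_def Y_def by fastforce
    moreover have "incseq (X e m)" unfolding X_def incseq_def by fastforce
    moreover have "range (X e m) \<subseteq> sets M" using Xm by auto
    ultimately show "(\<lambda>N. prob (X e m N)) \<longlonglongrightarrow> prob (Y e m)"
      using finite_Lim_measure_incseq[of "X e m"] by simp
    have "prob (X e m N) \<le> (\<Sum>t. (c (t + m))\<^sup>2) / e\<^sup>2" for N
    proof -
      have "prob (X e m N) \<le> (\<Sum>t=m..<N. (c t)\<^sup>2) / e\<^sup>2"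
        unfolding X_def by (rule orthogonal_maximal_inequality[where G=G and D=D and c=c, OF sub mono D bnd orth that])
      also have "(\<Sum>t=m..<N. (c t)\<^sup>2) = (\<Sum>t\<in>{..<N - m}. (c (t + m))\<^sup>2)"
        by (rule sum.reindex_bij_witness[of _ "\<lambda>t. t + m" "\<lambda>t. t - m"]) auto
      also have "\<dots> \<le> (\<Sum>t. (c (t + m))\<^sup>2)"
        by (rule sum_le_suminf) (use c summable_iff_shift[of "\<lambda>t. (c t)\<^sup>2" m] in auto)
      finally show ?thesis by (simp add: divide_right_mono)
    qed
    then show "\<exists>N. \<forall>n\<ge>N. prob (X e m n) \<le> (\<Sum>t. (c (t + m))\<^sup>2) / e\<^sup>2" by blast
  qed
  have AEe: "AE p in M. \<exists>m. p \<notin> Y e m" if e: "0 < e" for e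
  proof -
    have "prob (\<Inter>m. Y e m) \<le> 0"
    proof (rule LIMSEQ_le_const)
      have "(\<lambda>m. (\<Sum>t. (c (t + m))\<^sup>2) / e\<^sup>2) \<longlonglongrightarrow> 0 / e\<^sup>2"
        using e by (intro tendsto_divide suminf_exist_split2[OF c] tendsto_const) auto
      then show "(\<lambda>m. (\<Sum>t. (c (t + m))\<^sup>2) / e\<^sup>2) \<longlonglongrightarrow> 0" by simp
      have "prob (\<Inter>m. Y e m) \<le> prob (Y e m)" for m
        by (intro finite_measure_mono) auto
      then show "\<exists>N. \<forall>m\<ge>N. prob (\<Inter>m. Y e m) \<le> (\<Sum>t. (c (t + m))\<^sup>2) / e\<^sup>2"
        using Yle[OF e] order_trans by blast
    qed
    then have "prob (\<Inter>m. Y e m) = 0" by (simp add: measure_le_0_iff)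
    then have "emeasure M (\<Inter>m. Y e m) = 0" by (simp add: emeasure_eq_measure)
    moreover have "(\<Inter>m. Y e m) \<in> sets M" by auto
    ultimately have "(\<Inter>m. Y e m) \<in> null_sets M" by auto
    then show ?thesis by (rule AE_I') auto
  qed
  have "AE p in M. \<forall>k. \<exists>m. p \<notin> Y (inverse (real (Suc k))) m"
    by (subst AE_all_countable, intro allI AEe) simp
  then show ?thesis
  proof (rule AE_mp, intro AE_I2 impI)
    fix p assume p: "p \<in> space M" and *: "\<forall>k. \<exists>m. p \<notin> Y (inverse (real (Suc k))) m"
    have "Cauchy (\<lambda>n. \<Sum>t<n. D t p)"
    proof (rule metric_CauchyI)
      fix r :: real assume r: "0 < r"
      then obtain k where k: "inverse (real (Suc k)) < r / 2"
        using reals_Archimedean[of "r/2"] by auto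
      obtain m where m: "p \<notin> Y (inverse (real (Suc k))) m" using * by blast
      have near: "\<bar>(\<Sum>t<n. D t p) - (\<Sum>t<m. D t p)\<bar> < r / 2" if "n \<ge> m" for n
      proof -
        have "\<bar>\<Sum>t=m..<n. D t p\<bar> < inverse (real (Suc k))" using m p that unfolding Y_def by auto
        moreover have "(\<Sum>t<n. D t p) - (\<Sum>t<m. D t p) = (\<Sum>t=m..<n. D t p)"
          using that by (simp add: lessThan_atLeast0 sum_diff_nat_ivl)
        ultimately show ?thesis using k by simp
      qed
      show "\<exists>m. \<forall>i\<ge>m. \<forall>j\<ge>m. dist (\<Sum>t<i. D t p) (\<Sum>t<j. D t p) < r"
      proof (intro exI allI impI)
        fix i j assume "m \<le> i" "m \<le> j"
        then show "dist (\<Sum>t<i. D t p) (\<Sum>t<j. D t p) < r"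
          using near[of i] near[of j] unfolding dist_real_def by linarith
      qed
    qed
    then show "summable (\<lambda>t. D t p)"
      using Cauchy_convergent_iff summable_iff_convergent by blast
  qed
qed

text \<open>
  The grouping principle for independent families, applied to the blocks \<open>{..<t}\<close> and \<open>{t}\<close>.
\<close>

lemma indep_past_present:
  assumes indep: "indep_vars \<mu> \<omega> UNIV"
  defines "E \<equiv> \<lambda>i. {\<omega> i -` A \<inter> space M | A. A \<in> sets (\<mu> i)}"
  assumes A: "A \<in> sigma_sets (space M) (\<Union>i<t::nat. E i)" and B: "B \<in> sets (\<mu> t)"
  shows "prob (A \<inter> (\<omega> t -` B \<inter> space M)) = prob A * prob (\<omega> t -` B \<inter> space M)"
proof -
  have stable: "Int_stable (E i)" for i
  proof (rule Int_stableI)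
    fix a b assume "a \<in> E i" "b \<in> E i"
    then obtain A B where "a = \<omega> i -` A \<inter> space M" "b = \<omega> i -` B \<inter> space M"
      and AB: "A \<in> sets (\<mu> i)" "B \<in> sets (\<mu> i)" unfolding E_def by auto
    then have "a \<inter> b = \<omega> i -` (A \<inter> B) \<inter> space M" by auto
    then show "a \<inter> b \<in> E i" using AB unfolding E_def by blast
  qed
  have "indep_sets E UNIV" using indep unfolding indep_vars_def2 E_def by simp
  then have "indep_sets E (\<Union> (case_bool {..<t} {t} ` UNIV))" by (rule indep_sets_mono) auto
  then have "indep_sets (\<lambda>j. sigma_sets (space M) (\<Union> (E ` case_bool {..<t} {t} j))) UNIV"
    by (rule indep_sets_collect_sigma) (auto simp: stable disjoint_family_on_def split: bool.splits)
  moreover have "(\<lambda>j. sigma_sets (space M) (\<Union> (E ` case_bool {..<t} {t} j))) =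
      case_bool (sigma_sets (space M) (\<Union>i<t. E i)) (sigma_sets (space M) (E t))"
    by (auto simp: fun_eq_iff split: bool.splits)
  ultimately have ind: "indep_set (sigma_sets (space M) (\<Union>i<t. E i)) (sigma_sets (space M) (E t))"
    unfolding indep_set_def by simp
  have "\<omega> t -` B \<inter> space M \<in> sigma_sets (space M) (E t)"
    using B unfolding E_def by (intro sigma_sets.Basic) auto
  with ind A show ?thesis by (intro indep_setD)
qed

text \<open>
  The state \<open>x t\<close> is determined by the samples before time \<open>t\<close>, which are independent of \<open>\<omega> t\<close>.
  By Fubini, averaging over \<open>\<omega> t\<close> first, every bounded function of the past is orthogonal to the
  increment at time \<open>t\<close>.  The measurable structure \<open>N\<close> on the states is a parameter, so that
  the Borel structure of a manifold and the discrete structure are both covered.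
\<close>

lemma centred_increments_summable:
  fixes \<omega> :: "nat \<Rightarrow> 'a \<Rightarrow> 'w" and N :: "'s measure"
    and \<psi> :: "nat \<Rightarrow> 's \<times> 'w \<Rightarrow> real" and \<gamma> :: "nat \<Rightarrow> real"
  assumes prob: "\<And>t. prob_space (\<mu> t)"
    and indep: "indep_vars \<mu> \<omega> UNIV"
    and distr: "\<And>t. distr M (\<mu> t) (\<omega> t) = \<mu> t"
    and T: "\<And>t. T t \<in> N \<Otimes>\<^sub>M \<mu> t \<rightarrow>\<^sub>M N"
    and \<psi>: "\<And>t. \<psi> t \<in> borel_measurable (N \<Otimes>\<^sub>M \<mu> t)"
    and bnd: "\<And>t y w. y \<in> space N \<Longrightarrow> w \<in> space (\<mu> t) \<Longrightarrow> \<bar>\<psi> t (y, w)\<bar> \<le> B"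
    and centred: "\<And>t y. y \<in> space N \<Longrightarrow> (\<integral>w. \<psi> t (y, w) \<partial>\<mu> t) = 0"
    and x0: "x0 \<in> space N" "\<And>p. p \<in> space M \<Longrightarrow> x 0 p = x0"
    and x_Suc: "\<And>t p. p \<in> space M \<Longrightarrow> x (Suc t) p = T t (x t p, \<omega> t p)"
    and \<gamma>: "\<And>t. 0 \<le> \<gamma> t" "summable (\<lambda>t. (\<gamma> t)\<^sup>2)"
  shows "AE p in M. summable (\<lambda>t. \<gamma> t * \<psi> t (x t p, \<omega> t p))" and "x t \<in> M \<rightarrow>\<^sub>M N"
proof -
  define E where "E i = {\<omega> i -` A \<inter> space M | A. A \<in> sets (\<mu> i)}" for i
  define G where "G t = sigma (space M) (\<Union>i<t. E i)" for t
  have rv: "random_variable (\<mu> i) (\<omega> i)" for i using indep unfolding indep_vars_def2 by simp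
  have EM: "E i \<subseteq> sets M" for i using measurable_sets[OF rv] unfolding E_def by auto
  have Epow: "(\<Union>i<t. E i) \<subseteq> Pow (space M)" for t using EM sets.sets_into_space by blast
  have setsG: "sets (G t) = sigma_sets (space M) (\<Union>i<t. E i)" for t
    using Epow unfolding G_def by (simp add: sets_measure_of)
  have spG: "space (G t) = space M" for t unfolding G_def by (simp add: space_measure_of_conv)
  have sub: "subalgebra M (G t)" for t
    unfolding subalgebra_def spG setsG using EM by (auto intro!: sets.sigma_sets_subset)
  have mono: "sets (G s) \<subseteq> sets (G t)" if "s \<le> t" for s t
    unfolding setsG using that by (intro sigma_sets_mono') force
  have \<omega>G: "\<omega> t \<in> G (Suc t) \<rightarrow>\<^sub>M \<mu> t" for t
  proof (rule measurableI)
    fix A assume "A \<in> sets (\<mu> t)"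
    then have "\<omega> t -` A \<inter> space M \<in> (\<Union>i<Suc t. E i)" unfolding E_def by auto
    then show "\<omega> t -` A \<inter> space (G (Suc t)) \<in> sets (G (Suc t))" unfolding spG setsG by (rule sigma_sets.Basic)
  qed (use measurable_space[OF rv] spG in auto)
  have lift: "f \<in> G (Suc t) \<rightarrow>\<^sub>M N" if "f \<in> G t \<rightarrow>\<^sub>M N" for f t
    using measurable_from_subalg[of "G (Suc t)" "G t"] mono[of t "Suc t"] spG that
    by (simp add: subalgebra_def)
  have xG: "x t \<in> G t \<rightarrow>\<^sub>M N" for t
  proof (induction t)
    case 0
    have "(\<lambda>_. x0) \<in> G 0 \<rightarrow>\<^sub>M N" using x0 by simp
    then show ?case by (subst measurable_cong[where g="\<lambda>_. x0"]) (auto simp: spG x0)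
  next
    case (Suc t)
    have "(\<lambda>p. T t (x t p, \<omega> t p)) \<in> G (Suc t) \<rightarrow>\<^sub>M N"
      by (rule measurable_compose[OF measurable_Pair[OF lift[OF Suc] \<omega>G] T])
    then show ?case by (subst measurable_cong[where g="\<lambda>p. T t (x t p, \<omega> t p)"]) (auto simp: spG x_Suc)
  qed
  show "x t \<in> M \<rightarrow>\<^sub>M N" using measurable_from_subalg[OF sub xG] .
  show "AE p in M. summable (\<lambda>t. \<gamma> t * \<psi> t (x t p, \<omega> t p))"
  proof (rule orthogonal_increments_summable[where G=G and c="\<lambda>t. \<gamma> t * B"])
    show "subalgebra M (G t)" for t by (rule sub)
    show "sets (G s) \<subseteq> sets (G t)" if "s \<le> t" for s t by (rule mono[OF that])
    show "(\<lambda>p. \<gamma> t * \<psi> t (x t p, \<omega> t p)) \<in> borel_measurable (G (Suc t))" for t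
      using measurable_compose[OF measurable_Pair[OF lift[OF xG] \<omega>G] \<psi>] by simp
    have xs: "x t p \<in> space N" if "p \<in> space M" for t p
      using measurable_space[OF xG, of p t] that spG by simp
    show "\<bar>\<gamma> t * \<psi> t (x t p, \<omega> t p)\<bar> \<le> \<gamma> t * B" if "p \<in> space M" for t p
      unfolding abs_mult using bnd[OF xs[OF that] measurable_space[OF rv that], of t] \<gamma>(1)[of t]
      by (simp add: mult_left_mono)
    show "summable (\<lambda>t. (\<gamma> t * B)\<^sup>2)" using summable_mult2[OF \<gamma>(2)] by (simp add: power_mult_distrib)
    fix t and Z :: "'a \<Rightarrow> real" and C
    assume Z: "Z \<in> borel_measurable (G t)" and C: "\<And>p. p \<in> space M \<Longrightarrow> \<bar>Z p\<bar> \<le> C"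
    \<comment> \<open>\<open>?P\<close> is \<open>M\<close> restricted to the past; independence
      makes the joint law of the past and of the present sample a product.\<close>
    let ?P = "distr M (G t) (\<lambda>p. p)"
    have idm: "(\<lambda>p. p) \<in> M \<rightarrow>\<^sub>M G t"
      using measurable_from_subalg[OF sub measurable_ident_sets[OF refl]] by simp
    interpret mu: prob_space "\<mu> t" by (rule prob)
    interpret P: prob_space ?P by (rule prob_space_distr[OF idm])
    interpret pr: pair_prob_space ?P "\<mu> t" ..
    have pairm: "(\<lambda>p. (p, \<omega> t p)) \<in> M \<rightarrow>\<^sub>M G t \<Otimes>\<^sub>M \<mu> t" using idm rv by (rule measurable_Pair)
    have joint: "?P \<Otimes>\<^sub>M \<mu> t = distr M (G t \<Otimes>\<^sub>M \<mu> t) (\<lambda>p. (p, \<omega> t p))"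
    proof (rule pair_measure_eqI)
      show "sets (?P \<Otimes>\<^sub>M \<mu> t) = sets (distr M (G t \<Otimes>\<^sub>M \<mu> t) (\<lambda>p. (p, \<omega> t p)))"
        by (simp cong: sets_pair_measure_cong)
      fix A B assume "A \<in> sets ?P" and B: "B \<in> sets (\<mu> t)"
      then have A: "A \<in> sets (G t)" by simp
      have AM: "A \<inter> space M = A" using sets.sets_into_space[OF A] spG by auto
      have "prob (A \<inter> (\<omega> t -` B \<inter> space M)) = prob A * prob (\<omega> t -` B \<inter> space M)"
        using A B unfolding setsG E_def by (intro indep_past_present[OF indep])
      then have "emeasure M (A \<inter> (\<omega> t -` B \<inter> space M)) = emeasure M A * emeasure M (\<omega> t -` B \<inter> space M)"
        by (simp add: emeasure_eq_measure ennreal_mult)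
      moreover have "emeasure M (\<omega> t -` B \<inter> space M) = emeasure (\<mu> t) B"
        using emeasure_distr[OF rv B] by (simp add: distr)
      moreover have "emeasure ?P A = emeasure M A"
        using emeasure_distr[OF idm A] AM by simp
      moreover have "(\<lambda>p. (p, \<omega> t p)) -` (A \<times> B) \<inter> space M = A \<inter> (\<omega> t -` B \<inter> space M)"
        by auto
      ultimately show "emeasure ?P A * emeasure (\<mu> t) B =
          emeasure (distr M (G t \<Otimes>\<^sub>M \<mu> t) (\<lambda>p. (p, \<omega> t p))) (A \<times> B)"
        using A B by (simp add: emeasure_distr[OF pairm])
    qed (unfold_locales)
    define h where "h = (\<lambda>(p, w). Z p * (\<gamma> t * \<psi> t (x t p, w)))"
    have hm: "h \<in> borel_measurable (G t \<Otimes>\<^sub>M \<mu> t)"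
    proof -
      have "(\<lambda>z. (x t (fst z), snd z)) \<in> G t \<Otimes>\<^sub>M \<mu> t \<rightarrow>\<^sub>M N \<Otimes>\<^sub>M \<mu> t"
        using xG[of t] by measurable
      from measurable_compose[OF this \<psi>]
      have "(\<lambda>z. \<psi> t (x t (fst z), snd z)) \<in> borel_measurable (G t \<Otimes>\<^sub>M \<mu> t)" .
      moreover have "(\<lambda>z. Z (fst z)) \<in> borel_measurable (G t \<Otimes>\<^sub>M \<mu> t)" using Z by measurable
      ultimately show ?thesis unfolding h_def case_prod_beta by simp
    qed
    have hm': "h \<in> borel_measurable (?P \<Otimes>\<^sub>M \<mu> t)"
      using hm measurable_cong_sets[OF sets_pair_measure_cong[of ?P "G t" "\<mu> t" "\<mu> t"] refl] by simp
    have hb: "\<bar>h (p, w)\<bar> \<le> C * (\<gamma> t * B)" if "p \<in> space M" "w \<in> space (\<mu> t)" for p w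
    proof -
      have "0 \<le> C" using C[OF that(1)] by linarith
      then show ?thesis
        unfolding h_def case_prod_conv abs_mult
        using C[OF that(1)] bnd[OF xs[OF that(1), of t] that(2)] \<gamma>(1)[of t]
        by (intro mult_mono) (auto intro!: mult_left_mono)
    qed
    have hint: "integrable (?P \<Otimes>\<^sub>M \<mu> t) h"
      using hb hm' by (intro pr.integrable_const_bound[where B="C * (\<gamma> t * B)"])
        (auto simp: space_pair_measure spG)
    have "expectation (\<lambda>p. Z p * (\<gamma> t * \<psi> t (x t p, \<omega> t p))) = expectation (\<lambda>p. h (p, \<omega> t p))"
      unfolding h_def by simp
    also have "\<dots> = integral\<^sup>L (distr M (G t \<Otimes>\<^sub>M \<mu> t) (\<lambda>p. (p, \<omega> t p))) h"
      using integral_distr[OF pairm hm] by simp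
    also have "\<dots> = (\<integral>p. (\<integral>w. h (p, w) \<partial>\<mu> t) \<partial>?P)"
      unfolding joint[symmetric] by (rule pr.integral_fst'[OF hint, symmetric])
    also have "\<dots> = (\<integral>p. 0 \<partial>?P)"
      using centred[OF xs] by (intro Bochner_Integration.integral_cong) (auto simp: h_def spG)
    finally show "expectation (\<lambda>p. Z p * (\<gamma> t * \<psi> t (x t p, \<omega> t p))) = 0" by simp
  qed
qed

end

text \<open>
  If the sample spaces are finite then the state space may carry the discrete structure, for which
  measurability of the recursion is automatic.
\<close>

lemma measurable_discrete_pair:
  assumes "countable (space N)" "sets N = Pow (space N)" "\<And>y w. w \<in> space N \<Longrightarrow> f (y, w) \<in> space L"
  shows "f \<in> count_space UNIV \<Otimes>\<^sub>M N \<rightarrow>\<^sub>M L"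
proof -
  have "(\<lambda>(w, y). f (y, w)) \<in> count_space (space N) \<Otimes>\<^sub>M count_space UNIV \<rightarrow>\<^sub>M L"
    by (rule measurable_pair_measure_countable1) (use assms in auto)
  moreover have "sets (N \<Otimes>\<^sub>M count_space UNIV) = sets (count_space (space N) \<Otimes>\<^sub>M count_space UNIV)"
    using assms(2) by (intro sets_pair_measure_cong) auto
  ultimately have "(\<lambda>(w, y). f (y, w)) \<in> N \<Otimes>\<^sub>M count_space UNIV \<rightarrow>\<^sub>M L"
    using measurable_cong_sets by blast
  then show ?thesis by (subst measurable_pair_swap_iff)
qed

section \<open>Sequences of slow growth\<close>

text \<open>
  Infinitely many returns below a level \<open>e\<close> are forced by the divergence of the sum of the \<open>a t\<close>.
  A later climb above this level by at least \<open>e\<close> needs, by slow growth, a stretch of indices on which the \<open>a t\<close>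
  sum up to a multiple of \<open>e\<close> while \<open>b\<close> is at least \<open>e\<close>; far out the convergence of the sum of \<open>a t * (b t)\<^sup>2\<close>
  leaves no room for that.
\<close>

lemma vanishes_of_slow_growth:
  fixes b a :: "nat \<Rightarrow> real"
  assumes b: "\<And>t. 0 \<le> b t" and a: "\<And>t. 0 \<le> a t"
    and a_lim: "a \<longlonglongrightarrow> 0"
    and a_sum: "filterlim (\<lambda>n. \<Sum>t<n. a t) at_top sequentially"
    and ab: "summable (\<lambda>t. a t * (b t)\<^sup>2)"
    and C: "0 \<le> C" and slow: "\<And>t. b (Suc t) \<le> b t + C * a t"
  shows "b \<longlonglongrightarrow> 0"
proof (rule LIMSEQ_I)
  fix r :: real assume r: "0 < r"
  define e where "e = r / 4"
  have e: "0 < e" using r by (simp add: e_def)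
  have e2: "0 < e\<^sup>2 * (e / (C + 1))" "0 < e / (C + 1)" using e C by auto
  obtain N1 where N1: "\<And>t. t \<ge> N1 \<Longrightarrow> norm (a t - 0) < e / (C + 1)"
    using LIMSEQ_D[OF a_lim e2(2)] by auto
  obtain N2 where N2: "\<And>m n. m \<ge> N2 \<Longrightarrow> norm (\<Sum>t=m..<n. a t * (b t)\<^sup>2) < e\<^sup>2 * (e / (C + 1))"
    using ab[unfolded summable_Cauchy] e2(1) by meson
  define N where "N = max N1 N2"
  have "\<exists>m\<ge>N. b m < e"
  proof (rule ccontr)
    assume "\<not> ?thesis"
    then have ge: "e \<le> b t" if "t \<ge> N" for t using that by force
    have "summable (\<lambda>t. a (t + N))"
    proof (rule summable_comparison_test)
      show "summable (\<lambda>t. (a (t + N) * (b (t + N))\<^sup>2) / e\<^sup>2)"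
        using ab by (intro summable_divide) (subst summable_iff_shift)
      have "a t \<le> a t * (b t)\<^sup>2 / e\<^sup>2" if "t \<ge> N" for t
      proof -
        have "e\<^sup>2 \<le> (b t)\<^sup>2" using ge[OF that] e by (intro power_mono) auto
        then have "a t * e\<^sup>2 \<le> a t * (b t)\<^sup>2" using a[of t] by (intro mult_left_mono)
        then show ?thesis using e by (simp add: field_simps)
      qed
      then show "\<exists>M. \<forall>n\<ge>M. norm (a (n + N)) \<le> a (n + N) * (b (n + N))\<^sup>2 / e\<^sup>2"
        using a by auto
    qed
    then have "summable a" by (subst (asm) summable_iff_shift)
    then have "(\<lambda>n. \<Sum>t<n. a t) \<longlonglongrightarrow> suminf a" by (rule summable_LIMSEQ)
    then show False
      using a_sum not_tendsto_and_filterlim_at_infinity[of sequentially]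
        filterlim_at_top_imp_at_infinity sequentially_bot by blast
  qed
  then obtain m where m: "m \<ge> N" "b m < e" by blast
  \<comment> \<open>A step from below \<open>e\<close> restarts the bound; a step from above
    \<open>e\<close> costs at most \<open>C * a t\<close>, which is paid for by the term \<open>a t
    * (b t)\<^sup>2\<close> of the sum.\<close>
  have inv: "b (m + k) \<le> 2 * e + C / e\<^sup>2 * (\<Sum>t=m..<m + k. a t * (b t)\<^sup>2)" for k
  proof (induction k)
    case 0
    then show ?case using m(2) e by simp
  next
    case (Suc k)
    have step: "b (m + Suc k) \<le> b (m + k) + C * a (m + k)" using slow[of "m + k"] by simp
    have nn: "0 \<le> C / e\<^sup>2 * (\<Sum>t=m..<m + Suc k. a t * (b t)\<^sup>2)"
      using C a by (intro mult_nonneg_nonneg sum_nonneg) auto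
    show ?case
    proof (cases "b (m + k) < e")
      case True
      have "C * a (m + k) \<le> C * (e / (C + 1))"
        using N1[of "m + k"] m(1) C unfolding N_def by (intro mult_left_mono) auto
      also have "\<dots> \<le> e" using e C by (simp add: field_simps)
      finally show ?thesis using True step nn by linarith
    next
      case False
      have "e\<^sup>2 \<le> (b (m + k))\<^sup>2" using False e by (intro power_mono) auto
      then have "a (m + k) * e\<^sup>2 \<le> a (m + k) * (b (m + k))\<^sup>2"
        using a by (rule mult_left_mono)
      then have "C / e\<^sup>2 * (a (m + k) * e\<^sup>2) \<le> C / e\<^sup>2 * (a (m + k) * (b (m + k))\<^sup>2)"
        by (rule mult_left_mono) (use C in simp)
      then have "C * a (m + k) \<le> C / e\<^sup>2 * (a (m + k) * (b (m + k))\<^sup>2)" using e by simp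
      then show ?thesis using Suc step by (simp add: distrib_left)
    qed
  qed
  have "norm (b n - 0) < r" if nm: "n \<ge> m" for n
  proof -
    obtain k where k: "n = m + k" using le_Suc_ex[OF nm] by blast
    have "(\<Sum>t=m..<m + k. a t * (b t)\<^sup>2) \<le> e\<^sup>2 * (e / (C + 1))"
      using N2[of m "m + k"] m(1) unfolding N_def by auto
    then have "C / e\<^sup>2 * (\<Sum>t=m..<m + k. a t * (b t)\<^sup>2) \<le> C / e\<^sup>2 * (e\<^sup>2 * (e / (C + 1)))"
      using C by (intro mult_left_mono) auto
    also have "\<dots> = C * (e / (C + 1))" using e by simp
    also have "\<dots> \<le> e" using e C by (simp add: field_simps)
    finally have "b n \<le> 3 * e" using inv[of k] k by simp
    then show ?thesis using b[of n] r unfolding e_def by auto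
  qed
  then show "\<exists>no. \<forall>n\<ge>no. norm (b n - 0) < r" by blast
qed

section \<open>Convergence of stochastic gradient descent\<close>

theorem theorem2p4:
  fixes \<A> :: "('a::{t2_space, second_countable_topology}, 'e::euclidean_space) chart set"
    and g :: "('a, 'e) metric"
    and R :: "'a \<times> ('a, 'e) tvec \<Rightarrow> 'a"
    and F :: "'a \<Rightarrow> real"
    and K :: "'a set"
    and A :: real
    and \<mu> :: "nat \<Rightarrow> 'w measure"
    and H :: "nat \<Rightarrow> 'a \<Rightarrow> 'w \<Rightarrow> ('a, 'e) tvec"
    and P :: "'p measure"
    and \<omega> :: "nat \<Rightarrow> 'p \<Rightarrow> 'w"
    and \<gamma> :: "nat \<Rightarrow> real"
    and x\<^sub>0 :: 'a
    and x :: "nat \<Rightarrow> 'p \<Rightarrow> 'a"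
  assumes manifold: "riemannian_manifold \<A> g"
    and conn: "connected (UNIV :: 'a set)"
    and retr: "manifold_retraction \<A> R"
    and F_C1: "Ck_function 1 \<A> F"
    and K: "compact K"
    and A: "A > 0"
    and lip: "R_lipschitz_on \<A> g R K A (gradient \<A> g F)"
    and prob: "\<And>t. prob_space (\<mu> t)"
    and H_field: "\<And>t w. w \<in> space (\<mu> t) \<Longrightarrow> vector_field \<A> (\<lambda>y. H t y w)"
    and H_meas:
      "(\<forall>t. finite (space (\<mu> t)) \<and> sets (\<mu> t) = Pow (space (\<mu> t))) \<or>
       (\<forall>t. (\<lambda>(y, w). (y, H t y w)) \<in> borel \<Otimes>\<^sub>M \<mu> t \<rightarrow>\<^sub>M tangent_borel \<A>)"
    and H_mean: "\<And>t y. has_tangent_integral \<A> y (\<mu> t) (H t y) (gradient \<A> g F y)"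
    and H_bound: "\<And>t y w. y \<in> K \<Longrightarrow> w \<in> space (\<mu> t) \<Longrightarrow> tnorm g y (H t y w) \<le> A"
    and P: "prob_space P"
    and indep: "prob_space.indep_vars P \<mu> \<omega> UNIV"
    and distr: "\<And>t. distr P (\<mu> t) (\<omega> t) = \<mu> t"
    and \<gamma>_pos: "\<And>t. \<gamma> t > 0"
    and \<gamma>_sq: "summable (\<lambda>t. (\<gamma> t)\<^sup>2)"
    and \<gamma>_sum: "filterlim (\<lambda>n. \<Sum>t<n. \<gamma> t) at_top sequentially"
    and \<gamma>_le: "\<And>t. \<gamma> t \<le> 1"
    and x\<^sub>0: "x\<^sub>0 \<in> K"
    and x_0: "\<And>p. p \<in> space P \<Longrightarrow> x 0 p = x\<^sub>0"
    and x_Suc: "\<And>t p. p \<in> space P \<Longrightarrow>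
      x (Suc t) p = R (x t p, - (\<gamma> t *\<^sub>R H t (x t p) (\<omega> t p)))"
    and x_K: "\<And>t p. p \<in> space P \<Longrightarrow> x t p \<in> K"
  shows "(AE p in P. convergent (\<lambda>t. F (x t p))) \<and>
    (AE p in P. (\<lambda>t. tnorm g (x t p) (gradient \<A> g F (x t p))) \<longlonglongrightarrow> 0) \<and>
    (\<forall>t. integrable P (\<lambda>p. (tnorm g (x t p) (gradient \<A> g F (x t p)))\<^sup>2)) \<and>
    (\<lambda>t. prob_space.expectation P (\<lambda>p. (tnorm g (x t p) (gradient \<A> g F (x t p)))\<^sup>2)) \<longlonglongrightarrow> 0"
proof -
  interpret riemannian_retraction \<A> g R
    by (intro riemannian_retraction.intro manifold riemannian_retraction_axioms.intro retr)
  interpret P: prob_space P by (rule P)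
  define b where "b y = tnorm g y (gradient \<A> g F y)" for y
  define D where "D t y w = differential \<A> F y (H t y w)" for t y w
  \<comment> \<open>Off \<open>K\<close> the samples may be unbounded; trajectories stay in
    \<open>K\<close>, so the indicator does not change their increments.\<close>
  define \<psi> where "\<psi> t z = indicator K (fst z) * ((b (fst z))\<^sup>2 - D t (fst z) (snd z))" for t z
  define T where "T t z = R (fst z, (- \<gamma> t) *\<^sub>R H t (fst z) (snd z))" for t z
  have H_in: "H t y w \<in> tangent_space \<A> y" if "w \<in> space (\<mu> t)" for t y w
    using H_field[OF that] unfolding vector_field_def by blast
  have b0: "0 \<le> b y" for y unfolding b_def using F_C1 by simp
  have b_cont: "continuous_on UNIV b" unfolding b_def by (rule tnorm_gradient_continuous[OF F_C1])
  have "compact (b ` K)" by (rule compact_continuous_image[OF continuous_on_subset[OF b_cont] K]) simp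
  then obtain B where "\<forall>y\<in>K. \<bar>b y\<bar> \<le> B" by (auto dest!: compact_imp_bounded simp: bounded_iff)
  then have B: "b y \<le> B" if "y \<in> K" for y using that by force
  have B0: "0 \<le> B" using order_trans[OF b0 B[OF x\<^sub>0]] .
  have D_le: "\<bar>D t y w\<bar> \<le> B * A" if "y \<in> K" "w \<in> space (\<mu> t)" for t y w
  proof -
    have "\<bar>D t y w\<bar> \<le> b y * tnorm g y (H t y w)"
      unfolding D_def b_def metric_gradient[OF F_C1 H_in[OF that(2)], symmetric]
      by (rule metric_Cauchy_Schwarz[OF gradient_in[OF F_C1] H_in[OF that(2)]])
    also have "\<dots> \<le> B * A" using B[OF that(1)] H_bound[OF that] B0 H_in[OF that(2)] by (intro mult_mono) auto
    finally show ?thesis .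
  qed
  have D_mean: "has_bochner_integral (\<mu> t) (D t y) ((b y)\<^sup>2)" for t y
  proof -
    obtain c where c: "c \<in> \<A>" "y \<in> chart_dom c" by (rule ex_chart)
    let ?L = "frechet_derivative (F \<circ> chart_inv c) (at (chart_map c y))"
    have "bounded_linear ?L"
      using has_derivative_bounded_linear[OF C1_function_chart_has_derivative[OF F_C1 c(1)]] c by simp
    moreover have "has_bochner_integral (\<mu> t) (\<lambda>w. H t y w c) (gradient \<A> g F y c)"
      using H_mean[of y t] c unfolding has_tangent_integral_def by simp
    ultimately have "has_bochner_integral (\<mu> t) (\<lambda>w. ?L (H t y w c)) (?L (gradient \<A> g F y c))"
      by (rule has_bochner_integral_bounded_linear)
    moreover have "(b y)\<^sup>2 = ?L (gradient \<A> g F y c)"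
      unfolding b_def tnorm_gradient_sq[OF F_C1] by (rule differential_chart[OF F_C1 c gradient_in[OF F_C1]])
    moreover have "D t y w = ?L (H t y w c)" if "w \<in> space (\<mu> t)" for w
      unfolding D_def by (rule differential_chart[OF F_C1 c H_in[OF that]])
    ultimately show ?thesis using has_bochner_integral_cong[of "\<mu> t" "\<mu> t" "D t y"] by force
  qed
  have \<psi>_bound: "\<bar>\<psi> t (y, w)\<bar> \<le> B\<^sup>2 + B * A" if "w \<in> space (\<mu> t)" for t y w
  proof (cases "y \<in> K")
    case True
    have "(b y)\<^sup>2 \<le> B\<^sup>2" using B[OF True] b0 by (intro power_mono)
    moreover have "0 \<le> (b y)\<^sup>2" by simp
    ultimately have "\<bar>(b y)\<^sup>2 - D t y w\<bar> \<le> B\<^sup>2 + B * A" using D_le[OF True that] by linarith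
    then show ?thesis using True by (simp add: \<psi>_def)
  qed (use B0 A in \<open>simp add: \<psi>_def\<close>)
  have \<psi>_mean: "(\<integral>w. \<psi> t (y, w) \<partial>\<mu> t) = 0" for t y
  proof -
    interpret prob_space "\<mu> t" by (rule prob)
    have "integral\<^sup>L (\<mu> t) (D t y) = (b y)\<^sup>2" "integrable (\<mu> t) (D t y)"
      using D_mean[of t y] has_bochner_integral_integral_eq integrable.intros by blast+
    then show ?thesis by (simp add: \<psi>_def prob_space)
  qed
  \<comment> \<open>The discrete structure serves the finite alternative of the measurability
    hypothesis, the Borel structure the other one.\<close>
  obtain N :: "'a measure" where N: "space N = UNIV" "b \<in> borel_measurable N"
    "\<And>t. T t \<in> N \<Otimes>\<^sub>M \<mu> t \<rightarrow>\<^sub>M N" "\<And>t. \<psi> t \<in> borel_measurable (N \<Otimes>\<^sub>M \<mu> t)"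
  proof (cases "\<forall>t. finite (space (\<mu> t)) \<and> sets (\<mu> t) = Pow (space (\<mu> t))")
    case True
    show thesis
    proof (rule that[of "count_space UNIV"])
      show "T t \<in> count_space UNIV \<Otimes>\<^sub>M \<mu> t \<rightarrow>\<^sub>M count_space UNIV" for t
        using True by (intro measurable_discrete_pair) (auto intro: countable_finite)
      show "\<psi> t \<in> borel_measurable (count_space UNIV \<Otimes>\<^sub>M \<mu> t)" for t
        using True by (intro measurable_discrete_pair) (auto intro: countable_finite)
    qed auto
  next
    case False
    then have meas: "(\<lambda>(y, w). (y, H t y w)) \<in> borel \<Otimes>\<^sub>M \<mu> t \<rightarrow>\<^sub>M tangent_borel \<A>" for t using H_meas by blast
    have b_meas: "b \<in> borel_measurable borel" by (rule borel_measurable_continuous_onI[OF b_cont])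
    show thesis
    proof (rule that[of borel])
      fix t
      have "continuous_map (tangent_topology \<A>) euclidean (R \<circ> (\<lambda>(y, v). (y, (- \<gamma> t) *\<^sub>R v)))"
        by (rule continuous_map_compose[OF tangent_scaling_continuous retraction_continuous])
      from measurable_compose[OF meas tangent_borel_measurable[OF this]]
      show "T t \<in> borel \<Otimes>\<^sub>M \<mu> t \<rightarrow>\<^sub>M borel" by (simp add: T_def[abs_def] case_prod_beta)
      have "(\<lambda>z. D t (fst z) (snd z)) \<in> borel_measurable (borel \<Otimes>\<^sub>M \<mu> t)"
        using measurable_compose[OF meas tangent_borel_measurable[OF differential_continuous[OF F_C1]]]
        by (simp add: D_def[abs_def] case_prod_beta)
      moreover have "(\<lambda>z. b (fst z)) \<in> borel_measurable (borel \<Otimes>\<^sub>M \<mu> t)"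
        by (rule measurable_compose[OF measurable_fst b_meas])
      moreover have "(\<lambda>z. indicator K (fst z) :: real) \<in> borel_measurable (borel \<Otimes>\<^sub>M \<mu> t)"
        using compact_imp_closed[OF K]
        by (intro measurable_compose[OF measurable_fst] borel_measurable_indicator) auto
      ultimately show "\<psi> t \<in> borel_measurable (borel \<Otimes>\<^sub>M \<mu> t)"
        unfolding \<psi>_def[abs_def] by (intro borel_measurable_times borel_measurable_diff borel_measurable_power)
    qed (auto intro: b_meas)
  qed
  have \<omega>_in: "\<omega> t p \<in> space (\<mu> t)" if "p \<in> space P" for t p
    using indep that unfolding P.indep_vars_def2 by (auto dest: measurable_space)
  have x_T: "x (Suc t) p = T t (x t p, \<omega> t p)" if "p \<in> space P" for t p
    using x_Suc[OF that, of t] by (simp add: T_def)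
  have \<psi>_sum: "AE p in P. summable (\<lambda>t. \<gamma> t * \<psi> t (x t p, \<omega> t p))"
    by (rule P.centred_increments_summable(1)[where N=N and T=T and B="B\<^sup>2 + B * A" and ?x0.0=x\<^sub>0 and \<mu>=\<mu>])
      (use prob indep distr N \<psi>_bound \<psi>_mean x_0 x_T \<gamma>_pos \<gamma>_sq in \<open>auto intro: less_imp_le\<close>)
  have x_meas: "x t \<in> P \<rightarrow>\<^sub>M N" for t
    by (rule P.centred_increments_summable(2)[where T=T and \<psi>=\<psi> and \<gamma>=\<gamma> and B="B\<^sup>2 + B * A" and ?x0.0=x\<^sub>0 and \<mu>=\<mu>])
      (use prob indep distr N \<psi>_bound \<psi>_mean x_0 x_T \<gamma>_pos \<gamma>_sq in \<open>auto intro: less_imp_le\<close>)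
  obtain C where C: "0 < C" "\<And>y u. y \<in> K \<Longrightarrow> u \<in> tangent_space \<A> y \<Longrightarrow> tnorm g y u \<le> A \<Longrightarrow>
      tnorm g y (adj_fibre_differential \<A> g R y u (gradient \<A> g F (R (y, u))) - gradient \<A> g F y) \<le> C * tnorm g y u"
    using lip unfolding R_lipschitz_on_def by auto
  obtain C' where C': "0 \<le> C'" "\<And>y u. y \<in> K \<Longrightarrow> u \<in> tangent_space \<A> y \<Longrightarrow> tnorm g y u \<le> A \<Longrightarrow>
      R (y, u) \<in> K \<Longrightarrow> b (R (y, u)) \<le> b y + C' * tnorm g y u"
    using gradient_norm_growth[OF F_C1 K lip] unfolding b_def by blast
  have "compact (F ` K)"
    by (rule compact_continuous_image[OF continuous_on_subset[OF C1_function_continuous[OF F_C1]] K]) simp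
  then obtain BF where "\<forall>y\<in>K. \<bar>F y\<bar> \<le> BF" by (auto dest!: compact_imp_bounded simp: bounded_iff)
  then have BF: "\<bar>F y\<bar> \<le> BF" if "y \<in> K" for y using that by blast
  have \<gamma>_0: "\<gamma> \<longlonglongrightarrow> 0"
  proof -
    have "(\<lambda>t. sqrt ((\<gamma> t)\<^sup>2)) \<longlonglongrightarrow> sqrt 0" by (intro tendsto_real_sqrt summable_LIMSEQ_zero \<gamma>_sq)
    then show ?thesis using \<gamma>_pos by (simp add: less_imp_le)
  qed
  have path: "convergent (\<lambda>t. F (x t p)) \<and> (\<lambda>t. b (x t p)) \<longlonglongrightarrow> 0"
    if p: "p \<in> space P" and sum: "summable (\<lambda>t. \<gamma> t * \<psi> t (x t p, \<omega> t p))" for p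
  proof -
    define u where "u t = (- \<gamma> t) *\<^sub>R H t (x t p) (\<omega> t p)" for t
    have xK: "x t p \<in> K" for t by (rule x_K[OF p])
    have Hin: "H t (x t p) (\<omega> t p) \<in> tangent_space \<A> (x t p)" for t by (rule H_in[OF \<omega>_in[OF p]])
    have u_in: "u t \<in> tangent_space \<A> (x t p)" for t unfolding u_def using Hin by simp
    have xs: "x (Suc t) p = R (x t p, u t)" for t using x_Suc[OF p] by (simp add: u_def)
    have u_le: "tnorm g (x t p) (u t) \<le> \<gamma> t * A" for t
      using H_bound[OF xK \<omega>_in[OF p]] \<gamma>_pos[of t] unfolding u_def tnorm_scaleR[OF Hin] by (simp add: mult_left_mono)
    have u_A: "tnorm g (x t p) (u t) \<le> A" for t
    proof -
      have "\<gamma> t * A \<le> 1 * A" using \<gamma>_le[of t] A by (intro mult_right_mono) auto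
      then show ?thesis using u_le[of t] by linarith
    qed
    \<comment> \<open>The Taylor remainder of the step at time \<open>t\<close>.\<close>
    define d where "d t = F (x (Suc t) p) - F (x t p) - differential \<A> F (x t p) (u t)" for t
    have d_le: "\<bar>d t\<bar> \<le> C * A\<^sup>2 * (\<gamma> t)\<^sup>2" for t
    proof -
      have "\<bar>d t\<bar> \<le> C * (tnorm g (x t p) (u t))\<^sup>2"
        unfolding d_def xs by (rule retraction_Taylor[OF F_C1 _ C(2)[OF xK] u_in u_A]) (use C in auto)
      also have "\<dots> \<le> C * (\<gamma> t * A)\<^sup>2" using u_le u_in C(1) by (intro mult_left_mono power_mono) auto
      finally show ?thesis by (simp add: power_mult_distrib mult_ac)
    qed
    have d_sum: "summable d"
      by (rule summable_comparison_test[OF _ summable_mult[OF \<gamma>_sq, of "C * A\<^sup>2"]]) (use d_le in auto)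
    let ?m = "\<lambda>t. \<gamma> t * \<psi> t (x t p, \<omega> t p)"
    have step: "F (x (Suc t) p) - F (x t p) = ?m t - \<gamma> t * (b (x t p))\<^sup>2 + d t" for t
      using differential_scaleR[OF F_C1 Hin[of t], of "- \<gamma> t"] xK[of t]
      by (simp add: d_def \<psi>_def D_def u_def algebra_simps)
    have tele: "F (x n p) = F (x 0 p) + (\<Sum>t<n. ?m t - \<gamma> t * (b (x t p))\<^sup>2 + d t)" for n
      using sum_lessThan_telescope[of "\<lambda>t. F (x t p)" n] by (simp add: step)
    have "summable (\<lambda>t. ?m t + d t)" by (intro summable_add sum d_sum)
    then have "Bseq (\<lambda>n. \<Sum>t<n. ?m t + d t)" by (intro convergent_imp_Bseq) (simp add: summable_iff_convergent)
    then obtain L where L: "\<And>n. \<bar>\<Sum>t<n. ?m t + d t\<bar> \<le> L" unfolding Bseq_def by auto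
    have gb: "summable (\<lambda>t. \<gamma> t * (b (x t p))\<^sup>2)"
    proof (rule summableI_nonneg_bounded)
      show "0 \<le> \<gamma> t * (b (x t p))\<^sup>2" for t using \<gamma>_pos[of t] by simp
      fix n
      have "(\<Sum>t<n. \<gamma> t * (b (x t p))\<^sup>2) = (\<Sum>t<n. ?m t + d t) - F (x n p) + F (x 0 p)"
        unfolding tele[of n] by (simp add: sum.distrib sum_subtractf)
      also have "\<dots> \<le> L + BF + BF" using L[of n] BF[OF xK[of n]] BF[OF xK[of 0]] by linarith
      finally show "(\<Sum>t<n. \<gamma> t * (b (x t p))\<^sup>2) \<le> L + BF + BF" .
    qed
    have "summable (\<lambda>t. ?m t - \<gamma> t * (b (x t p))\<^sup>2 + d t)"
      by (intro summable_add summable_diff sum gb d_sum)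
    then have "convergent (\<lambda>n. \<Sum>t<n. ?m t - \<gamma> t * (b (x t p))\<^sup>2 + d t)" by (simp add: summable_iff_convergent)
    then have "convergent (\<lambda>n. F (x 0 p) + (\<Sum>t<n. ?m t - \<gamma> t * (b (x t p))\<^sup>2 + d t))"
      by (intro convergent_add convergent_const)
    then have "convergent (\<lambda>n. F (x n p))" unfolding tele[symmetric] .
    moreover have "(\<lambda>t. b (x t p)) \<longlonglongrightarrow> 0"
    proof (rule vanishes_of_slow_growth[OF b0 _ \<gamma>_0 \<gamma>_sum gb])
      show "0 \<le> C' * A" using C' A by simp
      show "0 \<le> \<gamma> t" for t using \<gamma>_pos[of t] by simp
      fix t
      have "b (x (Suc t) p) \<le> b (x t p) + C' * tnorm g (x t p) (u t)"
        using C'(2)[OF xK u_in u_A, of t] xK[of "Suc t"] unfolding xs by simp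
      also have "\<dots> \<le> b (x t p) + C' * (\<gamma> t * A)" using u_le C'(1) by (intro add_left_mono mult_left_mono)
      finally show "b (x (Suc t) p) \<le> b (x t p) + C' * A * \<gamma> t" by (simp add: mult_ac)
    qed
    ultimately show ?thesis by blast
  qed
  have conv: "AE p in P. convergent (\<lambda>t. F (x t p))" and lim: "AE p in P. (\<lambda>t. b (x t p)) \<longlonglongrightarrow> 0"
    using \<psi>_sum by (rule AE_mp, intro AE_I2, use path in blast)+
  have bx_meas: "(\<lambda>p. (b (x t p))\<^sup>2) \<in> borel_measurable P" for t
    using measurable_compose[OF x_meas N(2)] by simp
  have bx_le: "norm ((b (x t p))\<^sup>2) \<le> B\<^sup>2" if "p \<in> space P" for t p
    using B[OF x_K[OF that]] b0 by (simp add: power_mono)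
  have int: "integrable P (\<lambda>p. (b (x t p))\<^sup>2)" for t
    by (rule P.integrable_const_bound[OF AE_I2 bx_meas]) (rule bx_le)
  have "(\<lambda>t. P.expectation (\<lambda>p. (b (x t p))\<^sup>2)) \<longlonglongrightarrow> P.expectation (\<lambda>p. 0)"
  proof (rule integral_dominated_convergence[where w="\<lambda>_. B\<^sup>2"])
    show "AE p in P. (\<lambda>t. (b (x t p))\<^sup>2) \<longlonglongrightarrow> 0"
      using lim by (rule AE_mp, intro AE_I2 impI) (auto intro!: tendsto_eq_intros)
  qed (use bx_meas bx_le in auto)
  then show ?thesis using conv lim int unfolding b_def by simp
qed

end
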